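(* Let $\mathcal{G}$ be the class of forests and let $G_n$ be chosen uniformly at random from all forests with vertex set $\{1,\dots,n\}$. Then \[\overline{\{\lim_{n\to\infty}\Pr(G_n\models\varphi):\varphi\text{ an MSO sentence}\}} = [0,1-(1+e^{-1})e^{-1/2}]\cup[e^{-3/2},1-e^{-1/2}]\cup[e^{-1/2},1-e^{-3/2}]\cup[(1+e^{-1})e^{-1/2},1],\] where the bar denotes topological closure in $\mathbb{R}$.
   Context: MSO is monadic second-order logic of graphs: first-order logic (vertex variables, $=$, adjacency) enriched with quantification over sets of vertices and membership. The limits exist. *)

theory Defs
  imports "HOL-Probability.Probability"
begin

section \<open>Graphs and forests\<close>

text \<open>
  A graph is a pair of a vertex set and a set of edges, the edges being two-element sets of
  vertices. The predicate \<open>forest\<close> of the AFP entry \<open>Graph_Theory\<close> is not used: it is meant for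
  digraphs, and in a symmetric digraph the two arcs of any edge already form a cycle.
\<close>

type_synonym 'a graph = "'a set \<times> 'a set set"

abbreviation vertices :: "'a graph \<Rightarrow> 'a set" where
  "vertices G \<equiv> fst G"

abbreviation edges :: "'a graph \<Rightarrow> 'a set set" where
  "edges G \<equiv> snd G"

definition simple_graph :: "'a graph \<Rightarrow> bool" where
  "simple_graph G \<longleftrightarrow> (\<forall>e\<in>edges G. e \<subseteq> vertices G \<and> card e = 2)"

text \<open>A cycle is given by the list of its vertices, without repetition of the first one.\<close>

definition is_cycle :: "'a graph \<Rightarrow> 'a list \<Rightarrow> bool" where
  "is_cycle G p \<longleftrightarrow> length p \<ge> 3 \<and> distinct p \<and>
     (\<forall>i<length p. {p ! i, p ! (Suc i mod length p)} \<in> edges G)"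

definition forest :: "'a graph \<Rightarrow> bool" where
  "forest G \<longleftrightarrow> simple_graph G \<and> (\<nexists>p. is_cycle G p)"

definition forests :: "nat \<Rightarrow> nat graph set" where
  "forests n = {G. vertices G = {1..n} \<and> forest G}"

lemma finite_forests: "finite (forests n)"
proof (rule finite_subset)
  show "forests n \<subseteq> {{1..n}} \<times> Pow (Pow {1..n})"
    by (force simp: forests_def forest_def simple_graph_def simp del: One_nat_def atLeastAtMost_iff)
qed simp

lemma forests_nonempty: "forests n \<noteq> {}"
proof -
  have "\<not> is_cycle ({1..n}, {}) p" for p
    by (cases p) (auto simp: is_cycle_def)
  then have "({1..n}, {}) \<in> forests n"
    by (auto simp: forests_def forest_def simple_graph_def)
  then show ?thesis by blast
qed


section \<open>Monadic second-order logic of graphs\<close>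

text \<open>
  Vertex variables and set variables are taken from two separate copies of \<^typ>\<open>nat\<close>. The other
  connectives and the universal quantifiers are the usual abbreviations.
\<close>

datatype mso =
    Eq nat nat
  | Adj nat nat
  | Mem nat nat   \<comment> \<open>vertex variable, set variable\<close>
  | Neg mso
  | Conj mso mso
  | ExVertex nat mso
  | ExSet nat mso

primrec free_vertex_vars :: "mso \<Rightarrow> nat set" where
  "free_vertex_vars (Eq x y) = {x, y}"
| "free_vertex_vars (Adj x y) = {x, y}"
| "free_vertex_vars (Mem x X) = {x}"
| "free_vertex_vars (Neg \<phi>) = free_vertex_vars \<phi>"
| "free_vertex_vars (Conj \<phi> \<psi>) = free_vertex_vars \<phi> \<union> free_vertex_vars \<psi>"
| "free_vertex_vars (ExVertex x \<phi>) = free_vertex_vars \<phi> - {x}"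
| "free_vertex_vars (ExSet X \<phi>) = free_vertex_vars \<phi>"

primrec free_set_vars :: "mso \<Rightarrow> nat set" where
  "free_set_vars (Eq x y) = {}"
| "free_set_vars (Adj x y) = {}"
| "free_set_vars (Mem x X) = {X}"
| "free_set_vars (Neg \<phi>) = free_set_vars \<phi>"
| "free_set_vars (Conj \<phi> \<psi>) = free_set_vars \<phi> \<union> free_set_vars \<psi>"
| "free_set_vars (ExVertex x \<phi>) = free_set_vars \<phi>"
| "free_set_vars (ExSet X \<phi>) = free_set_vars \<phi> - {X}"

definition mso_sentence :: "mso \<Rightarrow> bool" where
  "mso_sentence \<phi> \<longleftrightarrow> free_vertex_vars \<phi> = {} \<and> free_set_vars \<phi> = {}"

primrec sat :: "'a graph \<Rightarrow> (nat \<Rightarrow> 'a) \<Rightarrow> (nat \<Rightarrow> 'a set) \<Rightarrow> mso \<Rightarrow> bool" where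
  "sat G v S (Eq x y) \<longleftrightarrow> v x = v y"
| "sat G v S (Adj x y) \<longleftrightarrow> {v x, v y} \<in> edges G"
| "sat G v S (Mem x X) \<longleftrightarrow> v x \<in> S X"
| "sat G v S (Neg \<phi>) \<longleftrightarrow> \<not> sat G v S \<phi>"
| "sat G v S (Conj \<phi> \<psi>) \<longleftrightarrow> sat G v S \<phi> \<and> sat G v S \<psi>"
| "sat G v S (ExVertex x \<phi>) \<longleftrightarrow> (\<exists>a\<in>vertices G. sat G (v(x := a)) S \<phi>)"
| "sat G v S (ExSet X \<phi>) \<longleftrightarrow> (\<exists>A\<subseteq>vertices G. sat G v (S(X := A)) \<phi>)"

text \<open>
  The assignments in the following definition are not required to take their values in the graph
  (which may be empty). For sentences they are irrelevant, as \<open>models_iff_sat\<close> shows.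
\<close>

definition models :: "'a graph \<Rightarrow> mso \<Rightarrow> bool"  (infix \<open>\<Turnstile>\<close> 50) where
  "G \<Turnstile> \<phi> \<longleftrightarrow> (\<forall>v S. sat G v S \<phi>)"

lemma sat_cong:
  assumes "\<And>x. x \<in> free_vertex_vars \<phi> \<Longrightarrow> v x = v' x"
    and "\<And>X. X \<in> free_set_vars \<phi> \<Longrightarrow> S X = S' X"
  shows "sat G v S \<phi> \<longleftrightarrow> sat G v' S' \<phi>"
  using assms
proof (induction \<phi> arbitrary: v v' S S')
  case (Conj \<phi> \<psi>)
  have "sat G v S \<phi> \<longleftrightarrow> sat G v' S' \<phi>" "sat G v S \<psi> \<longleftrightarrow> sat G v' S' \<psi>"
    using Conj.prems by (intro Conj.IH; simp)+
  then show ?case by simp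
next
  case (Neg \<phi>)
  have "sat G v S \<phi> \<longleftrightarrow> sat G v' S' \<phi>"
    using Neg.prems by (intro Neg.IH) simp_all
  then show ?case by simp
next
  case (ExVertex x \<phi>)
  have "sat G (v(x := a)) S \<phi> \<longleftrightarrow> sat G (v'(x := a)) S' \<phi>" for a
    using ExVertex.prems by (intro ExVertex.IH) auto
  then show ?case by simp
next
  case (ExSet X \<phi>)
  have "sat G v (S(X := A)) \<phi> \<longleftrightarrow> sat G v' (S'(X := A)) \<phi>" for A
    using ExSet.prems by (intro ExSet.IH) auto
  then show ?case by simp
qed auto

lemma models_iff_sat:
  assumes "mso_sentence \<phi>"
  shows "G \<Turnstile> \<phi> \<longleftrightarrow> sat G v S \<phi>"
proof -
  have "sat G v S \<phi> \<longleftrightarrow> sat G v' S' \<phi>" for v' S'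
    using assms by (intro sat_cong) (auto simp: mso_sentence_def)
  then show ?thesis by (auto simp: models_def)
qed


section \<open>The uniform random forest\<close>

definition random_forest :: "nat \<Rightarrow> nat graph pmf" where
  "random_forest n = pmf_of_set (forests n)"

definition forest_prob :: "mso \<Rightarrow> nat \<Rightarrow> real" where
  "forest_prob \<phi> n = measure_pmf.prob (random_forest n) {G. G \<Turnstile> \<phi>}"

lemma forest_prob_eq: "forest_prob \<phi> n = card {G \<in> forests n. G \<Turnstile> \<phi>} / card (forests n)"
  by (simp add: forest_prob_def random_forest_def measure_pmf_of_set finite_forests
      forests_nonempty Int_def conj_commute)

end

theory Submission
  imports Defs "HOL-Library.Transitive_Closure_Table" "HOL-Real_Asymp.Real_Asymp"
begin

text \<open>
  A large random forest is one giant tree together with a stochastically bounded rest, the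
  fragment. By \<open>t\<^sub>n = n\<^bsup>n-2\<^esup>\<close> and \<open>f\<^sub>n \<sim> e\<^bsup>1/2\<^esup> t\<^sub>n\<close>, the fragment is a given forest on \<open>j\<close> labelled vertices
  (up to order-preserving relabelling) with limiting probability \<open>e\<^bsup>-1/2-j\<^esup> / j!\<close>, and these
  probabilities sum to \<open>1\<close>. For every quantifier rank there is a rooted tree \<open>M\<close> that absorbs every tree in
  which it is pendant: all such trees satisfy the same sentences of that rank as \<open>M\<close>. By the second moment
  method almost every tree contains a pendant \<open>M\<close>, so asymptotically the truth of a sentence depends on the
  isomorphism class of the fragment only; conversely, every finite set of such classes is definable.
  Hence the closure of the limits is the set of subsums of the weights of the isomorphism classes. The
  empty fragment and the single vertex have weights \<open>e\<^bsup>-1/2\<^esup>\<close> and \<open>e\<^bsup>-3/2\<^esup>\<close>; by Kakeya's criterion the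
  subsums of all the other weights fill an interval, which yields the four intervals.
\<close>


section \<open>Forests and trees through edge cuts\<close>

text \<open>The absorbing tree \<open>M\<close> is a star. For every rank-\<open>k\<close> type of
  rooted tree its centre carries more copies than rank \<open>k\<close> can count, so a further tree
  hung on the centre brings nothing new. If \<open>M\<close> is pendant in a tree \<open>T\<close>
  by its centre, then the rest of \<open>T\<close> is such a further tree.

  The constant e^(1/2) comes from the exponential formula at 1/e, the radius of convergence, where
  the generating function of trees has the value 1/2. Since the limiting probabilities of the
  fragments have total mass 1, lower bounds for a property and for its negation already determine
  the limit; large fragments never have to be estimated separately.

  An isomorphism class on j vertices has at most j! labelled members, hence weight at most
  e^(-1/2-j). Kakeya's condition compares this with the weight of all larger fragments. It fails for
  j = 0 and j = 1, where 0.607 > 0.393 and 0.223 > 0.170, and holds from j = 2 on, with little room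
  at j = 2. The intervals are therefore the translates of [0, 1 - e^(-1/2) - e^(-3/2)] by the four
  subsums of e^(-1/2) and e^(-3/2).\<close>

definition cross :: "'a set \<Rightarrow> 'a set \<Rightarrow> bool" where
  "cross X e \<longleftrightarrow> e \<inter> X \<noteq> {} \<and> \<not> e \<subseteq> X"

text \<open>Every edge is a bridge, witnessed by a vertex set that this edge alone crosses. Speaking
  of cuts instead of paths turns the gluing and splitting of forests into set algebra;
  \<open>forest_iff_forests_on\<close> links it to cycles.\<close>

definition acyclic_edges :: "'a set set \<Rightarrow> bool" where
  "acyclic_edges E \<longleftrightarrow> (\<forall>e\<in>E. \<exists>X. {e' \<in> E. cross X e'} = {e})"

definition edges_on :: "'a set \<Rightarrow> 'a set set" where
  "edges_on V = {e. e \<subseteq> V \<and> card e = 2}"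

text \<open>Connectivity in the same language of cuts, which is also the form that a set quantifier
  can express. Nonemptiness keeps the empty graph from being a tree.\<close>

definition connected_on :: "'a set \<Rightarrow> 'a set set \<Rightarrow> bool" where
  "connected_on V E \<longleftrightarrow> V \<noteq> {} \<and> (\<forall>X\<subseteq>V. X \<noteq> {} \<longrightarrow> X \<noteq> V \<longrightarrow> (\<exists>e\<in>E. cross X e))"

definition forests_on :: "'a set \<Rightarrow> 'a set set set" where
  "forests_on V = {E. E \<subseteq> edges_on V \<and> acyclic_edges E}"

definition trees_on :: "'a set \<Rightarrow> 'a set set set" where
  "trees_on V = {E \<in> forests_on V. connected_on V E}"

lemma cross_pair: "cross X {a, b} \<longleftrightarrow> (a \<in> X) \<noteq> (b \<in> X)"
  by (auto simp: cross_def)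

lemma cross_Int: "e \<subseteq> V \<Longrightarrow> cross (X \<inter> V) e \<longleftrightarrow> cross X e"
  by (auto simp: cross_def)

lemma cross_Diff: "e \<subseteq> V \<Longrightarrow> cross (V - X) e \<longleftrightarrow> cross X e"
  by (auto simp: cross_def)

lemma not_cross_subset: "e \<subseteq> X \<Longrightarrow> \<not> cross X e"
  by (auto simp: cross_def)

lemma not_cross_disjoint: "e \<inter> X = {} \<Longrightarrow> \<not> cross X e"
  by (auto simp: cross_def)

lemma edges_onD: "e \<in> edges_on V \<Longrightarrow> e \<subseteq> V"
  by (auto simp: edges_on_def)

lemma edges_onE:
  assumes "e \<in> edges_on V"
  obtains a b where "e = {a, b}" "a \<noteq> b" "a \<in> V" "b \<in> V"
  using assms by (auto simp: edges_on_def card_2_iff)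

lemma edges_on_mono: "A \<subseteq> B \<Longrightarrow> edges_on A \<subseteq> edges_on B"
  by (auto simp: edges_on_def)

lemma edges_on_Int_Pow: "E \<subseteq> edges_on V \<Longrightarrow> E \<inter> Pow A \<subseteq> edges_on A"
  by (auto simp: edges_on_def)

lemma finite_edges_on: "finite V \<Longrightarrow> finite (edges_on V)"
  by (rule finite_subset[of _ "Pow V"]) (auto simp: edges_on_def)

lemma finite_forests_on: "finite V \<Longrightarrow> finite (forests_on V)"
  by (rule finite_subset[of _ "Pow (edges_on V)"]) (auto simp: forests_on_def finite_edges_on)

lemma finite_trees_on: "finite V \<Longrightarrow> finite (trees_on V)"
  by (simp add: trees_on_def finite_forests_on)

lemma forests_on_edges: "E \<in> forests_on V \<Longrightarrow> E \<subseteq> edges_on V"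
  by (simp add: forests_on_def)

lemma forests_on_subset: "E \<in> forests_on V \<Longrightarrow> e \<in> E \<Longrightarrow> e \<subseteq> V"
  by (auto simp: forests_on_def edges_on_def)

lemma trees_on_forests_on: "E \<in> trees_on V \<Longrightarrow> E \<in> forests_on V"
  by (simp add: trees_on_def)

lemma acyclic_edges_mono:
  assumes "acyclic_edges E" "E' \<subseteq> E"
  shows "acyclic_edges E'"
  unfolding acyclic_edges_def
proof
  fix e assume "e \<in> E'"
  then obtain X where "{e' \<in> E. cross X e'} = {e}"
    using assms unfolding acyclic_edges_def by blast
  then have "{e' \<in> E'. cross X e'} = {e}" using \<open>e \<in> E'\<close> assms(2) by blast
  then show "\<exists>X. {e' \<in> E'. cross X e'} = {e}" by blast
qed

text \<open>Intersecting a cut with \<open>V\<close>, or complementing it in \<open>V\<close>, does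
  not change which edges of \<open>E\<close> cross it. So the cut can be placed inside
  \<open>V\<close> on the side that avoids a prescribed vertex.\<close>

lemma acyclic_cut:
  assumes "E \<in> forests_on V" "e \<in> E" "a \<in> V"
  obtains X where "X \<subseteq> V" "a \<notin> X" "{e' \<in> E. cross X e'} = {e}"
proof -
  obtain X where X: "{e' \<in> E. cross X e'} = {e}"
    using assms unfolding forests_on_def acyclic_edges_def by blast
  have E: "e' \<subseteq> V" if "e' \<in> E" for e' using assms(1) that by (rule forests_on_subset)
  show thesis
  proof (cases "a \<in> X")
    case True
    have "{e' \<in> E. cross (V - X) e'} = {e' \<in> E. cross X e'}"
      using E by (auto simp: cross_Diff)
    then show thesis using True X that[of "V - X"] by auto
  next
    case False
    have "{e' \<in> E. cross (X \<inter> V) e'} = {e' \<in> E. cross X e'}"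
      using E by (auto simp: cross_Int)
    then show thesis using False X that[of "X \<inter> V"] by auto
  qed
qed

text \<open>Let \<open>X\<close> be the cut of the first edge of the cycle. Walking from
  \<open>p ! 1\<close> round to \<open>p ! 0\<close> uses only other edges, none of which crosses
  \<open>X\<close>, so both ends of the first edge lie on the same side.\<close>

lemma acyclic_no_cycle:
  assumes "acyclic_edges E"
  shows "\<not> is_cycle (V, E) p"
proof
  assume c: "is_cycle (V, E) p"
  define n where "n = length p"
  have n: "n \<ge> 3" and d: "distinct p"
    and e: "\<And>i. i < n \<Longrightarrow> {p ! i, p ! (Suc i mod n)} \<in> E"
    using c by (auto simp: is_cycle_def n_def)
  have pn: "p \<noteq> []" using n by (auto simp: n_def)
  have "{p ! 0, p ! (Suc 0 mod n)} \<in> E" using e[of 0] n by simp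
  then have e0: "{p ! 0, p ! 1} \<in> E" using n by (simp add: mod_less)
  then obtain X where X: "{e' \<in> E. cross X e'} = {{p ! 0, p ! 1}}"
    using assms unfolding acyclic_edges_def by blast
  \<comment> \<open>Here the length of at least 3 matters: the second edge of the cycle is a
    different set than the first.\<close>
  have ne: "{p ! i, p ! (Suc i mod n)} \<noteq> {p ! 0, p ! 1}" if i: "1 \<le> i" "i < n" for i
  proof -
    have "i \<noteq> 0" "Suc i mod n < n" using i by auto
    have "p ! i \<noteq> p ! 0" using nth_eq_iff_index_eq[OF d, of i 0] i n pn by (simp add: n_def)
    moreover have "p ! i = p ! 1 \<longrightarrow> p ! (Suc i mod n) \<noteq> p ! 0"
    proof
      assume "p ! i = p ! 1"
      then have "i = 1" using nth_eq_iff_index_eq[OF d, of i 1] i n pn by (simp add: n_def)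
      then have "Suc i mod n = 2" using n by simp
      then show "p ! (Suc i mod n) \<noteq> p ! 0"
        using nth_eq_iff_index_eq[OF d, of 2 0] n pn by (simp add: n_def)
    qed
    ultimately show ?thesis by (auto simp: doubleton_eq_iff)
  qed
  have st: "p ! i \<in> X \<longleftrightarrow> p ! (Suc i mod n) \<in> X" if i: "1 \<le> i" "i < n" for i
  proof -
    have "{p ! i, p ! (Suc i mod n)} \<notin> {e' \<in> E. cross X e'}" using ne[OF i] X by simp
    then have "\<not> cross X {p ! i, p ! (Suc i mod n)}" using e[OF i(2)] by simp
    then show ?thesis by (simp add: cross_pair)
  qed
  have "p ! 1 \<in> X \<longleftrightarrow> p ! Suc i \<in> X" if "Suc i < n" for i
    using that
  proof (induction i)
    case (Suc i)
    then show ?case using st[of "Suc i"] by (simp add: mod_less)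
  qed simp
  from this[of "n - 2"] have "p ! 1 \<in> X \<longleftrightarrow> p ! (n - 1) \<in> X"
    using n by (simp add: numeral_2_eq_2 Suc_diff_Suc)
  moreover have "p ! (n - 1) \<in> X \<longleftrightarrow> p ! 0 \<in> X" using st[of "n - 1"] n by simp
  moreover have "cross X {p ! 0, p ! 1}" using X by blast
  ultimately show False by (simp add: cross_pair)
qed

text \<open>The cut of an edge \<open>{a, b}\<close> consists of the vertices reachable from
  \<open>a\<close> without that edge. If it contained \<open>b\<close>, a simple path would close up
  to a cycle with the edge.\<close>

lemma no_cycle_acyclic:
  assumes "E \<subseteq> edges_on V" "\<And>p. \<not> is_cycle (V, E) p"
  shows "acyclic_edges E"
  unfolding acyclic_edges_def
proof
  fix e assume e: "e \<in> E"
  then obtain a b where ab: "e = {a, b}" "a \<noteq> b" using assms(1) by (meson edges_onE subsetD)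
  define r where "r = (\<lambda>x y. {x, y} \<in> E - {e})"
  define X where "X = {x. r\<^sup>*\<^sup>* a x}"
  have nc: "\<not> cross X e'" if e': "e' \<in> E" "e' \<noteq> e" for e'
  proof -
    obtain x y where xy: "e' = {x, y}" using assms(1) e' by (meson edges_onE subsetD)
    then have "r x y" "r y x" using e' by (auto simp: r_def insert_commute)
    then show ?thesis unfolding xy cross_pair X_def by (auto intro: rtranclp.rtrancl_into_rtrancl)
  qed
  have "b \<notin> X"
  proof
    assume "b \<in> X"
    then have "r\<^sup>*\<^sup>* a b" by (simp add: X_def)
    then obtain xs0 where "rtrancl_path r a xs0 b" by (auto simp: rtranclp_eq_rtrancl_path)
    then obtain xs where xs: "rtrancl_path r a xs b" "distinct (a # xs)"
      by (rule rtrancl_path_distinct)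
    have ne: "xs \<noteq> []" using xs(1) ab(2) by (auto elim: rtrancl_path.cases)
    have lst: "last xs = b" using rtrancl_path_last[OF xs(1) ne] .
    have nth: "r ((a # xs) ! i) (xs ! i)" if "i < length xs" for i
      using rtrancl_path_nth[OF xs(1) that] .
    \<comment> \<open>A path of one edge would be \<open>e\<close> itself, which is removed. So the
      cycle has the three vertices that \<open>is_cycle\<close> demands.\<close>
    have "length xs \<noteq> 1"
    proof
      assume "length xs = 1"
      then have "xs = [b]" using lst by (cases xs) auto
      then have "r a b" using nth[of 0] by simp
      then show False by (simp add: r_def ab)
    qed
    then have len: "length xs \<ge> 2" using ne by (cases xs) (auto simp: Suc_le_eq)
    have "is_cycle (V, E) (a # xs)"
      unfolding is_cycle_def
    proof (intro conjI allI impI)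
      fix i assume i: "i < length (a # xs)"
      show "{(a # xs) ! i, (a # xs) ! (Suc i mod length (a # xs))} \<in> edges (V, E)"
      proof (cases "i < length xs")
        case True
        then show ?thesis using nth[OF True] by (simp add: r_def)
      next
        case False
        then have "i = length xs" using i by simp
        then have "(a # xs) ! i = b" using lst ne by (cases xs rule: rev_cases) auto
        moreover have "(a # xs) ! (Suc i mod length (a # xs)) = a" using \<open>i = length xs\<close> by simp
        ultimately show ?thesis using e ab by (simp add: insert_commute)
      qed
    qed (use xs len in auto)
    with assms(2) show False by blast
  qed
  moreover have "a \<in> X" by (simp add: X_def)
  ultimately have "cross X e" by (simp add: ab cross_pair)
  with nc e have "{e' \<in> E. cross X e'} = {e}" by blast
  then show "\<exists>X. {e' \<in> E. cross X e'} = {e}" by blast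
qed

lemma forest_iff_forests_on: "forest (V, E) \<longleftrightarrow> E \<in> forests_on V"
proof -
  have "simple_graph (V, E) \<longleftrightarrow> E \<subseteq> edges_on V"
    by (auto simp: simple_graph_def edges_on_def)
  then show ?thesis
    using acyclic_no_cycle no_cycle_acyclic unfolding forest_def forests_on_def by blast
qed

lemma forests_eq: "forests n = Pair {1..n} ` forests_on {1..n}"
  by (auto simp: forests_def forest_iff_forests_on image_iff)

lemma connected_onD:
  assumes "connected_on V E" "X \<subseteq> V" "x \<in> X" "y \<in> V" "y \<notin> X"
  obtains e where "e \<in> E" "cross X e"
  using assms unfolding connected_on_def by blast

section \<open>Gluing and splitting trees along an edge\<close>

text \<open>The new edge has the cut \<open>A\<close>. An old edge keeps its cut, provided that the
  cut is chosen away from the end of the new edge in the same part.\<close>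

lemma glue_trees:
  assumes E1: "E1 \<in> trees_on A" and E2: "E2 \<in> trees_on B" and dis: "A \<inter> B = {}"
    and ab: "a \<in> A" "b \<in> B"
  shows "insert {a, b} (E1 \<union> E2) \<in> trees_on (A \<union> B)"
proof -
  let ?E = "insert {a, b} (E1 \<union> E2)"
  have s1: "e \<subseteq> A" if "e \<in> E1" for e using that E1 by (auto dest: trees_on_forests_on forests_on_subset)
  have s2: "e \<subseteq> B" if "e \<in> E2" for e using that E2 by (auto dest: trees_on_forests_on forests_on_subset)
  have "?E \<subseteq> edges_on (A \<union> B)"
  proof -
    have "a \<noteq> b" using ab dis by auto
    then have "{a, b} \<in> edges_on (A \<union> B)" using ab by (auto simp: edges_on_def)
    moreover have "E1 \<subseteq> edges_on (A \<union> B)" "E2 \<subseteq> edges_on (A \<union> B)"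
      using E1 E2 edges_on_mono[of A "A \<union> B"] edges_on_mono[of B "A \<union> B"]
      by (auto simp: trees_on_def forests_on_def)
    ultimately show ?thesis by auto
  qed
  moreover have "acyclic_edges ?E"
    unfolding acyclic_edges_def
  proof
    fix e assume "e \<in> ?E"
    then consider "e = {a, b}" | "e \<in> E1" | "e \<in> E2" by blast
    then show "\<exists>X. {e' \<in> ?E. cross X e'} = {e}"
    proof cases
      case 1
      have "\<not> cross A e'" if "e' \<in> E1 \<union> E2" for e'
        using that s1 s2 dis not_cross_subset[of e' A] not_cross_disjoint[of e' A] by blast
      moreover have "cross A {a, b}" using ab dis by (auto simp: cross_pair)
      ultimately have "{e' \<in> ?E. cross A e'} = {e}" using 1 by blast
      then show ?thesis by blast
    next
      case 2
      then obtain X where X: "X \<subseteq> A" "a \<notin> X" "{e' \<in> E1. cross X e'} = {e}"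
        using acyclic_cut[of E1 A e a] E1 ab by (auto simp: trees_on_def)
      have "\<not> cross X e'" if "e' \<in> E2" for e'
        using that s2 dis X not_cross_disjoint[of e' X] by blast
      moreover have "\<not> cross X {a, b}" using ab dis X by (auto simp: cross_pair)
      ultimately have "{e' \<in> ?E. cross X e'} = {e}" using X by blast
      then show ?thesis by blast
    next
      case 3
      then obtain X where X: "X \<subseteq> B" "b \<notin> X" "{e' \<in> E2. cross X e'} = {e}"
        using acyclic_cut[of E2 B e b] E2 ab by (auto simp: trees_on_def)
      have "\<not> cross X e'" if "e' \<in> E1" for e'
        using that s1 dis X not_cross_disjoint[of e' X] by blast
      moreover have "\<not> cross X {a, b}" using ab dis X by (auto simp: cross_pair)
      ultimately have "{e' \<in> ?E. cross X e'} = {e}" using X by blast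
      then show ?thesis by blast
    qed
  qed
  moreover have "connected_on (A \<union> B) ?E"
    unfolding connected_on_def
  proof (intro conjI allI impI)
    show "A \<union> B \<noteq> {}" using ab by auto
    fix X assume X: "X \<subseteq> A \<union> B" "X \<noteq> {}" "X \<noteq> A \<union> B"
    show "\<exists>e\<in>?E. cross X e"
    proof (rule ccontr)
      assume n: "\<not> (\<exists>e\<in>?E. cross X e)"
      have "\<not> (\<exists>e\<in>E1. cross (X \<inter> A) e)" using n cross_Int[OF s1] by blast
      then have 1: "X \<inter> A = {} \<or> X \<inter> A = A" using E1 unfolding trees_on_def connected_on_def by auto
      have "\<not> (\<exists>e\<in>E2. cross (X \<inter> B) e)" using n cross_Int[OF s2] by blast
      then have 2: "X \<inter> B = {} \<or> X \<inter> B = B" using E2 unfolding trees_on_def connected_on_def by auto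
      have 3: "a \<in> X \<longleftrightarrow> b \<in> X" using n by (auto simp: cross_pair)
      show False using 1 2 3 X ab by blast
    qed
  qed
  ultimately show ?thesis by (simp add: trees_on_def forests_on_def)
qed

lemma split_edges:
  assumes "E \<subseteq> edges_on V" "{e \<in> E. cross A e} = F"
  shows "E = F \<union> (E \<inter> Pow A) \<union> (E \<inter> Pow (V - A))"
proof -
  have "e \<subseteq> A \<or> e \<subseteq> V - A" if "e \<in> E" "\<not> cross A e" for e
    using that assms(1) edges_onD[of e V] by (auto simp: cross_def)
  then show ?thesis using assms by blast
qed

lemma split_tree:
  assumes E: "E \<in> trees_on V" and A: "A \<subseteq> V" "{e \<in> E. cross A e} = {{a, b}}" "a \<in> A" "b \<notin> A"
  shows "E \<inter> Pow A \<in> trees_on A"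
proof -
  have eV: "E \<subseteq> edges_on V" using E by (simp add: trees_on_def forests_on_def)
  have "acyclic_edges (E \<inter> Pow A)"
    using E by (auto simp: trees_on_def forests_on_def intro: acyclic_edges_mono)
  moreover have "connected_on A (E \<inter> Pow A)"
    unfolding connected_on_def
  proof (intro conjI allI impI)
    show "A \<noteq> {}" using A by auto
    fix X assume X: "X \<subseteq> A" "X \<noteq> {}" "X \<noteq> A"
    \<comment> \<open>Of \<open>X\<close> and its complement in \<open>A\<close>, the side without
      \<open>a\<close> is taken. Since \<open>b\<close> is not in \<open>A\<close>, the edge
      \<open>{a, b}\<close> cannot cross it, so the edge that does cross it lies inside
      \<open>A\<close>.\<close>
    define Y where "Y = (if a \<in> X then A - X else X)"
    have Y: "Y \<subseteq> A" "Y \<noteq> {}" "a \<notin> Y" using X by (auto simp: Y_def)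
    then obtain e where e: "e \<in> E" "cross Y e"
      using E A unfolding trees_on_def connected_on_def by blast
    have "e \<noteq> {a, b}" using e Y A by (auto simp: cross_pair)
    then have "\<not> cross A e" using A e by blast
    moreover have "e \<inter> A \<noteq> {}" using e Y by (auto simp: cross_def)
    ultimately have eA: "e \<subseteq> A" by (auto simp: cross_def)
    then have "cross X e" using e cross_Diff[OF eA, of X] by (auto simp: Y_def split: if_splits)
    with e eA show "\<exists>e\<in>E \<inter> Pow A. cross X e" by blast
  qed
  ultimately show ?thesis using edges_on_Int_Pow[OF eV] by (simp add: trees_on_def forests_on_def)
qed

section \<open>Components and the decomposition of a forest along one of them\<close>

text \<open>The component is the smallest set that contains \<open>v\<close> and is crossed by no
  edge. A cut of it without crossing edge would yield a smaller such set.\<close>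

lemma component_exists:
  assumes "E \<subseteq> edges_on V" "v \<in> V"
  obtains C where "v \<in> C" "C \<subseteq> V" "\<And>e. e \<in> E \<Longrightarrow> \<not> cross C e" "connected_on C (E \<inter> Pow C)"
proof -
  define K where "K = {C. v \<in> C \<and> C \<subseteq> V \<and> (\<forall>e\<in>E. \<not> cross C e)}"
  have VK: "V \<in> K" using assms by (auto simp: K_def cross_def dest: edges_onD)
  define C where "C = \<Inter>K"
  have "\<not> cross C e" if "e \<in> E" for e
  proof
    assume "cross C e"
    then obtain x y where xy: "x \<in> e" "x \<in> C" "y \<in> e" "y \<notin> C" by (auto simp: cross_def)
    then obtain D where "D \<in> K" "y \<notin> D" by (auto simp: C_def)
    moreover from this have "x \<in> D" using xy by (auto simp: C_def)
    ultimately have "cross D e" using xy by (auto simp: cross_def)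
    with \<open>D \<in> K\<close> that show False by (simp add: K_def)
  qed
  moreover have "v \<in> C" "C \<subseteq> V" using VK by (auto simp: C_def K_def)
  ultimately have C: "C \<in> K" by (simp add: K_def)
  have "connected_on C (E \<inter> Pow C)"
    unfolding connected_on_def
  proof (intro conjI allI impI)
    show "C \<noteq> {}" using C by (auto simp: K_def)
    fix X assume X: "X \<subseteq> C" "X \<noteq> {}" "X \<noteq> C"
    define Y where "Y = (if v \<in> X then X else C - X)"
    have Y: "v \<in> Y" "Y \<subseteq> C" "Y \<noteq> C" using X C by (auto simp: Y_def K_def)
    have "Y \<notin> K" using Y C_def by blast
    then obtain e where e: "e \<in> E" "cross Y e" using Y C by (auto simp: K_def)
    have "\<not> cross C e" using e C by (auto simp: K_def)
    then have eC: "e \<subseteq> C" using e Y by (auto simp: cross_def)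
    then have "cross X e" using e cross_Diff[OF eC, of X] by (auto simp: Y_def split: if_splits)
    then show "\<exists>e\<in>E \<inter> Pow C. cross X e" using e eC by blast
  qed
  then show thesis using that[of C] C by (auto simp: K_def)
qed

text \<open>Otherwise \<open>D\<close> would cut \<open>C\<close> without a crossing edge. Used in
  both directions, this makes the component of a vertex unique.\<close>

lemma component_subset:
  assumes "connected_on C (E \<inter> Pow C)" "\<And>e. e \<in> E \<Longrightarrow> \<not> cross D e" "v \<in> C" "v \<in> D"
  shows "C \<subseteq> D"
proof (rule ccontr)
  assume "\<not> C \<subseteq> D"
  then obtain e where "e \<in> E" "e \<subseteq> C" "cross (D \<inter> C) e"
    using assms unfolding connected_on_def by (metis Int_iff Pow_iff empty_iff inf.absorb_iff2 inf_le2)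
  then show False using assms(2) cross_Int[of e C D] by blast
qed

lemma union_forests:
  assumes "E1 \<in> forests_on A" "E2 \<in> forests_on B" "A \<inter> B = {}"
  shows "E1 \<union> E2 \<in> forests_on (A \<union> B)"
proof -
  have *: "\<exists>X. {e' \<in> E1 \<union> E2. cross X e'} = {e}"
    if f: "E1 \<in> forests_on A" "E2 \<in> forests_on B" "A \<inter> B = {}" "e \<in> E1" for e :: "'a set" and E1 E2 A B
  proof -
    have "e \<in> edges_on A" using f by (auto simp: forests_on_def)
    then obtain a where "a \<in> e" by (auto elim: edges_onE)
    then have "a \<in> A" using f forests_on_subset by blast
    then obtain X where X: "X \<subseteq> A" "a \<notin> X" "{e' \<in> E1. cross X e'} = {e}"
      by (rule acyclic_cut[OF f(1,4)])
    have "\<not> cross X e'" if "e' \<in> E2" for e'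
      using that forests_on_subset[OF f(2)] f(3) X not_cross_disjoint[of e' X] by blast
    then show ?thesis using X by blast
  qed
  have "acyclic_edges (E1 \<union> E2)"
    unfolding acyclic_edges_def
  proof
    fix e assume "e \<in> E1 \<union> E2"
    then show "\<exists>X. {e' \<in> E1 \<union> E2. cross X e'} = {e}"
    proof
      assume "e \<in> E2"
      with *[OF assms(2,1)] assms(3) have "\<exists>X. {e' \<in> E2 \<union> E1. cross X e'} = {e}" by blast
      then show ?thesis by (simp only: Un_commute)
    qed (rule *[OF assms])
  qed
  then show ?thesis using assms edges_on_mono[of A "A \<union> B"] edges_on_mono[of B "A \<union> B"]
    by (auto simp: forests_on_def)
qed

text \<open>A forest with component \<open>C\<close> is a tree on \<open>C\<close> together with a
  forest on the rest; restriction inverts the union because edges are nonempty. The predicates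
  \<open>P\<close> and \<open>Q\<close> allow the giant tree and the fragment to be restricted
  independently of each other.\<close>

lemma forests_on_component_bij:
  assumes "C \<subseteq> V"
  shows "bij_betw (\<lambda>(E1, E2). E1 \<union> E2)
    ({E1 \<in> trees_on C. P E1} \<times> {E2 \<in> forests_on (V - C). Q E2})
    {E \<in> forests_on V. (\<forall>e\<in>E. \<not> cross C e) \<and> connected_on C (E \<inter> Pow C) \<and>
       P (E \<inter> Pow C) \<and> Q (E \<inter> Pow (V - C))}"
proof (rule bij_betw_byWitness[where f' = "\<lambda>E. (E \<inter> Pow C, E \<inter> Pow (V - C))"])
  have CV: "C \<union> (V - C) = V" using assms by auto
  have sub: "(E1 \<union> E2) \<inter> Pow C = E1" "(E1 \<union> E2) \<inter> Pow (V - C) = E2"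
    "\<forall>e\<in>E1 \<union> E2. \<not> cross C e"
    if "E1 \<in> forests_on C" "E2 \<in> forests_on (V - C)" for E1 E2
  proof -
    have 1: "e \<subseteq> C" "e \<noteq> {}" if "e \<in> E1" for e
      using that \<open>E1 \<in> forests_on C\<close> by (auto simp: forests_on_def edges_on_def)
    have 2: "e \<subseteq> V - C" "e \<noteq> {}" if "e \<in> E2" for e
      using that \<open>E2 \<in> forests_on (V - C)\<close> by (auto simp: forests_on_def edges_on_def)
    have "\<not> e \<subseteq> C" if "e \<in> E2" for e using 2[OF that] by blast
    with 1 show "(E1 \<union> E2) \<inter> Pow C = E1" by blast
    have "\<not> e \<subseteq> V - C" if "e \<in> E1" for e using 1[OF that] by blast
    with 2 show "(E1 \<union> E2) \<inter> Pow (V - C) = E2" by blast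
    show "\<forall>e\<in>E1 \<union> E2. \<not> cross C e" using 1 2 by (auto simp: cross_def)
  qed
  show "\<forall>a\<in>{E1 \<in> trees_on C. P E1} \<times> {E2 \<in> forests_on (V - C). Q E2}.
     (case case a of (E1, E2) \<Rightarrow> E1 \<union> E2 of E \<Rightarrow> (E \<inter> Pow C, E \<inter> Pow (V - C))) = a"
    using sub by (auto simp: trees_on_def)
  show "(\<lambda>(E1, E2). E1 \<union> E2) ` ({E1 \<in> trees_on C. P E1} \<times> {E2 \<in> forests_on (V - C). Q E2})
    \<subseteq> {E \<in> forests_on V. (\<forall>e\<in>E. \<not> cross C e) \<and> connected_on C (E \<inter> Pow C) \<and>
       P (E \<inter> Pow C) \<and> Q (E \<inter> Pow (V - C))}"
    using sub union_forests[of _ C _ "V - C"] CV by (auto simp: trees_on_def)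
  have *: "(E \<inter> Pow C) \<union> (E \<inter> Pow (V - C)) = E"
    if "E \<in> forests_on V" "\<forall>e\<in>E. \<not> cross C e" for E
  proof -
    have "{e \<in> E. cross C e} = {}" using that by auto
    then show ?thesis using split_edges[of E V C "{}"] that by (auto simp: forests_on_def)
  qed
  then show "\<forall>E\<in>{E \<in> forests_on V. (\<forall>e\<in>E. \<not> cross C e) \<and> connected_on C (E \<inter> Pow C) \<and>
       P (E \<inter> Pow C) \<and> Q (E \<inter> Pow (V - C))}.
     (case (E \<inter> Pow C, E \<inter> Pow (V - C)) of (E1, E2) \<Rightarrow> E1 \<union> E2) = E"
    by auto
  have "E \<inter> Pow A \<in> forests_on A" if "E \<in> forests_on V" for E A
    using that edges_on_Int_Pow[of E V A]
    by (auto simp: forests_on_def intro: acyclic_edges_mono)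
  then show "(\<lambda>E. (E \<inter> Pow C, E \<inter> Pow (V - C))) `
      {E \<in> forests_on V. (\<forall>e\<in>E. \<not> cross C e) \<and> connected_on C (E \<inter> Pow C) \<and>
       P (E \<inter> Pow C) \<and> Q (E \<inter> Pow (V - C))}
     \<subseteq> {E1 \<in> trees_on C. P E1} \<times> {E2 \<in> forests_on (V - C). Q E2}"
    by (auto simp: trees_on_def)
qed

lemma card_forests_on_component:
  assumes "C \<subseteq> V"
  shows "card {E \<in> forests_on V. (\<forall>e\<in>E. \<not> cross C e) \<and> connected_on C (E \<inter> Pow C) \<and>
       P (E \<inter> Pow C) \<and> Q (E \<inter> Pow (V - C))} =
    card {E1 \<in> trees_on C. P E1} * card {E2 \<in> forests_on (V - C). Q E2}"
  using bij_betw_same_card[OF forests_on_component_bij[OF assms, of P Q]]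
  by (simp add: card_cartesian_product)

text \<open>Forests are sorted by the component of the fixed vertex \<open>v\<close>.\<close>

lemma card_forests_on_rec:
  assumes "finite V" "v \<in> V"
  shows "card (forests_on V) =
    (\<Sum>C | v \<in> C \<and> C \<subseteq> V. card (trees_on C) * card (forests_on (V - C)))"
proof -
  let ?S = "\<lambda>C. {E \<in> forests_on V. (\<forall>e\<in>E. \<not> cross C e) \<and> connected_on C (E \<inter> Pow C)}"
  have fin: "finite {C. v \<in> C \<and> C \<subseteq> V}" using assms by simp
  have "forests_on V = (\<Union>C\<in>{C. v \<in> C \<and> C \<subseteq> V}. ?S C)"
  proof
    show "forests_on V \<subseteq> (\<Union>C\<in>{C. v \<in> C \<and> C \<subseteq> V}. ?S C)"
    proof
      fix E assume E: "E \<in> forests_on V"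
      then obtain C where "v \<in> C" "C \<subseteq> V" "\<And>e. e \<in> E \<Longrightarrow> \<not> cross C e" "connected_on C (E \<inter> Pow C)"
        using component_exists[of E V v] assms forests_on_edges by blast
      with E show "E \<in> (\<Union>C\<in>{C. v \<in> C \<and> C \<subseteq> V}. ?S C)" by blast
    qed
  qed auto
  also have "card \<dots> = (\<Sum>C | v \<in> C \<and> C \<subseteq> V. card (?S C))"
  proof (rule card_UN_disjoint[OF fin])
    show "\<forall>i\<in>{C. v \<in> C \<and> C \<subseteq> V}. finite (?S i)" using finite_forests_on[OF assms(1)] by simp
    show "\<forall>i\<in>{C. v \<in> C \<and> C \<subseteq> V}. \<forall>j\<in>{C. v \<in> C \<and> C \<subseteq> V}. i \<noteq> j \<longrightarrow> ?S i \<inter> ?S j = {}"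
    proof (intro ballI impI)
      fix C D assume CD: "C \<in> {C. v \<in> C \<and> C \<subseteq> V}" "D \<in> {C. v \<in> C \<and> C \<subseteq> V}" "C \<noteq> D"
      have False if E: "E \<in> ?S C" "E \<in> ?S D" for E
        using component_subset[of C E D v] component_subset[of D E C v] E CD by simp
      then show "?S C \<inter> ?S D = {}" by blast
    qed
  qed
  also have "\<dots> = (\<Sum>C | v \<in> C \<and> C \<subseteq> V. card (trees_on C) * card (forests_on (V - C)))"
    using card_forests_on_component[of _ V "\<lambda>_. True" "\<lambda>_. True"] by (intro sum.cong) auto
  finally show ?thesis .
qed

section \<open>Cayley's formula\<close>

lemma trees_on_subset: "E \<in> trees_on V \<Longrightarrow> e \<in> E \<Longrightarrow> e \<subseteq> V"
  by (rule forests_on_subset[OF trees_on_forests_on])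

lemma trees_on_edges: "E \<in> trees_on V \<Longrightarrow> E \<subseteq> edges_on V"
  by (simp add: trees_on_def forests_on_def)

lemma split_tree_both:
  assumes "E \<in> trees_on V" "A \<subseteq> V" "{e \<in> E. cross A e} = {{a, b}}" "a \<in> A" "b \<notin> A"
  shows "E \<inter> Pow A \<in> trees_on A" "E \<inter> Pow (V - A) \<in> trees_on (V - A)"
    "E = insert {a, b} ((E \<inter> Pow A) \<union> (E \<inter> Pow (V - A)))" "b \<in> V"
proof -
  note E = trees_on_subset[OF assms(1)]
  show "E \<inter> Pow A \<in> trees_on A" by (rule split_tree[OF assms])
  have "{a, b} \<in> E" using assms(3) by auto
  then show bV: "b \<in> V" using E by blast
  have "{e \<in> E. cross (V - A) e} = {e \<in> E. cross A e}" using E by (auto simp: cross_Diff)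
  then show "E \<inter> Pow (V - A) \<in> trees_on (V - A)"
    using split_tree[OF assms(1), of "V - A" b a] assms bV by (auto simp: insert_commute)
  have "E \<subseteq> edges_on V" using assms(1) by (simp add: trees_on_def forests_on_def)
  from split_edges[OF this assms(3)]
  show "E = insert {a, b} ((E \<inter> Pow A) \<union> (E \<inter> Pow (V - A)))" by auto
qed

text \<open>These identities recover the pieces from the glued tree, which is what makes gluing
  injective.\<close>

lemma glue_parts:
  assumes "E1 \<in> forests_on A" "E2 \<in> forests_on B" "A \<inter> B = {}" "a \<in> A" "b \<in> B"
  shows "{e \<in> insert {a, b} (E1 \<union> E2). cross A e} = {{a, b}}"
    "insert {a, b} (E1 \<union> E2) \<inter> Pow A = E1" "insert {a, b} (E1 \<union> E2) \<inter> Pow B = E2"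
proof -
  have 1: "e \<subseteq> A \<and> e \<noteq> {}" if "e \<in> E1" for e
    using that assms(1) by (auto simp: forests_on_def edges_on_def)
  have 2: "e \<subseteq> B \<and> e \<noteq> {}" if "e \<in> E2" for e
    using that assms(2) by (auto simp: forests_on_def edges_on_def)
  have 3: "a \<notin> B" "b \<notin> A" using assms by auto
  have 4: "\<not> cross A e" if "e \<in> E1 \<union> E2" for e
    using that 1 2 assms(3) by (fastforce simp: cross_def)
  have "cross A {a, b}" using assms 3 by (simp add: cross_pair)
  with 4 show "{e \<in> insert {a, b} (E1 \<union> E2). cross A e} = {{a, b}}" by blast
  have "\<not> e \<subseteq> A" if "e \<in> E2" for e using 2[OF that] assms(3) by blast
  with 1 3 show "insert {a, b} (E1 \<union> E2) \<inter> Pow A = E1" by auto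
  have "\<not> e \<subseteq> B" if "e \<in> E1" for e using 1[OF that] assms(3) by blast
  with 2 3 show "insert {a, b} (E1 \<union> E2) \<inter> Pow B = E2" by auto
qed

lemma tree_edge_cut:
  assumes "E \<in> trees_on V" "{a, b} \<in> E"
  obtains A where "A \<subseteq> V" "a \<in> A" "b \<notin> A" "{e \<in> E. cross A e} = {{a, b}}"
proof -
  have "b \<in> V" using trees_on_subset[OF assms] by simp
  then obtain A where A: "A \<subseteq> V" "b \<notin> A" "{e \<in> E. cross A e} = {{a, b}}"
    by (rule acyclic_cut[OF trees_on_forests_on[OF assms(1)] assms(2)])
  have "{a, b} \<in> {e \<in> E. cross A e}" unfolding A(3) by (rule singletonI)
  then have "cross A {a, b}" by simp
  then have "a \<in> A" using A(2) by (simp add: cross_pair)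
  then show thesis by (rule that[OF A(1) _ A(2,3)])
qed

lemma trees_on_nonempty: "E \<in> trees_on V \<Longrightarrow> V \<noteq> {}"
  by (simp add: trees_on_def connected_on_def)

lemma trees_on_empty [simp]: "trees_on {} = {}"
  using trees_on_nonempty by blast

lemma forests_on_empty [simp]: "forests_on {} = {{}}"
  by (auto simp: forests_on_def edges_on_def acyclic_edges_def)

lemma edges_on_singleton [simp]: "edges_on {v} = {}"
proof -
  have "card e \<noteq> 2" if "e \<subseteq> {v}" for e using card_mono[OF _ that] by simp
  then show ?thesis unfolding edges_on_def by blast
qed

lemma trees_on_singleton [simp]: "trees_on {v} = {{}}"
proof -
  have "connected_on {v} {}" by (auto simp: connected_on_def)
  then show ?thesis by (auto simp: trees_on_def forests_on_def acyclic_edges_def)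
qed

lemma tree_has_edge:
  assumes "E \<in> trees_on V" "v \<in> V" "V \<noteq> {v}"
  obtains a b where "{a, b} \<in> E"
proof -
  obtain y where "y \<in> V" "y \<noteq> v" using assms(2,3) by blast
  moreover have "connected_on V E" using assms(1) by (simp add: trees_on_def)
  ultimately obtain e where "e \<in> E" using connected_onD[of V E "{v}" v y] assms(2) by auto
  moreover from this have "e \<in> edges_on V" using assms(1) by (auto simp: trees_on_def forests_on_def)
  ultimately show thesis using that by (auto elim: edges_onE)
qed

text \<open>Cutting the tree at any edge leaves two smaller trees, to which the induction
  applies.\<close>

lemma card_tree:
  assumes "finite V" "E \<in> trees_on V"
  shows "card V = Suc (card E)"
  using assms
proof (induction "card V" arbitrary: V E rule: less_induct)
  case less
  obtain v where v: "v \<in> V" using trees_on_nonempty less.prems by blast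
  show ?case
  proof (cases "V = {v}")
    case True
    then show ?thesis using less.prems by simp
  next
    case False
    then obtain a b where "{a, b} \<in> E" using tree_has_edge less.prems v by metis
    then obtain A where A: "A \<subseteq> V" "a \<in> A" "b \<notin> A" "{e \<in> E. cross A e} = {{a, b}}"
      using tree_edge_cut less.prems by metis
    note sp = split_tree_both[OF less.prems(2) A(1,4,2,3)]
    have fin: "finite A" "finite (V - A)" using A less.prems finite_subset by auto
    have fE: "finite (E \<inter> Pow A)" "finite (E \<inter> Pow (V - A))" using fin by auto
    have "card A < card V" using A sp(4) less.prems by (intro psubset_card_mono) auto
    then have 1: "card A = Suc (card (E \<inter> Pow A))" using less.hyps fin sp by blast
    have "card (V - A) < card V" using A sp(4) less.prems by (intro psubset_card_mono) auto
    then have 2: "card (V - A) = Suc (card (E \<inter> Pow (V - A)))" using less.hyps fin sp by blast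
    have V: "card V = card A + card (V - A)"
      using A less.prems by (metis card_Diff_subset fin(1) card_mono le_add_diff_inverse)
    have "card E = Suc (card ((E \<inter> Pow A) \<union> (E \<inter> Pow (V - A))))"
      using sp(3) fE A by (subst sp(3), subst card_insert_disjoint) auto
    also have "card ((E \<inter> Pow A) \<union> (E \<inter> Pow (V - A))) = card (E \<inter> Pow A) + card (E \<inter> Pow (V - A))"
    proof (rule card_Un_disjoint[OF fE])
      have "{} \<notin> E" using trees_on_edges[OF less.prems(2)] by (auto simp: edges_on_def)
      moreover have "e = {}" if "e \<subseteq> A" "e \<subseteq> V - A" for e using that by blast
      ultimately show "E \<inter> Pow A \<inter> (E \<inter> Pow (V - A)) = {}" by auto
    qed
    finally show ?thesis using 1 2 V by simp
  qed
qed

section \<open>Trees with an oriented edge\<close>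

lemma card_ordered_edges:
  assumes "E \<subseteq> edges_on V" "finite E"
  shows "card {(a, b). {a, b} \<in> E} = 2 * card E"
proof -
  have *: "card {(a, b). {a, b} = e} = 2 \<and> finite {(a, b). {a, b} = e}" if "e \<in> E" for e
  proof -
    have "e \<in> edges_on V" using assms(1) that by auto
    then obtain x y where "e = {x, y}" "x \<noteq> y" by (rule edges_onE)
    then have "{(a, b). {a, b} = e} = {(x, y), (y, x)}" by (auto simp: doubleton_eq_iff)
    then show ?thesis using \<open>x \<noteq> y\<close> by simp
  qed
  have "{(a, b). {a, b} \<in> E} = (\<Union>e\<in>E. {(a, b). {a, b} = e})" by auto
  also have "card \<dots> = (\<Sum>e\<in>E. card {(a, b). {a, b} = e})"
    using assms(2) * by (intro card_UN_disjoint) auto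
  also have "\<dots> = 2 * card E" using * by simp
  finally show ?thesis .
qed

text \<open>Deleting an oriented edge \<open>(a, b)\<close> leaves a tree rooted at \<open>a\<close>
  and a tree rooted at \<open>b\<close>. The vertex set \<open>A\<close> of the first is determined
  as the component of \<open>a\<close> after the deletion, which gives injectivity.\<close>

lemma edge_rooted_trees_bij:
  "bij_betw (\<lambda>(A, (E1, a), (E2, b)). (insert {a, b} (E1 \<union> E2), a, b))
     (SIGMA A:Pow V. (trees_on A \<times> A) \<times> (trees_on (V - A) \<times> (V - A)))
     (SIGMA E:trees_on V. {(a, b). {a, b} \<in> E})"
  (is "bij_betw ?F ?D ?S")
  unfolding bij_betw_def
proof (intro conjI)
  show "inj_on ?F ?D"
  proof (rule inj_onI, clarsimp)
    fix A E1 a E2 b A' E1' E2'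
    assume A: "A \<subseteq> V" "E1 \<in> trees_on A" "a \<in> A" "E2 \<in> trees_on (V - A)" "b \<in> V" "b \<notin> A"
      and A': "A' \<subseteq> V" "E1' \<in> trees_on A'" "a \<in> A'" "E2' \<in> trees_on (V - A')" "b \<notin> A'"
      and eq: "insert {a, b} (E1 \<union> E2) = insert {a, b} (E1' \<union> E2')"
    let ?E = "insert {a, b} (E1 \<union> E2)"
    have b: "b \<in> V - A" "b \<in> V - A'" using A A' by auto
    note p = glue_parts[OF trees_on_forests_on[OF A(2)] trees_on_forests_on[OF A(4)] Diff_disjoint A(3) b(1)]
    note p' = glue_parts[OF trees_on_forests_on[OF A'(2)] trees_on_forests_on[OF A'(4)] Diff_disjoint A'(3) b(2),
        folded eq]
    have sub: "C \<subseteq> D" if "connected_on C (?E \<inter> Pow C)" "{e \<in> ?E. cross D e} = {{a, b}}"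
      "a \<in> C" "a \<in> D" "b \<notin> C" for C D
    proof (rule component_subset[of C "?E \<inter> Pow C" D a])
      show "\<not> cross D e" if "e \<in> ?E \<inter> Pow C" for e
      proof
        assume "cross D e"
        then have "e = {a, b}" using that \<open>{e \<in> ?E. cross D e} = {{a, b}}\<close> by blast
        then show False using that \<open>b \<notin> C\<close> by blast
      qed
    qed (use that in \<open>auto simp: Int_assoc\<close>)
    have "connected_on A (?E \<inter> Pow A)" "connected_on A' (?E \<inter> Pow A')"
      using A A' p(2) p'(2) by (simp_all add: trees_on_def)
    then have "A = A'" using sub[of A A'] sub[of A' A] p p' A A' by blast
    then show "A = A' \<and> E1 = E1' \<and> E2 = E2'" using p p' by simp
  qed
  show "?F ` ?D = ?S"
  proof
    show "?F ` ?D \<subseteq> ?S"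
    proof clarsimp
      fix A E1 a E2 b
      assume A: "A \<subseteq> V" "E1 \<in> trees_on A" "a \<in> A" "E2 \<in> trees_on (V - A)" "b \<in> V" "b \<notin> A"
      then have "insert {a, b} (E1 \<union> E2) \<in> trees_on (A \<union> (V - A))" by (intro glue_trees) auto
      then show "insert {a, b} (E1 \<union> E2) \<in> trees_on V" using A(1) by (simp add: Un_absorb1)
    qed
    show "?S \<subseteq> ?F ` ?D"
    proof clarify
      fix E a b assume E: "E \<in> trees_on V" "{a, b} \<in> E"
      then obtain A where A: "A \<subseteq> V" "a \<in> A" "b \<notin> A" "{e \<in> E. cross A e} = {{a, b}}"
        by (rule tree_edge_cut)
      note sp = split_tree_both[OF E(1) A(1,4,2,3)]
      have "(A, (E \<inter> Pow A, a), (E \<inter> Pow (V - A), b)) \<in> ?D" using A sp by auto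
      then have "?F (A, (E \<inter> Pow A, a), (E \<inter> Pow (V - A), b)) \<in> ?F ` ?D" by (rule imageI)
      then show "(E, a, b) \<in> ?F ` ?D" using sp(3) by simp
    qed
  qed
qed

text \<open>Trees with an oriented edge are counted twice: every tree on n vertices has 2(n-1)
  oriented edges, and each pair is an ordered pair of rooted trees.\<close>

lemma card_trees_on_rec:
  assumes "finite V"
  shows "2 * (card V - 1) * card (trees_on V) =
    (\<Sum>A\<in>Pow V. (card (trees_on A) * card A) * (card (trees_on (V - A)) * card (V - A)))"
proof -
  have fin: "finite A" if "A \<in> Pow V" for A using that assms finite_subset by auto
  have fE: "finite E" if "E \<in> trees_on V" for E
    using that assms finite_edges_on finite_subset by (auto simp: trees_on_def forests_on_def)
  have fo: "finite {(a, b). {a, b} \<in> E}" if "E \<in> trees_on V" for E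
  proof (rule finite_subset)
    show "{(a, b). {a, b} \<in> E} \<subseteq> V \<times> V"
      using that forests_on_subset trees_on_forests_on by blast
  qed (use assms in simp)
  have "card (SIGMA E:trees_on V. {(a, b). {a, b} \<in> E}) = (\<Sum>E\<in>trees_on V. card {(a, b). {a, b} \<in> E})"
    using fo finite_trees_on[OF assms] by (intro card_SigmaI) auto
  also have "\<dots> = (\<Sum>E\<in>trees_on V. 2 * (card V - 1))"
  proof (rule sum.cong[OF refl])
    fix E assume E: "E \<in> trees_on V"
    have "card {(a, b). {a, b} \<in> E} = 2 * card E"
      using E fE by (intro card_ordered_edges[of _ V]) (auto simp: trees_on_def forests_on_def)
    then show "card {(a, b). {a, b} \<in> E} = 2 * (card V - 1)" using card_tree[OF assms E] by simp
  qed
  also have "\<dots> = 2 * (card V - 1) * card (trees_on V)" by simp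
  finally have 1: "card (SIGMA E:trees_on V. {(a, b). {a, b} \<in> E}) = 2 * (card V - 1) * card (trees_on V)" .
  have "card (SIGMA A:Pow V. (trees_on A \<times> A) \<times> (trees_on (V - A) \<times> (V - A))) =
     (\<Sum>A\<in>Pow V. card ((trees_on A \<times> A) \<times> (trees_on (V - A) \<times> (V - A))))"
    using assms fin finite_trees_on by (intro card_SigmaI) (auto intro!: finite_cartesian_product)
  also have "\<dots> = (\<Sum>A\<in>Pow V. (card (trees_on A) * card A) * (card (trees_on (V - A)) * card (V - A)))"
    by (simp add: card_cartesian_product)
  finally show ?thesis using 1 bij_betw_same_card[OF edge_rooted_trees_bij[of V]] by simp
qed

section \<open>Abel's binomial identity and the proof of Cayley's formula\<close>

lemma sum_Pow_card:
  fixes g :: "nat \<Rightarrow> 'b::comm_semiring_1"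
  assumes "finite V"
  shows "(\<Sum>A\<in>Pow V. g (card A)) = (\<Sum>k\<le>card V. of_nat (card V choose k) * g k)"
proof -
  have "(\<Sum>A\<in>Pow V. g (card A)) = (\<Sum>k\<le>card V. \<Sum>A\<in>{A \<in> Pow V. card A = k}. g (card A))"
    using assms by (intro sum.group[symmetric]) (auto intro: card_mono)
  also have "\<dots> = (\<Sum>k\<le>card V. of_nat (card V choose k) * g k)"
    using n_subsets[OF assms] by (intro sum.cong) (auto simp: Pow_def)
  finally show ?thesis .
qed

text \<open>This is a finite difference of order n of a polynomial of smaller degree. In the
  induction the difference \<open>D\<close> of order n has derivative zero because differentiation
  lowers the degree; so \<open>D\<close> is constant, and the difference of order n+1 is
  \<open>D x - D (x + 1)\<close>.\<close>

lemma alternating_binomial_power_sum: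
  fixes x :: real
  assumes "m < n"
  shows "(\<Sum>i\<le>n. (-1) ^ i * real (n choose i) * (x + i) ^ m) = 0"
  using assms
proof (induction n arbitrary: m x)
  case (Suc n)
  define D where "D = (\<lambda>x::real. \<Sum>i\<le>n. (-1) ^ i * real (n choose i) * (x + i) ^ m)"
  have "(D has_real_derivative 0) (at x)" for x
  proof -
    have "(D has_real_derivative (\<Sum>i\<le>n. (-1) ^ i * real (n choose i) * (m * (x + i) ^ (m - 1)))) (at x)"
      unfolding D_def by (auto intro!: derivative_eq_intros sum.cong)
    also have "(\<Sum>i\<le>n. (-1) ^ i * real (n choose i) * (m * (x + i) ^ (m - 1))) =
       m * (\<Sum>i\<le>n. (-1) ^ i * real (n choose i) * (x + i) ^ (m - 1))"
      by (simp add: sum_distrib_left mult_ac)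
    also have "\<dots> = 0" using Suc.IH[of "m - 1" x] Suc.prems by (cases "m = 0") auto
    finally show ?thesis .
  qed
  then have c: "D x = D y" for x y using DERIV_isconst_all by blast
  have "(\<Sum>i\<le>Suc n. (-1) ^ i * real (Suc n choose i) * (x + i) ^ m) = D x - D (x + 1)"
  proof -
    let ?f = "\<lambda>i. (x + real i) ^ m"
    have "(\<Sum>i\<le>Suc n. (-1) ^ i * real (Suc n choose i) * ?f i) =
      ?f 0 + (\<Sum>i\<le>n. (-1) ^ Suc i * real (Suc n choose Suc i) * ?f (Suc i))"
      by (subst sum.atMost_Suc_shift) simp
    also have "(\<Sum>i\<le>n. (-1) ^ Suc i * real (Suc n choose Suc i) * ?f (Suc i)) =
      (\<Sum>i\<le>n. (-1) ^ Suc i * real (n choose Suc i) * ?f (Suc i)) - D (x + 1)"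
      unfolding D_def by (simp add: sum.distrib sum_negf algebra_simps sum_subtractf)
    also have "?f 0 + ((\<Sum>i\<le>n. (-1) ^ Suc i * real (n choose Suc i) * ?f (Suc i)) - D (x + 1)) =
      (\<Sum>i\<le>Suc n. (-1) ^ i * real (n choose i) * ?f i) - D (x + 1)"
      using sum.atMost_Suc_shift[of "\<lambda>i. (-1) ^ i * real (n choose i) * ?f i" n] by simp
    also have "\<dots> = D x - D (x + 1)" by (simp add: D_def)
    finally show ?thesis .
  qed
  then show ?case using c[of x "x + 1"] by simp
qed simp

text \<open>Induction by differentiation in \<open>y\<close>: the derivative of the left-hand side
  is n+1 times the preceding case at \<open>y + 1\<close>, and so is that of the right-hand side. It
  remains to compare both sides at a single point.\<close>

lemma abel_identity:
  fixes y :: real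
  assumes "n \<ge> 1"
  shows "(\<Sum>i=1..n. real (n choose i) * real i ^ (i - 1) * (y + real (n - i)) ^ (n - i)) = n * (y + n) ^ (n - 1)"
  using assms
proof (induction n arbitrary: y rule: dec_induct)
  case (step n)
  define P where "P = (\<lambda>y::real. \<Sum>i=1..Suc n. real (Suc n choose i) * real i ^ (i - 1) * (y + real (Suc n - i)) ^ (Suc n - i))"
  define Q where "Q = (\<lambda>y::real. Suc n * (y + Suc n) ^ n)"
  have "((\<lambda>y. P y - Q y) has_real_derivative 0) (at y)" for y
  proof -
    have "(P has_real_derivative (\<Sum>i=1..Suc n. real (Suc n choose i) * real i ^ (i - 1) *
        (real (Suc n - i) * (y + real (Suc n - i)) ^ (Suc n - i - 1)))) (at y)"
      unfolding P_def by (auto intro!: derivative_eq_intros sum.cong)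
    also have "(\<Sum>i=1..Suc n. real (Suc n choose i) * real i ^ (i - 1) *
        (real (Suc n - i) * (y + real (Suc n - i)) ^ (Suc n - i - 1))) =
        (\<Sum>i=1..n. Suc n * (real (n choose i) * real i ^ (i - 1) * (y + 1 + real (n - i)) ^ (n - i)))"
    proof -
      have "real (Suc n choose i) * real (Suc n - i) = Suc n * real (n choose i)" if "i \<le> n" for i
      proof -
        have "(Suc n - i) * (Suc n choose i) = Suc n * (n choose i)"
          using binomial_absorb_comp[of "Suc n" i] by simp
        then show ?thesis by (metis mult.commute of_nat_mult)
      qed
      then have "real (Suc n choose i) * real i ^ (i - 1) *
        (real (Suc n - i) * (y + real (Suc n - i)) ^ (Suc n - i - 1)) =
        Suc n * (real (n choose i) * real i ^ (i - 1) * (y + 1 + real (n - i)) ^ (n - i))" if "i \<in> {1..n}" for i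
        using that by (simp add: Suc_diff_le mult_ac add_ac)
      then show ?thesis by (subst sum.atLeast_Suc_atMost_Suc_shift sum.nat_ivl_Suc') (auto intro!: sum.cong)
    qed
    also have "\<dots> = Suc n * (n * (y + 1 + n) ^ (n - 1))"
      unfolding sum_distrib_left[symmetric] step.IH ..
    finally have 1: "(P has_real_derivative (Suc n * (n * (y + 1 + n) ^ (n - 1)))) (at y)" .
    have 2: "(Q has_real_derivative (Suc n * (n * (y + 1 + n) ^ (n - 1)))) (at y)"
      unfolding Q_def by (auto intro!: derivative_eq_intros simp: algebra_simps)
    show ?thesis using DERIV_diff[OF 1 2] by simp
  qed
  then have c: "P y - Q y = P z - Q z" for y z using DERIV_isconst_all[of "\<lambda>y. P y - Q y"] by blast
  \<comment> \<open>At this point the base \<open>y + (Suc n - i)\<close> equals -i. The two powers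
    merge into i^n up to sign, and the alternating sum of these vanishes because n < n+1.\<close>
  have "P (- real (Suc n)) = 0"
  proof -
    have "P (- real (Suc n)) = (\<Sum>i=1..Suc n. (-1) ^ Suc n * ((-1) ^ i * real (Suc n choose i) * (0 + real i) ^ n))"
      unfolding P_def
    proof (rule sum.cong[OF refl])
      fix i assume i: "i \<in> {1..Suc n}"
      have e: "- real (Suc n) + real (Suc n - i) = - real i" using i by simp
      have "real i ^ (i - 1) * (- real i) ^ (Suc n - i) = (-1) ^ (Suc n - i) * (real i ^ (i - 1) * real i ^ (Suc n - i))"
        by (simp add: power_minus[of "real i"])
      also have "real i ^ (i - 1) * real i ^ (Suc n - i) = real i ^ n"
        using i by (simp add: power_add[symmetric])
      also have "(-1::real) ^ (Suc n - i) = (-1) ^ Suc n * (-1) ^ i"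
        using i by (simp add: minus_one_power_iff)
      finally show "real (Suc n choose i) * real i ^ (i - 1) * (- real (Suc n) + real (Suc n - i)) ^ (Suc n - i) =
          (-1) ^ Suc n * ((-1) ^ i * real (Suc n choose i) * (0 + real i) ^ n)"
        unfolding e by (simp add: mult_ac)
    qed
    also have "\<dots> = (-1) ^ Suc n * (\<Sum>i=1..Suc n. (-1) ^ i * real (Suc n choose i) * (0 + real i) ^ n)"
      by (simp only: sum_distrib_left)
    \<comment> \<open>The term i = 0 may be added since 0 ^ n = 0 for n \<ge> 1.\<close>
    also have "(\<Sum>i=1..Suc n. (-1) ^ i * real (Suc n choose i) * (0 + real i) ^ n) =
      (\<Sum>i\<le>Suc n. (-1) ^ i * real (Suc n choose i) * (0 + real i) ^ n)"
      using step.hyps by (intro sum.mono_neutral_left) auto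
    also have "\<dots> = 0" by (rule alternating_binomial_power_sum) simp
    finally show ?thesis by simp
  qed
  moreover have "Q (- real (Suc n)) = 0" using step.hyps by (simp add: Q_def)
  ultimately have "P y = Q y" using c[of y "- real (Suc n)"] by simp
  then show ?case by (simp only: P_def Q_def) simp
qed simp

text \<open>Abel's identity at y = 0. With one factor n-i split off, its terms are (n-i) s(i), and
  the symmetry i \<leftrightarrow> n-i replaces the factor by its average n/2. The term i = n
  contributes n^(n-1).\<close>

lemma abel_convolution:
  assumes "n \<ge> 2"
  shows "(\<Sum>i=1..n-1. (n choose i) * i ^ (i - 1) * (n - i) ^ (n - i - 1)) = 2 * (n - 1) * n ^ (n - 2)"
proof -
  define s where "s = (\<lambda>i. real ((n choose i) * i ^ (i - 1) * (n - i) ^ (n - i - 1)))"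
  define S where "S = (\<Sum>i=1..n-1. s i)"
  have n: "{1..n} = insert n {1..n-1}" using assms by auto
  have "(\<Sum>i=1..n. real (n choose i) * real i ^ (i - 1) * (0 + real (n - i)) ^ (n - i)) =
     real n ^ (n - 1) + (\<Sum>i=1..n-1. real (n choose i) * real i ^ (i - 1) * (0 + real (n - i)) ^ (n - i))"
    using assms unfolding n by (subst sum.insert) auto
  also have "(\<Sum>i=1..n-1. real (n choose i) * real i ^ (i - 1) * (0 + real (n - i)) ^ (n - i)) =
     (\<Sum>i=1..n-1. real (n - i) * s i)"
  proof (rule sum.cong[OF refl])
    fix i assume "i \<in> {1..n-1}"
    then obtain d where d: "n - i = Suc d" by (metis Suc_diff_Suc atLeastAtMost_iff less_eq_Suc_le One_nat_def Suc_pred' assms le_imp_less_Suc less_le_trans pos2)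
    show "real (n choose i) * real i ^ (i - 1) * (0 + real (n - i)) ^ (n - i) = real (n - i) * s i"
      unfolding s_def d by simp
  qed
  finally have "real n ^ (n - 1) + (\<Sum>i=1..n-1. real (n - i) * s i) = n * real n ^ (n - 1)"
    using abel_identity[of n 0] assms by simp
  moreover have "(\<Sum>i=1..n-1. real (n - i) * s i) = (\<Sum>i=1..n-1. real i * s i)"
  proof (rule sum.reindex_bij_witness[of _ "\<lambda>i. n - i" "\<lambda>i. n - i"])
    fix i assume "i \<in> {1..n-1}"
    then have "n - (n - i) = i" "n choose (n - i) = n choose i"
      using assms binomial_symmetric[of i n] by auto
    then show "real (n - i) * s (n - i) = real (n - i) * s i"
      unfolding s_def by (simp only: mult_ac)
  qed (use assms in auto)
  moreover have "(\<Sum>i=1..n-1. real (n - i) * s i) + (\<Sum>i=1..n-1. real i * s i) = n * S"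
    unfolding S_def sum.distrib[symmetric] sum_distrib_left
    by (intro sum.cong) (auto simp: algebra_simps of_nat_diff)
  ultimately have "n * S = 2 * (n * real n ^ (n - 1) - real n ^ (n - 1))" by simp
  also have "real n ^ (n - 1) = n * real n ^ (n - 2)"
    using assms by (metis Suc_diff_le diff_Suc_Suc numeral_2_eq_2 One_nat_def power_Suc)
  also have "2 * (n * (n * real n ^ (n - 2)) - n * real n ^ (n - 2)) = n * (2 * (real n - 1) * real n ^ (n - 2))"
    by (simp add: algebra_simps)
  finally have "S = 2 * (real n - 1) * real n ^ (n - 2)" using assms by simp
  also have "\<dots> = real (2 * (n - 1) * n ^ (n - 2))" using assms by (simp add: of_nat_diff)
  finally have "real (\<Sum>i=1..n-1. (n choose i) * i ^ (i - 1) * (n - i) ^ (n - i - 1)) = real (2 * (n - 1) * n ^ (n - 2))"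
    unfolding S_def s_def by (simp only: of_nat_sum)
  then show ?thesis by (simp only: of_nat_eq_iff)
qed

text \<open>With k^(k-1) rooted trees on every smaller set of k vertices, the recurrence for
  oriented edges becomes the convolution identity. For a single vertex the truncated exponent gives
  1^0 = 1.\<close>

theorem cayley:
  assumes "finite V" "V \<noteq> {}"
  shows "card (trees_on V) = card V ^ (card V - 2)"
  using assms
proof (induction "card V" arbitrary: V rule: less_induct)
  case less
  show ?case
  proof (cases "card V = 1")
    case True
    then show ?thesis by (auto simp: card_1_singleton_iff)
  next
    case False
    define n where "n = card V"
    have n: "n \<ge> 2" using False less.prems by (simp add: n_def) (metis One_nat_def Suc_leI card_gt_0_iff le_neq_implies_less Suc_1)
    \<comment> \<open>The value at 0 is set by hand: there is no tree on the empty set, whereas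
      \<open>0 ^ (0 - 1)\<close> is 1. So the terms \<open>A = {}\<close> and \<open>A = V\<close>
      vanish, and the induction hypothesis is applied to proper subsets only.\<close>
    define g where "g = (\<lambda>k::nat. if k = 0 then 0 else k ^ (k - 1))"
    have g: "card (trees_on A) * card A = g (card A)" if "A \<subset> V" for A
    proof (cases "A = {}")
      case False
      have fA: "finite A" using that less.prems finite_subset by auto
      then have "card A \<ge> 1" using False by (simp add: Suc_le_eq card_gt_0_iff)
      moreover have "card (trees_on A) = card A ^ (card A - 2)"
        using less.hyps[of A] that False fA less.prems psubset_card_mono by blast
      moreover have "m ^ (m - 2) * m = m ^ (m - 1)" if "m \<ge> 1" for m :: nat
        using that by (cases "m = 1") (auto simp: power_Suc[symmetric] mult.commute simp del: power_Suc
           intro: arg_cong[where f = "(^) m"] simp flip: power_Suc)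
      ultimately show ?thesis by (simp add: g_def)
    qed (simp add: g_def)
    have "2 * (n - 1) * card (trees_on V) =
      (\<Sum>A\<in>Pow V. (card (trees_on A) * card A) * (card (trees_on (V - A)) * card (V - A)))"
      unfolding n_def by (rule card_trees_on_rec[OF less.prems(1)])
    also have "\<dots> = (\<Sum>A\<in>Pow V. g (card A) * g (n - card A))"
    proof (rule sum.cong[OF refl])
      fix A assume A: "A \<in> Pow V"
      consider "A = V" | "A = {}" | "A \<subset> V" "V - A \<subset> V" using A by blast
      then show "(card (trees_on A) * card A) * (card (trees_on (V - A)) * card (V - A)) = g (card A) * g (n - card A)"
      proof cases
        case 3
        have "card (V - A) = n - card A"
          using A less.prems finite_subset unfolding n_def by (metis Pow_iff card_Diff_subset)
        then show ?thesis using g[OF 3(1)] g[OF 3(2)] by simp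
      qed (simp_all add: g_def n_def)
    qed
    also have "\<dots> = (\<Sum>k\<le>n. of_nat (n choose k) * (g k * g (n - k)))"
      unfolding n_def by (rule sum_Pow_card[OF less.prems(1)])
    also have "\<dots> = (\<Sum>k=1..n-1. (n choose k) * k ^ (k - 1) * (n - k) ^ (n - k - 1))"
    proof (rule sum.mono_neutral_cong_right)
      show "\<forall>i\<in>{..n} - {1..n - 1}. of_nat (n choose i) * (g i * g (n - i)) = 0"
      proof
        fix i assume "i \<in> {..n} - {1..n - 1}"
        then have "i = 0 \<or> i = n" by auto
        then show "of_nat (n choose i) * (g i * g (n - i)) = 0" by (auto simp: g_def)
      qed
    qed (use n in \<open>auto simp: g_def\<close>)
    also have "\<dots> = 2 * (n - 1) * n ^ (n - 2)" by (rule abel_convolution[OF n])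
    finally show ?thesis using n by (simp add: n_def)
  qed
qed

section \<open>Asymptotics of the tree and forest counts\<close>

text \<open>The recurrence is the coefficient form of F' = F B', so F = exp B as formal series.
  Evaluation at 1 exchanges two summations; since all coefficients are nonnegative, partial sums can
  be compared in both directions.\<close>

lemma exp_formula:
  fixes b v :: "nat \<Rightarrow> real"
  assumes b: "b 0 = 0" "\<And>n. b n \<ge> 0" "b sums s"
    and v: "v 0 = 1" "\<And>n. n \<ge> 1 \<Longrightarrow> real n * v n = (\<Sum>k=1..n. real k * b k * v (n - k))"
  shows "v sums exp s"
proof -
  define B where "B = Abs_fps b"
  define F where "F = fps_exp 1 oo B"
  have B0: "fps_nth B 0 = 0" by (simp add: B_def b)
  have dF: "fps_deriv F = F * fps_deriv B"
    unfolding F_def using fps_compose_deriv[OF B0, of "fps_exp (1::real)"] by simp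
  have F: "v n = fps_nth F n" for n
  proof (induction n rule: less_induct)
    case (less n)
    show ?case
    proof (cases n)
      case (Suc m)
      have "real n * fps_nth F n = fps_nth (fps_deriv F) m" using Suc by simp
      also have "\<dots> = (\<Sum>i=0..m. fps_nth (fps_deriv B) i * fps_nth F (m - i))"
        unfolding dF by (subst mult.commute) (simp add: fps_mult_nth)
      also have "\<dots> = (\<Sum>k=1..n. real k * b k * v (n - k))"
        using less.IH unfolding Suc
        by (intro sum.reindex_bij_witness[of _ "\<lambda>k. k - 1" Suc]) (auto simp: B_def)
      also have "\<dots> = real n * v n" using v(2)[of n] Suc by simp
      finally show ?thesis using Suc by simp
    qed (simp add: v F_def)
  qed
  have vn: "v n = (\<Sum>i\<le>n. fps_nth (B ^ i) n / fact i)" for n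
    by (simp add: F F_def fps_compose_nth atLeast0AtMost)
  have Bnn: "fps_nth (B ^ i) n \<ge> 0" for i n
  proof (induction i arbitrary: n)
    case (Suc i)
    then show ?case by (auto simp: fps_mult_nth B_def b intro!: sum_nonneg mult_nonneg_nonneg)
  qed (simp add: fps_one_nth)
  have Bs: "(\<lambda>n. fps_nth (B ^ i) n) sums s ^ i" for i
  proof (induction i)
    case 0
    then show ?case using sums_single[of 0 "\<lambda>_. 1::real"] by (simp add: fps_one_nth)
  next
    case (Suc i)
    have "(\<lambda>k. \<Sum>j\<le>k. b j * fps_nth (B ^ i) (k - j)) sums ((\<Sum>k. b k) * (\<Sum>k. fps_nth (B ^ i) k))"
      using b Suc.IH Bnn by (intro Cauchy_product_sums) (auto simp: sums_iff)
    also have "(\<lambda>k. \<Sum>j\<le>k. b j * fps_nth (B ^ i) (k - j)) = (\<lambda>k. fps_nth (B ^ Suc i) k)"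
      by (simp add: fps_mult_nth B_def atLeast0AtMost)
    finally show ?case using b(3) Suc.IH by (simp add: sums_iff)
  qed
  have Bz: "fps_nth (B ^ i) n = 0" if "n < i" for i n
    using startsby_zero_power_prefix[OF B0, of i] that by blast
  have s0: "s \<ge> 0" using b sums_le[of "\<lambda>_. 0" b 0 s] by simp
  have vnn: "v n \<ge> 0" for n unfolding vn using Bnn by (intro sum_nonneg) auto
  have part: "(\<Sum>i\<le>N. fps_nth (B ^ i) n / fact i) = v n" if "n \<le> N" for n N
    unfolding vn using that Bz by (intro sum.mono_neutral_right) auto
  have "s ^ i / fact i = (s ^ i) /\<^sub>R fact i" for i by (simp add: divide_inverse mult.commute)
  then have es: "(\<lambda>i. s ^ i / fact i) sums exp s" using exp_converges[of s] by simp
  have fs: "(\<lambda>n. \<Sum>i\<le>N. fps_nth (B ^ i) n / fact i) sums (\<Sum>i\<le>N. s ^ i / fact i)" for N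
    by (intro sums_sum sums_divide Bs)
  \<comment> \<open>Dropping the powers of B above N does not affect the coefficients below N, so
    the partial sum is bounded by a truncated exponential series.\<close>
  have up: "(\<Sum>n<N. v n) \<le> exp s" for N
  proof -
    have "(\<Sum>n<N. v n) = (\<Sum>n<N. \<Sum>i\<le>N. fps_nth (B ^ i) n / fact i)"
      using part[of _ N] by (intro sum.cong) auto
    also have "\<dots> \<le> (\<Sum>i\<le>N. s ^ i / fact i)"
      using fs[of N] Bnn unfolding sums_iff
      by (metis (no_types, lifting) sum_le_suminf[OF _ finite_lessThan] divide_nonneg_nonneg fact_ge_zero sum_nonneg)
    also have "\<dots> \<le> exp s"
      using sum_le_suminf[of "\<lambda>i. s ^ i / fact i" "{..N}"] es s0 by (auto simp: sums_iff)
    finally show ?thesis .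
  qed
  have sv: "summable v" by (rule bounded_imp_summable[of v "exp s"]) (use vnn up[of "Suc _"] in \<open>auto simp: lessThan_Suc_atMost\<close>)
  \<comment> \<open>Conversely, each truncated exponential series is bounded coefficient by
    coefficient by the whole series of v.\<close>
  have "exp s \<le> suminf v"
  proof (rule LIMSEQ_le_const2)
    show "(\<lambda>N. \<Sum>i\<le>N. s ^ i / fact i) \<longlonglongrightarrow> exp s" using es by (simp add: sums_def_le)
    have "(\<Sum>i\<le>N. s ^ i / fact i) \<le> suminf v" for N
    proof (rule sums_le[OF _ fs summable_sums[OF sv]])
      fix n
      have "(\<Sum>i\<le>N. fps_nth (B ^ i) n / fact i) \<le> (\<Sum>i\<le>max n N. fps_nth (B ^ i) n / fact i)"
        using Bnn by (intro sum_mono2) auto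
      then show "(\<Sum>i\<le>N. fps_nth (B ^ i) n / fact i) \<le> v n" using part[of n "max n N"] by simp
    qed
    then show "\<exists>N. \<forall>n\<ge>N. (\<Sum>i\<le>n. s ^ i / fact i) \<le> suminf v" by blast
  qed
  moreover have "suminf v \<le> exp s" using sv up by (intro suminf_le_const) auto
  ultimately show ?thesis using sv by (simp add: sums_iff)
qed

section \<open>Trees at the radius of convergence\<close>

text \<open>The terms of the exponential generating function of trees at 1/e. The case n = 0 is
  separate because \<open>0 ^ (0 - 2)\<close> is 1.\<close>

definition tree_weight :: "nat \<Rightarrow> real" where
  "tree_weight n = (if n = 0 then 0 else real (n ^ (n - 2)) * exp (- real n) / fact n)"

text \<open>The terms of Cayley's tree function T = x exp T, which counts rooted trees, at the same
  point.\<close>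

definition rooted_weight :: "nat \<Rightarrow> real" where
  "rooted_weight n = real n * tree_weight n"

lemma tree_weight_0 [simp]: "tree_weight 0 = 0" by (simp add: tree_weight_def)
lemma rooted_weight_0 [simp]: "rooted_weight 0 = 0" by (simp add: rooted_weight_def)
lemma tree_weight_1 [simp]: "tree_weight (Suc 0) = exp (-1)" by (simp add: tree_weight_def)
lemma rooted_weight_1 [simp]: "rooted_weight (Suc 0) = exp (-1)" by (simp add: rooted_weight_def)

lemma tree_weight_pos: "n \<ge> 1 \<Longrightarrow> tree_weight n > 0"
  by (simp add: tree_weight_def)

lemma tree_weight_nonneg: "tree_weight n \<ge> 0"
  by (simp add: tree_weight_def)

lemma rooted_weight_pos: "n \<ge> 1 \<Longrightarrow> rooted_weight n > 0"
  by (simp add: rooted_weight_def tree_weight_pos)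

lemma rooted_weight_nonneg: "rooted_weight n \<ge> 0"
  by (simp add: rooted_weight_def tree_weight_nonneg)

text \<open>The real exponent also covers n = 1, where the exponent in the definition is truncated,
  because the base is then 1.\<close>

lemma tree_weight_powr:
  assumes "n \<ge> 1"
  shows "tree_weight n = real n powr (real n - 2) * exp (- real n) / fact n"
proof (cases "n = 1")
  case False
  then have "real n - 2 = real (n - 2)" using assms by (simp add: of_nat_diff)
  moreover have "real n powr real (n - 2) = real n ^ (n - 2)" using assms by (intro powr_realpow) simp
  ultimately have "real n powr (real n - 2) = real n ^ (n - 2)" by metis
  then show ?thesis using assms by (simp add: tree_weight_def)
qed simp

lemma tree_weight_ratio:
  assumes "n \<ge> 1"
  shows "tree_weight (Suc n) / tree_weight n = (1 + 1 / real n) powr (real n - 2) / exp 1"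
proof -
  have n: "real n > 0" using assms by simp
  have "real (Suc n) powr (real (Suc n) - 2) = real (Suc n) powr (real n - 2) * real (Suc n)"
    using powr_add[of "real (Suc n)" "real n - 2" 1] by (simp add: algebra_simps)
  then have "tree_weight (Suc n) = real (Suc n) powr (real n - 2) * real (Suc n) * exp (- real (Suc n)) / (real (Suc n) * fact n)"
    using tree_weight_powr[of "Suc n"] by (simp only: fact_Suc of_nat_mult of_nat_fact)
  also have "\<dots> = real (Suc n) powr (real n - 2) * exp (- real (Suc n)) / fact n"
    by (simp del: of_nat_Suc)
  finally have "tree_weight (Suc n) / tree_weight n =
     real (Suc n) powr (real n - 2) / real n powr (real n - 2) * (exp (- real (Suc n)) / exp (- real n))"
    using tree_weight_powr[OF assms] by (simp del: of_nat_Suc)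
  also have "exp (- real (Suc n)) / exp (- real n) = 1 / exp 1"
    using exp_diff[of "- real (Suc n)" "- real n"] by (simp add: exp_minus divide_inverse)
  also have "real (Suc n) powr (real n - 2) / real n powr (real n - 2) = (1 + 1 / real n) powr (real n - 2)"
    using n by (simp add: powr_divide[symmetric] field_simps)
  finally show ?thesis by simp
qed

lemma tree_weight_ratio_tendsto: "(\<lambda>n. tree_weight (Suc n) / tree_weight n) \<longlonglongrightarrow> 1"
proof -
  have "(\<lambda>n. (1 + 1 / real n) powr (real n - 2) / exp 1) \<longlonglongrightarrow> 1" by real_asymp
  moreover have "eventually (\<lambda>n. (1 + 1 / real n) powr (real n - 2) / exp 1 = tree_weight (Suc n) / tree_weight n) sequentially"
    using eventually_ge_at_top[of 1] by eventually_elim (simp add: tree_weight_ratio)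
  ultimately show ?thesis by (auto intro: Lim_transform_eventually)
qed

text \<open>The exponential growth is divided out, so the successive ratios tend to 1, and finitely
  many of them telescope. This is why taking away a fragment of fixed size has a limiting
  cost.\<close>

lemma tree_weight_shift_tendsto: "(\<lambda>n. tree_weight (n - j) / tree_weight n) \<longlonglongrightarrow> 1"
proof -
  have "(\<lambda>n. tree_weight (n + j) / tree_weight n) \<longlonglongrightarrow> 1" for j
  proof (induction j)
    case 0
    have "eventually (\<lambda>n. tree_weight (n + 0) / tree_weight n = 1) sequentially"
      using eventually_ge_at_top[of 1] by eventually_elim (use tree_weight_pos in fastforce)
    then show ?case by (rule tendsto_eventually)
  next
    case (Suc j)
    have "(\<lambda>n. tree_weight (Suc (n + j)) / tree_weight (n + j) * (tree_weight (n + j) / tree_weight n)) \<longlonglongrightarrow> 1 * 1"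
      using tree_weight_ratio_tendsto LIMSEQ_ignore_initial_segment by (intro tendsto_mult Suc.IH) fast
    moreover have "eventually (\<lambda>n. tree_weight (Suc (n + j)) / tree_weight (n + j) * (tree_weight (n + j) / tree_weight n) =
        tree_weight (n + Suc j) / tree_weight n) sequentially"
      using eventually_ge_at_top[of 1] by eventually_elim (use tree_weight_pos in \<open>simp add: less_imp_neq[OF tree_weight_pos, symmetric]\<close>)
    ultimately have "(\<lambda>n. tree_weight (n + Suc j) / tree_weight n) \<longlonglongrightarrow> 1 * 1"
      by (rule Lim_transform_eventually)
    then show ?case by simp
  qed
  from tendsto_inverse[OF this[of j]]
  have "(\<lambda>n. tree_weight n / tree_weight (n + j)) \<longlonglongrightarrow> 1" by simp
  then have "(\<lambda>n. tree_weight (n + j - j) / tree_weight (n + j)) \<longlonglongrightarrow> 1" by simp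
  then show ?thesis by (rule LIMSEQ_offset)
qed

text \<open>The quantity is n^3 \<open>tree_weight n\<close>, and its successive quotients (1 +
  1/n)^(n+1) / e are at least 1. The true order of \<open>rooted_weight n\<close> is n^(-3/2), but a
  decay no faster than n^(-2) suffices and spares Stirling's formula.\<close>

lemma rooted_weight_mono:
  assumes "1 \<le> m" "m \<le> n"
  shows "real m ^ 2 * rooted_weight m \<le> real n ^ 2 * rooted_weight n"
  using assms(2,1)
proof (induction n rule: dec_induct)
  case (step n)
  have n: "real n > 0" using step by simp
  have "- ln (1 + 1 / real n) \<le> - (1 / (real n + 1))"
  proof -
    have "- ln (1 + 1 / real n) = ln (n / (real n + 1))"
      using n by (simp add: ln_div[symmetric] field_simps flip: ln_inverse)
    also have "\<dots> \<le> n / (real n + 1) - 1" using n by (intro ln_le_minus_one) auto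
    also have "\<dots> = - (1 / (real n + 1))" using n by (simp add: field_simps)
    finally show ?thesis .
  qed
  then have "1 \<le> (real n + 1) * ln (1 + 1 / real n)" using n by (simp add: field_simps)
  then have "exp 1 \<le> exp ((real n + 1) * ln (1 + 1 / real n))" by simp
  also have "\<dots> = (1 + 1 / real n) powr (real n + 1)"
    using n by (simp add: powr_def add_pos_pos less_imp_neq[symmetric])
  also have "\<dots> = (1 + 1 / real n) powr (real n - 2) * (1 + 1 / real n) ^ 3"
    using n powr_add[of "1 + 1 / real n" "real n - 2" 3]
    by (simp add: add_pos_pos less_imp_neq[symmetric] add.commute)
  finally have "1 \<le> (1 + 1 / real n) powr (real n - 2) / exp 1 * (1 + 1 / real n) ^ 3"
    by (simp add: field_simps)
  then have "1 \<le> tree_weight (Suc n) / tree_weight n * (real (Suc n) / real n) ^ 3"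
    using n step by (simp add: tree_weight_ratio add_divide_distrib add.commute)
  then have "real n ^ 3 * tree_weight n \<le> real (Suc n) ^ 3 * tree_weight (Suc n)"
    using n tree_weight_pos[of n] step by (simp add: field_simps)
  then have "real n ^ 2 * rooted_weight n \<le> real (Suc n) ^ 2 * rooted_weight (Suc n)"
    by (simp add: rooted_weight_def power2_eq_square power3_eq_cube mult_ac)
  then show ?case using step by simp
qed simp

text \<open>The 4 is the square of the bound 2 on n / m.\<close>

lemma rooted_weight_half:
  assumes "1 \<le> m" "m \<le> n" "n \<le> 2 * m"
  shows "rooted_weight m \<le> 4 * rooted_weight n"
proof -
  have "real m ^ 2 * rooted_weight m \<le> real n ^ 2 * rooted_weight n"
    using rooted_weight_mono assms by blast
  also have "\<dots> \<le> (2 * real m) ^ 2 * rooted_weight n"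
    using assms rooted_weight_nonneg by (intro mult_right_mono power_mono) auto
  finally have "real m ^ 2 * rooted_weight m \<le> real m ^ 2 * (4 * rooted_weight n)" by (simp add: power_mult_distrib)
  then show ?thesis using assms by (simp add: mult_le_cancel_left)
qed

text \<open>At the radius of convergence the ratio test is inconclusive. Raabe's test succeeds with
  the value 3/2, in accordance with the order n^(-3/2).\<close>

lemma summable_rooted_weight: "summable rooted_weight"
proof (rule raabes_test_convergence)
  show "eventually (\<lambda>n. rooted_weight n > 0) sequentially"
    using eventually_ge_at_top[of 1] by eventually_elim (rule rooted_weight_pos)
  have "(\<lambda>n. real n * (exp 1 / (1 + 1 / real n) powr (real n - 1) - 1)) \<longlonglongrightarrow> 3 / 2" by real_asymp
  moreover have "eventually (\<lambda>n. real n * (exp 1 / (1 + 1 / real n) powr (real n - 1) - 1) =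
     of_nat n * (rooted_weight n / rooted_weight (Suc n) - 1)) sequentially"
    using eventually_ge_at_top[of 1]
  proof eventually_elim
    case (elim n)
    have n: "real n > 0" using elim by simp
    have "(1 + 1 / real n) powr (real n - 1) = (1 + 1 / real n) powr (real n - 2) * (1 + 1 / real n)"
      using n powr_add[of "1 + 1 / real n" "real n - 2" 1] by (simp add: add_pos_pos less_imp_le)
    moreover have "rooted_weight (Suc n) / rooted_weight n = tree_weight (Suc n) / tree_weight n * (1 + 1 / real n)"
      using n by (simp add: rooted_weight_def field_simps)
    ultimately have "rooted_weight (Suc n) / rooted_weight n = (1 + 1 / real n) powr (real n - 1) / exp 1"
      unfolding tree_weight_ratio[OF elim] by simp
    then have "rooted_weight n / rooted_weight (Suc n) = exp 1 / (1 + 1 / real n) powr (real n - 1)"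
      by (metis inverse_divide)
    then show ?case by simp
  qed
  ultimately have "(\<lambda>n. of_nat n * (rooted_weight n / rooted_weight (Suc n) - 1)) \<longlonglongrightarrow> 3 / 2"
    by (rule Lim_transform_eventually)
  then have "(\<lambda>n. ereal (of_nat n * (rooted_weight n / rooted_weight (Suc n) - 1))) \<longlonglongrightarrow> ereal (3 / 2)"
    by simp
  then have "liminf (\<lambda>n. ereal (of_nat n * (rooted_weight n / rooted_weight (Suc n) - 1))) = ereal (3 / 2)"
    by (intro lim_imp_Liminf) auto
  then show "1 < liminf (\<lambda>n. ereal (of_nat n * (rooted_weight n / rooted_weight (Suc n) - 1)))" by simp
qed

lemma tree_weight_le_rooted: "tree_weight n \<le> rooted_weight n"
  using mult_right_mono[of 1 "real n" "tree_weight n"]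
  by (cases "n = 0") (auto simp: rooted_weight_def tree_weight_nonneg)

lemma summable_tree_weight: "summable tree_weight"
  using summable_comparison_test_ev[OF _ summable_rooted_weight, of tree_weight]
  by (simp add: tree_weight_nonneg tree_weight_le_rooted)

lemma rooted_weight_eq: "n \<ge> 1 \<Longrightarrow> rooted_weight n = real (n ^ (n - 1)) * exp (- real n) / fact n"
proof -
  assume "n \<ge> 1"
  then have "real n * real (n ^ (n - 2)) = real (n ^ (n - 1))"
    by (cases "n = 1") (auto simp: power_Suc[symmetric] Suc_diff_Suc numeral_2_eq_2 simp del: power_Suc)
  then show ?thesis using \<open>n \<ge> 1\<close> by (simp add: rooted_weight_def tree_weight_def mult.assoc[symmetric])
qed

text \<open>Abel's convolution divided by n!. In generating functions it reads T^2 = 2T - 2U with U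
  for unrooted trees, that is, U = T - T^2/2: a tree has one vertex more than it has edges.\<close>

lemma rooted_weight_convolution:
  "(\<Sum>i\<le>n. rooted_weight i * rooted_weight (n - i)) = 2 * rooted_weight n - 2 * tree_weight n"
proof (cases "n \<ge> 2")
  case True
  have "(\<Sum>i\<le>n. rooted_weight i * rooted_weight (n - i)) = (\<Sum>i=1..n-1. rooted_weight i * rooted_weight (n - i))"
  proof (rule sum.mono_neutral_right)
    show "\<forall>i\<in>{..n} - {1..n - 1}. rooted_weight i * rooted_weight (n - i) = 0"
    proof
      fix i assume "i \<in> {..n} - {1..n - 1}"
      then have "i = 0 \<or> i = n" by auto
      then show "rooted_weight i * rooted_weight (n - i) = 0" by auto
    qed
  qed auto
  also have "\<dots> = (\<Sum>i=1..n-1. exp (- real n) / fact n * real ((n choose i) * i ^ (i - 1) * (n - i) ^ (n - i - 1)))"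
  proof (rule sum.cong[OF refl])
    fix i assume i: "i \<in> {1..n-1}"
    then have "real i + real (n - i) = real n" using True by (simp flip: of_nat_add) linarith
    then have "exp (- real i) * exp (- real (n - i)) = exp (- real n)"
      by (simp add: exp_add[symmetric])
    moreover have "real (n choose i) = fact n / (fact i * fact (n - i))"
      using i by (intro binomial_fact) auto
    ultimately show "rooted_weight i * rooted_weight (n - i) =
        exp (- real n) / fact n * real ((n choose i) * i ^ (i - 1) * (n - i) ^ (n - i - 1))"
    proof -
      assume e: "exp (- real i) * exp (- real (n - i)) = exp (- real n)"
        and b: "real (n choose i) = fact n / (fact i * fact (n - i))"
      have "1 \<le> i" "1 \<le> n - i" using i True by auto
      then have "rooted_weight i * rooted_weight (n - i) = real (i ^ (i - 1)) * real ((n - i) ^ (n - i - 1)) *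
          (exp (- real i) * exp (- real (n - i))) / (fact i * fact (n - i))"
        by (simp only: rooted_weight_eq) (simp only: times_divide_times_eq mult_ac)
      then show ?thesis unfolding e by (simp add: b)
    qed
  qed
  also have "\<dots> = exp (- real n) / fact n * real (\<Sum>i=1..n-1. (n choose i) * i ^ (i - 1) * (n - i) ^ (n - i - 1))"
    by (simp only: sum_distrib_left of_nat_sum)
  also have "\<dots> = exp (- real n) / fact n * real (2 * (n - 1) * n ^ (n - 2))"
    by (simp only: abel_convolution[OF True])
  also have "\<dots> = 2 * rooted_weight n - 2 * tree_weight n"
    using True by (simp add: rooted_weight_def tree_weight_def of_nat_diff field_simps)
  finally show ?thesis .
next
  case False
  then consider "n = 0" | "n = Suc 0" by linarith
  then show ?thesis by cases auto
qed

text \<open>Weighted by the index and symmetrised, the convolution identity becomes the recurrence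
  of the exponential formula for the shifted series; this is T = x exp T. At x = 1/e the sum U
  satisfies e U = exp U, hence ln U = U - 1, and U = 1 is the only solution.\<close>

lemma rooted_weight_sums: "rooted_weight sums 1"
proof -
  define U where "U = suminf rooted_weight"
  have U: "rooted_weight sums U" using summable_rooted_weight by (simp add: U_def summable_sums)
  define r where "r = (\<lambda>n. exp 1 * rooted_weight (Suc n))"
  have "r sums (exp 1 * U)"
    unfolding r_def using U sums_Suc_iff[of rooted_weight U] by (intro sums_mult) simp
  moreover have "r sums exp U"
  proof (rule exp_formula)
    show "r 0 = 1" by (simp add: r_def exp_minus)
    fix n :: nat assume n: "n \<ge> 1"
    define c where "c = (\<lambda>i. rooted_weight i * rooted_weight (Suc n - i))"
    have "(\<Sum>i\<le>Suc n. real i * c i) = (\<Sum>i\<le>Suc n. real (Suc n - i) * c i)"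
      by (rule sum.reindex_bij_witness[of _ "\<lambda>i. Suc n - i" "\<lambda>i. Suc n - i"]) (auto simp: c_def mult_ac)
    moreover have "(\<Sum>i\<le>Suc n. real i * c i) + (\<Sum>i\<le>Suc n. real (Suc n - i) * c i) = real (Suc n) * (\<Sum>i\<le>Suc n. c i)"
      unfolding sum.distrib[symmetric] sum_distrib_left
      by (intro sum.cong) (auto simp: algebra_simps of_nat_diff)
    moreover have "real (Suc n) * (\<Sum>i\<le>Suc n. c i) = 2 * real n * rooted_weight (Suc n)"
      unfolding c_def rooted_weight_convolution by (simp add: rooted_weight_def algebra_simps)
    ultimately have "real n * rooted_weight (Suc n) = (\<Sum>i\<le>Suc n. real i * c i)" by simp
    also have "\<dots> = (\<Sum>k=1..n. real k * c k)"
      by (rule sum.mono_neutral_right) (auto simp: c_def le_Suc_eq not_le)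
    finally have "real n * rooted_weight (Suc n) = (\<Sum>k=1..n. real k * c k)" .
    moreover have "real n * r n = exp 1 * (real n * rooted_weight (Suc n))" by (simp add: r_def)
    ultimately have "real n * r n = (\<Sum>k=1..n. exp 1 * (real k * c k))"
      by (simp only: sum_distrib_left)
    also have "\<dots> = (\<Sum>k=1..n. real k * rooted_weight k * r (n - k))"
      by (intro sum.cong) (auto simp: r_def c_def Suc_diff_le)
    finally show "real n * r n = (\<Sum>k=1..n. real k * rooted_weight k * r (n - k))" .
  qed (use U rooted_weight_nonneg in auto)
  ultimately have e: "exp 1 * U = exp U" by (rule sums_unique2)
  have "U > 0" using e by (metis exp_gt_zero zero_less_mult_pos)
  have "ln (exp 1 * U) = U" using e by simp
  then have "ln U = U - 1" using \<open>U > 0\<close> by (simp add: ln_mult)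
  then have "U = 1" using ln_eq_minus_one \<open>U > 0\<close> by blast
  then show ?thesis using U by simp
qed

text \<open>Summing T^2 = 2T - 2U gives 1 = 2 - 2U. This 1/2 is the exponent in the ratio of forests
  to trees.\<close>

lemma tree_weight_sums: "tree_weight sums (1 / 2)"
proof -
  have "(\<lambda>k. \<Sum>i\<le>k. rooted_weight i * rooted_weight (k - i)) sums (1 * 1)"
    using Cauchy_product_sums[of rooted_weight rooted_weight] summable_rooted_weight rooted_weight_sums
    by (simp add: rooted_weight_nonneg sums_iff)
  then have "(\<lambda>k. 2 * rooted_weight k - 2 * tree_weight k) sums 1"
    by (simp add: rooted_weight_convolution)
  moreover have "(\<lambda>k. 2 * rooted_weight k - 2 * tree_weight k) sums (2 * 1 - 2 * suminf tree_weight)"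
    by (intro sums_diff sums_mult rooted_weight_sums summable_sums summable_tree_weight)
  ultimately have "2 * 1 - 2 * suminf tree_weight = 1" by (rule sums_unique2[symmetric])
  then show ?thesis using summable_tree_weight by (simp add: sums_iff)
qed

section \<open>Forest weights and the dominance of one large component\<close>

context
  fixes v :: "nat \<Rightarrow> real"
  assumes v0: "v 0 = 1"
    and vrec: "\<And>n. n \<ge> 1 \<Longrightarrow> real n * v n = (\<Sum>k=1..n. rooted_weight k * v (n - k))"
begin

text \<open>As \<open>rooted_weight k\<close> is k times \<open>tree_weight k\<close>, the
  recurrence is that of the exponential formula for the tree weights.\<close>

lemma forest_weight_sums: "v sums exp (1 / 2)"
  using v0 vrec tree_weight_nonneg tree_weight_sums
  by (intro exp_formula[of tree_weight]) (auto simp: rooted_weight_def)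

lemma forest_weight_nonneg: "v n \<ge> 0"
proof (induction n rule: less_induct)
  case (less n)
  show ?case
  proof (cases "n = 0")
    case False
    have "real n * v n \<ge> 0"
      using False less.IH by (subst vrec) (auto intro!: sum_nonneg mult_nonneg_nonneg rooted_weight_nonneg)
    then show ?thesis using False by (simp add: zero_le_mult_iff)
  qed (simp add: v0)
qed

text \<open>The bound is the weight (n+1)^(n-1) e^(-n) / n! of rooted forests. Inserted into the
  recurrence it can be summed by the convolution identity. It exceeds the true order by a factor of
  about n, which the next lemma removes.\<close>

lemma forest_weight_le: "v n \<le> exp 1 * rooted_weight (Suc n)"
proof (induction n rule: less_induct)
  case (less n)
  show ?case
  proof (cases "n = 0")
    case False
    then have n: "n \<ge> 1" by simp
    define c where "c = (\<lambda>i. rooted_weight i * rooted_weight (Suc n - i))"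
    have "real n * v n = (\<Sum>k=1..n. rooted_weight k * v (n - k))" using vrec n by simp
    also have "\<dots> \<le> (\<Sum>k=1..n. exp 1 * c k)"
    proof (rule sum_mono)
      fix k assume k: "k \<in> {1..n}"
      have "v (n - k) \<le> exp 1 * rooted_weight (Suc (n - k))" using less.IH[of "n - k"] k by simp
      then have "rooted_weight k * v (n - k) \<le> rooted_weight k * (exp 1 * rooted_weight (Suc (n - k)))"
        by (intro mult_left_mono rooted_weight_nonneg)
      then show "rooted_weight k * v (n - k) \<le> exp 1 * c k" using k by (simp add: c_def mult_ac Suc_diff_le)
    qed
    also have "\<dots> = exp 1 * (\<Sum>i\<le>Suc n. c i)"
      unfolding sum_distrib_left by (rule sum.mono_neutral_left) (auto simp: c_def le_Suc_eq not_le)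
    also have "(\<Sum>i\<le>Suc n. c i) = 2 * rooted_weight (Suc n) - 2 * tree_weight (Suc n)"
      unfolding c_def by (rule rooted_weight_convolution)
    also have "\<dots> = 2 * real n * tree_weight (Suc n)" by (simp add: rooted_weight_def algebra_simps)
    also have "\<dots> \<le> real n * rooted_weight (Suc n)"
      using n tree_weight_nonneg[of "Suc n"] by (simp add: rooted_weight_def mult_left_mono mult_right_mono)
    finally have "real n * v n \<le> real n * (exp 1 * rooted_weight (Suc n))" by (simp add: mult_ac)
    then show ?thesis using n by (simp add: mult_le_cancel_left)
  qed (simp add: v0 exp_minus)
qed

lemma forest_weight_conv: "n \<ge> 1 \<Longrightarrow> real n * v n = (\<Sum>j<n. rooted_weight (n - j) * v j)"
  by (subst vrec) (auto intro!: sum.reindex_bij_witness[of _ "\<lambda>j. n - j" "\<lambda>j. n - j"])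

text \<open>The recurrence is split at j = n/2. Below, \<open>rooted_weight (n - j)\<close> is at
  most 4 \<open>rooted_weight n\<close> and the forest weights sum to at most e^(1/2). Above, the
  crude bound makes \<open>v j\<close> at most 4e \<open>rooted_weight n\<close> and the rooted
  weights sum to at most 1. Hence the two summands of the constant.\<close>

lemma forest_weight_bound: "\<exists>K\<ge>0. \<forall>n\<ge>1. v n \<le> K * tree_weight n"
proof (intro exI conjI allI impI)
  let ?K = "4 * exp (1/2) + 4 * exp 1 :: real"
  show "?K \<ge> 0" by (simp add: add_nonneg_nonneg)
  fix n :: nat assume n: "n \<ge> 1"
  have "real n * v n = (\<Sum>j<n. rooted_weight (n - j) * v j)" by (rule forest_weight_conv[OF n])
  also have "\<dots> \<le> (\<Sum>j<n. 4 * rooted_weight n * v j + 4 * exp 1 * rooted_weight n * rooted_weight (n - j))"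
  proof (rule sum_mono)
    fix j assume j: "j \<in> {..<n}"
    show "rooted_weight (n - j) * v j \<le> 4 * rooted_weight n * v j + 4 * exp 1 * rooted_weight n * rooted_weight (n - j)"
    proof (cases "2 * j \<le> n")
      case True
      have "rooted_weight (n - j) \<le> 4 * rooted_weight n" using True j by (intro rooted_weight_half) auto
      then have "rooted_weight (n - j) * v j \<le> 4 * rooted_weight n * v j"
        by (intro mult_right_mono forest_weight_nonneg)
      then show ?thesis using rooted_weight_nonneg by (intro add_increasing2) auto
    next
      case False
      have "v j \<le> exp 1 * rooted_weight (Suc j)" by (rule forest_weight_le)
      also have "\<dots> \<le> exp 1 * (4 * rooted_weight n)" using False j by (intro mult_left_mono rooted_weight_half) auto
      finally have "rooted_weight (n - j) * v j \<le> rooted_weight (n - j) * (exp 1 * (4 * rooted_weight n))"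
        by (intro mult_left_mono rooted_weight_nonneg)
      then show ?thesis using rooted_weight_nonneg forest_weight_nonneg
        by (intro add_increasing) (auto simp: mult_ac)
    qed
  qed
  also have "\<dots> = 4 * rooted_weight n * (\<Sum>j<n. v j) + 4 * exp 1 * rooted_weight n * (\<Sum>j<n. rooted_weight (n - j))"
    by (simp add: sum.distrib sum_distrib_left)
  also have "\<dots> \<le> 4 * rooted_weight n * exp (1/2) + 4 * exp 1 * rooted_weight n * 1"
  proof (intro add_mono mult_left_mono)
    show "(\<Sum>j<n. v j) \<le> exp (1/2)"
      using forest_weight_sums forest_weight_nonneg sum_le_suminf[of v "{..<n}"] by (auto simp: sums_iff)
    have "(\<Sum>j<n. rooted_weight (n - j)) = (\<Sum>j\<in>{1..n}. rooted_weight j)"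
      by (rule sum.reindex_bij_witness[of _ "\<lambda>j. n - j" "\<lambda>j. n - j"]) auto
    also have "\<dots> \<le> 1"
      using rooted_weight_sums rooted_weight_nonneg sum_le_suminf[of rooted_weight "{1..n}"] by (auto simp: sums_iff)
    finally show "(\<Sum>j<n. rooted_weight (n - j)) \<le> 1" .
  qed (auto simp: rooted_weight_nonneg)
  also have "\<dots> = real n * (?K * tree_weight n)" by (simp add: rooted_weight_def algebra_simps)
  finally show "v n \<le> ?K * tree_weight n" using n by (simp add: mult_le_cancel_left)
qed

text \<open>Divided by \<open>rooted_weight n\<close>, the recurrence expresses the ratio as a sum
  of the \<open>v j\<close> with factors tending to 1, where j is the number of vertices outside one
  component. Termwise the limit is the sum of all \<open>v j\<close>, that is, e^(1/2).\<close>

lemma forest_tree_ratio: "(\<lambda>n. v n / tree_weight n) \<longlonglongrightarrow> exp (1 / 2)"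
proof -
  obtain K where K: "K \<ge> 0" "\<And>n. n \<ge> 1 \<Longrightarrow> v n \<le> K * tree_weight n"
    using forest_weight_bound by blast
  \<comment> \<open>Up to j = n/2 the doubling bound dominates the terms by 4 \<open>v j\<close>, so
    Tannery's theorem applies to this truncation.\<close>
  define a where "a = (\<lambda>j n. if 2 * j \<le> n then rooted_weight (n - j) / rooted_weight n * v j else 0)"
  have shift: "(\<lambda>n. rooted_weight (n - j) / rooted_weight n) \<longlonglongrightarrow> 1" for j
  proof -
    have "(\<lambda>n. real (n - j) / real n) \<longlonglongrightarrow> 1"
    proof -
      have "(\<lambda>n. (real n - real j) / real n) \<longlonglongrightarrow> 1" by real_asymp
      moreover have "eventually (\<lambda>n. (real n - real j) / real n = real (n - j) / real n) sequentially"
        using eventually_ge_at_top[of j] by eventually_elim (simp add: of_nat_diff)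
      ultimately show ?thesis by (auto intro: Lim_transform_eventually)
    qed
    from tendsto_mult[OF this tree_weight_shift_tendsto[of j]]
    show ?thesis by (simp add: rooted_weight_def)
  qed
  have lim: "(\<lambda>n. a j n) \<longlonglongrightarrow> v j" for j
  proof -
    have "(\<lambda>n. rooted_weight (n - j) / rooted_weight n * v j) \<longlonglongrightarrow> 1 * v j"
      by (intro tendsto_mult shift tendsto_const)
    moreover have "eventually (\<lambda>n. rooted_weight (n - j) / rooted_weight n * v j = a j n) sequentially"
      using eventually_ge_at_top[of "2 * j"] by eventually_elim (simp add: a_def)
    ultimately show ?thesis by (auto intro: Lim_transform_eventually)
  qed
  have half: "rooted_weight m / rooted_weight n \<le> 4" if "1 \<le> m" "m \<le> n" "n \<le> 2 * m" for m n
    using rooted_weight_half[OF that] rooted_weight_pos[of n] that by (simp add: divide_le_eq)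
  have bound: "norm (a j n) \<le> 4 * v j" if "n \<ge> 1" for j n
  proof (cases "2 * j \<le> n")
    case True
    have "rooted_weight (n - j) / rooted_weight n * v j \<le> 4 * v j"
      using that True forest_weight_nonneg by (intro mult_right_mono half) auto
    moreover have "rooted_weight (n - j) / rooted_weight n * v j \<ge> 0"
      using forest_weight_nonneg rooted_weight_nonneg by simp
    ultimately show ?thesis using True by (simp add: a_def)
  qed (simp add: a_def forest_weight_nonneg)
  have "((\<lambda>n. suminf (\<lambda>j. a j n)) \<longlongrightarrow> suminf v) sequentially"
  proof (rule tannerys_theorem[THEN conjunct2, THEN conjunct2, OF lim])
    show "\<forall>\<^sub>F (k, n) in sequentially \<times>\<^sub>F sequentially. norm (a k n) \<le> 4 * v k"
      unfolding eventually_prod_sequentially using bound by (intro exI[of _ 1]) auto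
    show "summable (\<lambda>k. 4 * v k)" using forest_weight_sums by (auto simp: sums_iff)
  qed simp
  then have main: "(\<lambda>n. \<Sum>j. a j n) \<longlonglongrightarrow> exp (1/2)" using forest_weight_sums by (simp add: sums_iff)
  \<comment> \<open>In the other half, \<open>v j\<close> is at most K
    \<open>rooted_weight j\<close> / j with j > n/2. The denominator gains a factor 1/n, and the
    remaining rooted weights sum to at most 1.\<close>
  have diff: "v n / tree_weight n - (\<Sum>j. a j n) \<in> {0..8 * K / real n}" if n: "n \<ge> 1" for n
  proof -
    have "(\<Sum>j. a j n) = (\<Sum>j<n. a j n)"
    proof (rule suminf_finite)
      fix j assume "j \<notin> {..<n}"
      then show "a j n = 0" using n by (auto simp: a_def)
    qed simp
    moreover have "v n / tree_weight n = (\<Sum>j<n. rooted_weight (n - j) / rooted_weight n * v j)"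
    proof -
      have "v n / tree_weight n = real n * v n / rooted_weight n" using n by (simp add: rooted_weight_def)
      then show ?thesis by (simp add: forest_weight_conv[OF n] sum_divide_distrib)
    qed
    ultimately have eq: "v n / tree_weight n - (\<Sum>j. a j n) =
       (\<Sum>j<n. if 2 * j \<le> n then 0 else rooted_weight (n - j) / rooted_weight n * v j)"
      by (auto simp: sum_subtractf[symmetric] a_def intro!: sum.cong)
    have "(\<Sum>j<n. if 2 * j \<le> n then 0 else rooted_weight (n - j) / rooted_weight n * v j) \<le>
      (\<Sum>j<n. 8 * K / real n * rooted_weight (n - j))"
    proof (rule sum_mono)
      fix j assume j: "j \<in> {..<n}"
      show "(if 2 * j \<le> n then 0 else rooted_weight (n - j) / rooted_weight n * v j) \<le> 8 * K / real n * rooted_weight (n - j)"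
      proof (cases "2 * j \<le> n")
        case True
        then show ?thesis using K rooted_weight_nonneg by simp
      next
        case False
        have "v j \<le> K * tree_weight j" using K(2) False by simp
        also have "tree_weight j = rooted_weight j / real j" using False by (simp add: rooted_weight_def)
        also have "rooted_weight j / real j \<le> 4 * rooted_weight n / (real n / 2)"
          using False j n by (intro frac_le rooted_weight_half) (auto simp: rooted_weight_nonneg)
        finally have "v j \<le> K * (4 * rooted_weight n / (real n / 2))" using K(1) by (simp add: mult_left_mono)
        then have "rooted_weight (n - j) / rooted_weight n * v j \<le>
            rooted_weight (n - j) / rooted_weight n * (K * (4 * rooted_weight n / (real n / 2)))"
          using rooted_weight_nonneg by (intro mult_left_mono) auto
        also have "\<dots> = 8 * K / real n * rooted_weight (n - j)"
          using rooted_weight_pos[OF n] by (simp add: field_simps)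
        finally show ?thesis using False by simp
      qed
    qed
    also have "\<dots> = 8 * K / real n * (\<Sum>j\<in>{1..n}. rooted_weight j)"
      unfolding sum_distrib_left
      by (rule sum.reindex_bij_witness[of _ "\<lambda>j. n - j" "\<lambda>j. n - j"]) auto
    also have "\<dots> \<le> 8 * K / real n * 1"
      using rooted_weight_sums rooted_weight_nonneg sum_le_suminf[of rooted_weight "{1..n}"] K
      by (intro mult_left_mono) (auto simp: sums_iff)
    finally have "(\<Sum>j<n. if 2 * j \<le> n then 0 else rooted_weight (n - j) / rooted_weight n * v j) \<le> 8 * K / real n" by simp
    moreover have "(\<Sum>j<n. if 2 * j \<le> n then 0 else rooted_weight (n - j) / rooted_weight n * v j) \<ge> 0"
      using rooted_weight_nonneg forest_weight_nonneg by (intro sum_nonneg) auto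
    ultimately show ?thesis unfolding eq by simp
  qed
  have "(\<lambda>n. v n / tree_weight n - (\<Sum>j. a j n)) \<longlonglongrightarrow> 0"
  proof (rule tendsto_sandwich)
    show "(\<lambda>n. 0::real) \<longlonglongrightarrow> 0" by simp
    show "(\<lambda>n. 8 * K / real n) \<longlonglongrightarrow> 0" by real_asymp
    show "\<forall>\<^sub>F n in sequentially. 0 \<le> v n / tree_weight n - (\<Sum>j. a j n)"
      using eventually_ge_at_top[of 1] by eventually_elim (use diff in auto)
    show "\<forall>\<^sub>F n in sequentially. v n / tree_weight n - (\<Sum>j. a j n) \<le> 8 * K / real n"
      using eventually_ge_at_top[of 1] by eventually_elim (use diff in auto)
  qed
  from tendsto_add[OF this main] show ?thesis by simp
qed

end

section \<open>Types of MSO-equivalent structures\<close>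

text \<open>The first component is a code: 0 for inclusion, which on singletons is equality and
  membership, 1 for adjacency, 2 for being a singleton, 3 for having a common element. Code 3 makes
  the atoms of a disjoint union, and those after the addition of edges, computable from the given
  atoms.\<close>

definition atoms :: "'a set \<Rightarrow> 'a set set \<Rightarrow> 'a set list \<Rightarrow> (nat \<times> nat \<times> nat) set" where
  "atoms W E L = {(c, i, j). i < length L \<and> j < length L \<and>
     (c = 0 \<and> L ! i \<inter> W \<subseteq> L ! j \<or>
      c = 1 \<and> (\<exists>a\<in>L ! i \<inter> W. \<exists>b\<in>L ! j \<inter> W. {a, b} \<in> E) \<or>
      c = 2 \<and> (\<exists>a. L ! i \<inter> W = {a}) \<or>
      c = 3 \<and> L ! i \<inter> L ! j \<inter> W \<noteq> {})}"

text \<open>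
  Vertex quantifiers are treated as quantifiers over singletons. Types are coded as natural numbers, so that
  structures over different types of vertices can be compared.
\<close>

primrec tp :: "nat \<Rightarrow> 'a set \<Rightarrow> 'a set set \<Rightarrow> 'a set list \<Rightarrow> nat" where
  "tp 0 W E L = set_encode (to_nat ` atoms W E L)"
| "tp (Suc k) W E L = set_encode ((\<lambda>A. tp k W E (A # L)) ` Pow W)"

lemma atoms_subset: "atoms W E L \<subseteq> {..3} \<times> {..<length L} \<times> {..<length L}"
  by (auto simp: atoms_def)

lemma finite_atoms: "finite (atoms W E L)"
  by (rule finite_subset[OF atoms_subset]) simp

lemma tp_0_iff: "tp 0 W E L = tp 0 W' E' L' \<longleftrightarrow> atoms W E L = atoms W' E' L'"
  by (simp add: set_encode_eq finite_atoms inj_image_eq_iff)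

lemma tp_SucD:
  assumes "tp (Suc k) W E L = tp (Suc k) W' E' L'" "finite W" "finite W'" "A \<subseteq> W"
  obtains A' where "A' \<subseteq> W'" "tp k W E (A # L) = tp k W' E' (A' # L')"
proof -
  have "(\<lambda>A. tp k W E (A # L)) ` Pow W = (\<lambda>A. tp k W' E' (A # L')) ` Pow W'"
    using assms by (simp add: set_encode_eq)
  then have "tp k W E (A # L) \<in> (\<lambda>A. tp k W' E' (A # L')) ` Pow W'"
    using assms(4) by blast
  then show thesis using that by blast
qed

lemma tp_SucI:
  assumes "\<And>A. A \<subseteq> W \<Longrightarrow> \<exists>A'\<subseteq>W'. tp k W E (A # L) = tp k W' E' (A' # L')"
    and "\<And>A'. A' \<subseteq> W' \<Longrightarrow> \<exists>A\<subseteq>W. tp k W E (A # L) = tp k W' E' (A' # L')"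
  shows "tp (Suc k) W E L = tp (Suc k) W' E' L'"
proof -
  have "(\<lambda>A. tp k W E (A # L)) ` Pow W = (\<lambda>A. tp k W' E' (A # L')) ` Pow W'"
  proof (intro equalityI subsetI)
    fix t assume "t \<in> (\<lambda>A. tp k W E (A # L)) ` Pow W"
    then obtain A where "A \<subseteq> W" "t = tp k W E (A # L)" by blast
    with assms(1)[of A] show "t \<in> (\<lambda>A. tp k W' E' (A # L')) ` Pow W'" by auto
  next
    fix t assume "t \<in> (\<lambda>A. tp k W' E' (A # L')) ` Pow W'"
    then obtain A' where "A' \<subseteq> W'" "t = tp k W' E' (A' # L')" by blast
    with assms(2)[of A'] show "t \<in> (\<lambda>A. tp k W E (A # L)) ` Pow W" by (metis imageI PowI)
  qed
  then show ?thesis by simp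
qed

lemma atoms_tl: "atoms W E L = {(c, i, j). (c, Suc i, Suc j) \<in> atoms W E (A # L)}"
  by (simp add: atoms_def)

text \<open>A higher rank still determines the atoms: the empty set is prepended at every level and
  the atoms of the shorter list are read off by \<open>atoms_tl\<close>.\<close>

lemma tp_atoms:
  assumes "tp k W E L = tp k W' E' L'" "finite W" "finite W'"
  shows "atoms W E L = atoms W' E' L'"
  using assms
proof (induction k arbitrary: L L')
  case 0
  then show ?case by (simp only: tp_0_iff)
next
  case (Suc k)
  obtain A' where "tp k W E ({} # L) = tp k W' E' (A' # L')"
    using tp_SucD[OF Suc.prems, of "{}"] by auto
  then have "atoms W E ({} # L) = atoms W' E' (A' # L')" using Suc by blast
  then show ?case using atoms_tl[of W E L "{}"] atoms_tl[of W' E' L' A'] by simp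
qed

text \<open>Inclusion is reflexive exactly at the valid positions of the list.\<close>

lemma tp_length:
  assumes "tp k W E L = tp k W' E' L'" "finite W" "finite W'"
  shows "length L = length L'"
proof -
  have "(0, i, i) \<in> atoms W E L \<longleftrightarrow> (0, i, i) \<in> atoms W' E' L'" for i
    using tp_atoms[OF assms] by simp
  then have "i < length L \<longleftrightarrow> i < length L'" for i by (simp add: atoms_def)
  then show ?thesis by (metis less_irrefl linorder_neqE_nat)
qed

text \<open>A type of rank k+1 is a code of a set of rank-k types with one more set in the list.
  This finiteness feeds the pigeonhole arguments and makes the universal tree finite.\<close>

lemma finite_types: "finite {tp k W E L | (W :: 'a set) E L. finite W \<and> length L = m}"
proof (induction k arbitrary: m)
  case 0
  have "{tp 0 W E L | (W :: 'a set) E L. finite W \<and> length L = m} \<subseteq>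
      (\<lambda>S. set_encode (to_nat ` S)) ` Pow ({..3::nat} \<times> {..<m} \<times> {..<m})"
  proof
    fix t assume "t \<in> {tp 0 W E L | (W :: 'a set) E L. finite W \<and> length L = m}"
    then obtain W E and L :: "'a set list" where "t = tp 0 W E L" "length L = m" by blast
    then show "t \<in> (\<lambda>S. set_encode (to_nat ` S)) ` Pow ({..3::nat} \<times> {..<m} \<times> {..<m})"
      using atoms_subset[of W E L] by simp
  qed
  then show ?case by (rule finite_subset) simp
next
  case (Suc k)
  have "{tp (Suc k) W E L | (W :: 'a set) E L. finite W \<and> length L = m} \<subseteq>
      set_encode ` Pow {tp k W E L | (W :: 'a set) E L. finite W \<and> length L = Suc m}"
  proof
    fix t assume "t \<in> {tp (Suc k) W E L | (W :: 'a set) E L. finite W \<and> length L = m}"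
    then obtain W E and L :: "'a set list" where t: "t = tp (Suc k) W E L" "length L = m" "finite W" by blast
    then have "(\<lambda>A. tp k W E (A # L)) ` Pow W \<in> Pow {tp k W E L | (W :: 'a set) E L. finite W \<and> length L = Suc m}"
      by auto (metis length_Cons)
    then show "t \<in> set_encode ` Pow {tp k W E L | (W :: 'a set) E L. finite W \<and> length L = Suc m}"
      using t by simp
  qed
  then show ?case by (rule finite_subset) (use Suc.IH[of "Suc m"] in simp)
qed

text \<open>Only the traces on \<open>W\<close> matter. So the type of a part may be evaluated with
  the edges and the sets of the whole graph.\<close>

lemma tp_cong:
  assumes "length L = length L'" "\<And>i. i < length L \<Longrightarrow> L ! i \<inter> W = L' ! i \<inter> W"
    and "\<And>a b. a \<in> W \<Longrightarrow> b \<in> W \<Longrightarrow> {a, b} \<in> E \<longleftrightarrow> {a, b} \<in> E'"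
  shows "tp k W E L = tp k W E' L'"
  using assms(1,2)
proof (induction k arbitrary: L L')
  case 0
  have "(L ! i \<inter> W \<subseteq> L ! j) = (L' ! i \<inter> W \<subseteq> L' ! j)" if "i < length L" "j < length L" for i j
  proof -
    have "(L ! i \<inter> W \<subseteq> L ! j) \<longleftrightarrow> (L ! i \<inter> W \<subseteq> L ! j \<inter> W)" by blast
    also have "\<dots> \<longleftrightarrow> (L' ! i \<inter> W \<subseteq> L' ! j)" using 0(2)[OF that(1)] 0(2)[OF that(2)] by auto
    finally show ?thesis .
  qed
  moreover have "L ! i \<inter> L ! j \<inter> W = L' ! i \<inter> L' ! j \<inter> W" if "i < length L" "j < length L" for i j
    using 0(2)[OF that(1)] 0(2)[OF that(2)] by blast
  moreover have "(\<exists>a\<in>L ! i \<inter> W. \<exists>b\<in>L ! j \<inter> W. {a, b} \<in> E) \<longleftrightarrow> (\<exists>a\<in>L' ! i \<inter> W. \<exists>b\<in>L' ! j \<inter> W. {a, b} \<in> E')"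
    if "i < length L" "j < length L" for i j
    using 0(2)[OF that(1)] 0(2)[OF that(2)] assms(3) by auto
  ultimately have "(c, i, j) \<in> atoms W E L \<longleftrightarrow> (c, i, j) \<in> atoms W E' L'" for c i j
  proof (cases "i < length L \<and> j < length L")
    case False
    then show ?thesis unfolding atoms_def using 0(1) by auto
  qed (use 0 in \<open>simp add: atoms_def\<close>)
  then have "atoms W E L = atoms W E' L'" by (intro set_eqI) (clarify, simp)
  then show ?case by simp
next
  case (Suc k)
  have "tp k W E (A # L) = tp k W E' (A # L')" for A
  proof (rule Suc.IH)
    fix i assume "i < length (A # L)"
    then show "(A # L) ! i \<inter> W = (A # L') ! i \<inter> W" using Suc.prems by (cases i) auto
  qed (use Suc.prems in simp)
  then show ?case by simp
qed

lemma tp_image: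
  assumes "inj_on g W" "\<And>A. A \<in> set L \<Longrightarrow> A \<subseteq> W"
    and "\<And>a b. a \<in> W \<Longrightarrow> b \<in> W \<Longrightarrow> {g a, g b} \<in> E' \<longleftrightarrow> {a, b} \<in> E"
  shows "tp k (g ` W) E' (map ((`) g) L) = tp k W E L"
  using assms(2)
proof (induction k arbitrary: L)
  case 0
  have L: "L ! i \<subseteq> W" if "i < length L" for i using 0 that by auto
  have i: "g ` X \<inter> g ` W = g ` X" if "X \<subseteq> W" for X using that by auto
  have s: "g ` X \<subseteq> g ` Y \<longleftrightarrow> X \<subseteq> Y" if "X \<subseteq> W" "Y \<subseteq> W" for X Y
    using inj_on_image_subset_iff[OF assms(1)] that by blast
  have t: "g ` X \<inter> g ` Y = g ` (X \<inter> Y)" if "X \<subseteq> W" "Y \<subseteq> W" for X Y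
    using inj_on_image_Int[OF assms(1)] that by simp
  have u: "(\<exists>a. g ` X = {a}) \<longleftrightarrow> (\<exists>a. X = {a})" if "X \<subseteq> W" for X
    using inj_on_subset[OF assms(1) that] card_image card_1_singleton_iff by (metis One_nat_def)
  have e: "(\<exists>a\<in>X. \<exists>b\<in>Y. {g a, g b} \<in> E') \<longleftrightarrow> (\<exists>a\<in>X. \<exists>b\<in>Y. {a, b} \<in> E)" if "X \<subseteq> W" "Y \<subseteq> W" for X Y
    using assms(3) that by blast
  have "atoms (g ` W) E' (map ((`) g) L) = atoms W E L"
  proof (rule set_eqI, clarify)
    fix c i j
    show "(c, i, j) \<in> atoms (g ` W) E' (map ((`) g) L) \<longleftrightarrow> (c, i, j) \<in> atoms W E L"
    proof (cases "i < length L \<and> j < length L")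
      case True
      then have w: "L ! i \<subseteq> W" "L ! j \<subseteq> W" using L by auto
      have w': "L ! i \<inter> W = L ! i" "L ! j \<inter> W = L ! j" "L ! i \<inter> L ! j \<inter> W = L ! i \<inter> L ! j" using w by auto
      have w'': "g ` (L ! i \<inter> L ! j) \<inter> g ` W = g ` (L ! i \<inter> L ! j)" using w by auto
      show ?thesis using True w w' w''
        by (simp add: atoms_def i s t u e)
    qed (auto simp: atoms_def)
  qed
  then show ?case by simp
next
  case (Suc k)
  have "tp (Suc k) (g ` W) E' (map ((`) g) L) =
      set_encode ((\<lambda>A. tp k (g ` W) E' (g ` A # map ((`) g) L)) ` Pow W)"
    by (simp add: image_Pow_surj[OF refl, of g W, symmetric] image_image)
  also have "(\<lambda>A. tp k (g ` W) E' (g ` A # map ((`) g) L)) ` Pow W = (\<lambda>A. tp k W E (A # L)) ` Pow W"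
  proof (rule image_cong[OF refl])
    fix A assume "A \<in> Pow W"
    then have "tp k (g ` W) E' (map ((`) g) (A # L)) = tp k W E (A # L)"
      using Suc.prems by (intro Suc.IH) auto
    then show "tp k (g ` W) E' (g ` A # map ((`) g) L) = tp k W E (A # L)" by simp
  qed
  finally show ?case by simp
qed

section \<open>Types of disjoint unions, of joined graphs and of shortened lists\<close>

lemma atoms_Un:
  assumes "W1 \<inter> W2 = {}" "\<And>a b. a \<in> W1 \<Longrightarrow> b \<in> W2 \<Longrightarrow> {a, b} \<notin> E"
  shows "(c, i, j) \<in> atoms (W1 \<union> W2) E L \<longleftrightarrow>
    c = 0 \<and> (c, i, j) \<in> atoms W1 E L \<and> (c, i, j) \<in> atoms W2 E L \<or>
    (c = 1 \<or> c = 3) \<and> ((c, i, j) \<in> atoms W1 E L \<or> (c, i, j) \<in> atoms W2 E L) \<or>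
    c = 2 \<and> ((c, i, j) \<in> atoms W1 E L \<and> (3, i, i) \<notin> atoms W2 E L \<or>
             (c, i, j) \<in> atoms W2 E L \<and> (3, i, i) \<notin> atoms W1 E L)"
proof -
  have 1: "(\<exists>a\<in>X \<inter> (W1 \<union> W2). \<exists>b\<in>Y \<inter> (W1 \<union> W2). {a, b} \<in> E) \<longleftrightarrow>
    (\<exists>a\<in>X \<inter> W1. \<exists>b\<in>Y \<inter> W1. {a, b} \<in> E) \<or> (\<exists>a\<in>X \<inter> W2. \<exists>b\<in>Y \<inter> W2. {a, b} \<in> E)" for X Y
  proof -
    have "{a, b} \<notin> E" if "a \<in> W2" "b \<in> W1" for a b
      using assms(2)[OF that(2,1)] by (simp add: insert_commute)
    with assms(2) show ?thesis by blast
  qed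
  have 2: "(\<exists>a. X \<inter> (W1 \<union> W2) = {a}) \<longleftrightarrow>
    (\<exists>a. X \<inter> W1 = {a}) \<and> X \<inter> W2 = {} \<or> (\<exists>a. X \<inter> W2 = {a}) \<and> X \<inter> W1 = {}" for X
  proof
    assume "\<exists>a. X \<inter> (W1 \<union> W2) = {a}"
    then obtain a where a: "X \<inter> (W1 \<union> W2) = {a}" by blast
    show "(\<exists>a. X \<inter> W1 = {a}) \<and> X \<inter> W2 = {} \<or> (\<exists>a. X \<inter> W2 = {a}) \<and> X \<inter> W1 = {}"
    proof (cases "a \<in> W1")
      case True
      then have "X \<inter> W1 = {a}" "X \<inter> W2 = {}" using a assms(1) by auto
      then show ?thesis by blast
    next
      case False
      then have "X \<inter> W2 = {a}" "X \<inter> W1 = {}" using a assms(1) by auto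
      then show ?thesis by blast
    qed
  next
    assume "(\<exists>a. X \<inter> W1 = {a}) \<and> X \<inter> W2 = {} \<or> (\<exists>a. X \<inter> W2 = {a}) \<and> X \<inter> W1 = {}"
    then show "\<exists>a. X \<inter> (W1 \<union> W2) = {a}" by (auto simp: Int_Un_distrib)
  qed
  consider "c = 0" | "c = 1" | "c = 2" | "c = 3" | "c > 3" by linarith
  then show ?thesis
  proof cases
    case 3
    then show ?thesis unfolding atoms_def by (simp add: 2) blast
  qed (auto simp: atoms_def 1)
qed

text \<open>Composition: a subset of a disjoint union is a pair of traces, which are answered
  separately in the two parts; \<open>tp_cong\<close> then replaces either answer by the union of
  both.\<close>

lemma tp_Un:
  assumes "finite W1" "finite W2" "finite W1'" "finite W2'"
    and "W1 \<inter> W2 = {}" "\<And>a b. a \<in> W1 \<Longrightarrow> b \<in> W2 \<Longrightarrow> {a, b} \<notin> E"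
    and "W1' \<inter> W2' = {}" "\<And>a b. a \<in> W1' \<Longrightarrow> b \<in> W2' \<Longrightarrow> {a, b} \<notin> E'"
    and "tp k W1 E L = tp k W1' E' L'" "tp k W2 E L = tp k W2' E' L'"
  shows "tp k (W1 \<union> W2) E L = tp k (W1' \<union> W2') E' L'"
  using assms(9,10)
proof (induction k arbitrary: L L')
  case 0
  then have "atoms W1 E L = atoms W1' E' L'" "atoms W2 E L = atoms W2' E' L'"
    by (simp_all only: tp_0_iff)
  then have "atoms (W1 \<union> W2) E L = atoms (W1' \<union> W2') E' L'"
    using atoms_Un[OF assms(5,6), where L = L] atoms_Un[OF assms(7,8), where L = L']
    by (intro set_eqI) (clarify, simp)
  then show ?case by simp
next
  case (Suc k)
  note fin = assms(1-4)
  show ?case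
  proof (rule tp_SucI)
    fix A assume A: "A \<subseteq> W1 \<union> W2"
    obtain A1 where A1: "A1 \<subseteq> W1'" "tp k W1 E ((A \<inter> W1) # L) = tp k W1' E' (A1 # L')"
      using tp_SucD[OF Suc.prems(1) fin(1,3), of "A \<inter> W1"] by auto
    obtain A2 where A2: "A2 \<subseteq> W2'" "tp k W2 E ((A \<inter> W2) # L) = tp k W2' E' (A2 # L')"
      using tp_SucD[OF Suc.prems(2) fin(2,4), of "A \<inter> W2"] by auto
    have "tp k W1 E ((A \<inter> W1) # L) = tp k W1 E (A # L)" "tp k W2 E ((A \<inter> W2) # L) = tp k W2 E (A # L)"
      "tp k W1' E' (A1 # L') = tp k W1' E' ((A1 \<union> A2) # L')" "tp k W2' E' (A2 # L') = tp k W2' E' ((A1 \<union> A2) # L')"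
      using A1(1) A2(1) assms(7)
      by (intro tp_cong; fastforce simp: nth_Cons split: nat.split)+
    then have "tp k (W1 \<union> W2) E (A # L) = tp k (W1' \<union> W2') E' ((A1 \<union> A2) # L')"
      using A1 A2 by (intro Suc.IH) auto
    then show "\<exists>A'\<subseteq>W1' \<union> W2'. tp k (W1 \<union> W2) E (A # L) = tp k (W1' \<union> W2') E' (A' # L')"
      using A1(1) A2(1) by (intro exI[of _ "A1 \<union> A2"]) auto
  next
    fix A assume A: "A \<subseteq> W1' \<union> W2'"
    obtain A1 where A1: "A1 \<subseteq> W1" "tp k W1' E' ((A \<inter> W1') # L') = tp k W1 E (A1 # L)"
      using tp_SucD[OF Suc.prems(1)[symmetric] fin(3,1), of "A \<inter> W1'"] by auto
    obtain A2 where A2: "A2 \<subseteq> W2" "tp k W2' E' ((A \<inter> W2') # L') = tp k W2 E (A2 # L)"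
      using tp_SucD[OF Suc.prems(2)[symmetric] fin(4,2), of "A \<inter> W2'"] by auto
    have "tp k W1' E' ((A \<inter> W1') # L') = tp k W1' E' (A # L')" "tp k W2' E' ((A \<inter> W2') # L') = tp k W2' E' (A # L')"
      "tp k W1 E (A1 # L) = tp k W1 E ((A1 \<union> A2) # L)" "tp k W2 E (A2 # L) = tp k W2 E ((A1 \<union> A2) # L)"
      using A1(1) A2(1) assms(5)
      by (intro tp_cong; fastforce simp: nth_Cons split: nat.split)+
    then have "tp k (W1 \<union> W2) E ((A1 \<union> A2) # L) = tp k (W1' \<union> W2') E' (A # L')"
      using A1 A2 by (intro Suc.IH) auto
    then show "\<exists>A'\<subseteq>W1 \<union> W2. tp k (W1 \<union> W2) E (A' # L) = tp k (W1' \<union> W2') E' (A # L')"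
      using A1(1) A2(1) by (intro exI[of _ "A1 \<union> A2"]) auto
  qed
qed

text \<open>Disjoint unions cover only parts without edges between them. Joining all roots to a
  centre puts the missing edges of a star back in.\<close>

definition join_edges :: "'a set set \<Rightarrow> 'a set \<Rightarrow> 'a set \<Rightarrow> 'a set set" where
  "join_edges E P Q = E \<union> {{x, y} | x y. x \<in> P \<and> y \<in> Q}"

lemma join_edges_iff: "{a, b} \<in> join_edges E P Q \<longleftrightarrow> {a, b} \<in> E \<or> a \<in> P \<and> b \<in> Q \<or> a \<in> Q \<and> b \<in> P"
  by (auto simp: join_edges_def doubleton_eq_iff)

lemma atoms_join_edges:
  assumes "p < length L" "q < length L"
  shows "(c, i, j) \<in> atoms W (join_edges E (L ! p) (L ! q)) L \<longleftrightarrow>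
     (c, i, j) \<in> atoms W E L \<or> c = 1 \<and>
     ((3, i, p) \<in> atoms W E L \<and> (3, j, q) \<in> atoms W E L \<or> (3, i, q) \<in> atoms W E L \<and> (3, j, p) \<in> atoms W E L)"
proof (cases "i < length L \<and> j < length L")
  case True
  have "(\<exists>a\<in>L ! i \<inter> W. \<exists>b\<in>L ! j \<inter> W. {a, b} \<in> join_edges E (L ! p) (L ! q)) \<longleftrightarrow>
    (\<exists>a\<in>L ! i \<inter> W. \<exists>b\<in>L ! j \<inter> W. {a, b} \<in> E) \<or>
    L ! i \<inter> L ! p \<inter> W \<noteq> {} \<and> L ! j \<inter> L ! q \<inter> W \<noteq> {} \<or> L ! i \<inter> L ! q \<inter> W \<noteq> {} \<and> L ! j \<inter> L ! p \<inter> W \<noteq> {}"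
    unfolding join_edges_iff by blast
  moreover have "(1, i, j) \<in> atoms W F L \<longleftrightarrow> (\<exists>a\<in>L ! i \<inter> W. \<exists>b\<in>L ! j \<inter> W. {a, b} \<in> F)" for F
    using True by (simp add: atoms_def)
  moreover have "(3, i', j') \<in> atoms W E L \<longleftrightarrow> L ! i' \<inter> L ! j' \<inter> W \<noteq> {}"
    if "i' < length L" "j' < length L" for i' j'
    using that by (simp add: atoms_def)
  ultimately show ?thesis
  proof (cases "c = 1")
    case False
    then show ?thesis by (simp add: atoms_def)
  qed (use True assms in simp)
qed (auto simp: atoms_def)

text \<open>The new edges are definable without quantifiers from the sets at positions
  \<open>p\<close> and \<open>q\<close>, so equality of types survives their addition as long as
  both sets stay in the list. Each quantifier shifts the positions by one.\<close>

lemma tp_join_edges: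
  assumes "tp k W E L = tp k W' E' L'" "finite W" "finite W'" "p < length L" "q < length L"
  shows "tp k W (join_edges E (L ! p) (L ! q)) L = tp k W' (join_edges E' (L' ! p) (L' ! q)) L'"
  using assms(1,4,5)
proof (induction k arbitrary: L L' p q)
  case 0
  have l: "length L = length L'" using tp_length[OF 0(1) assms(2,3)] .
  have "atoms W E L = atoms W' E' L'" using 0 by (simp only: tp_0_iff)
  then have "atoms W (join_edges E (L ! p) (L ! q)) L = atoms W' (join_edges E' (L' ! p) (L' ! q)) L'"
    using atoms_join_edges[of p L q] atoms_join_edges[of p L' q] 0 l
    by (intro set_eqI) (clarify, simp)
  then show ?case by simp
next
  case (Suc k)
  show ?case
  proof (rule tp_SucI)
    fix A assume "A \<subseteq> W"
    then obtain A' where A': "A' \<subseteq> W'" "tp k W E (A # L) = tp k W' E' (A' # L')"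
      using tp_SucD[OF Suc.prems(1) assms(2,3)] by blast
    then show "\<exists>A'\<subseteq>W'. tp k W (join_edges E (L ! p) (L ! q)) (A # L) = tp k W' (join_edges E' (L' ! p) (L' ! q)) (A' # L')"
      using Suc.IH[OF A'(2), of "Suc p" "Suc q"] Suc.prems by auto
  next
    fix A' assume "A' \<subseteq> W'"
    then obtain A where A: "A \<subseteq> W" "tp k W' E' (A' # L') = tp k W E (A # L)"
      using tp_SucD[OF Suc.prems(1)[symmetric] assms(3,2)] by blast
    then show "\<exists>A\<subseteq>W. tp k W (join_edges E (L ! p) (L ! q)) (A # L) = tp k W' (join_edges E' (L' ! p) (L' ! q)) (A' # L')"
      using Suc.IH[OF A(2)[symmetric], of "Suc p" "Suc q"] Suc.prems by auto
  qed
qed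

text \<open>Marker sets that were carried along only to define edges can be forgotten
  afterwards.\<close>

lemma tp_append:
  assumes "tp k W E (L @ M) = tp k W' E' (L' @ M')" "length L = length L'" "finite W" "finite W'"
  shows "tp k W E L = tp k W' E' L'"
  using assms(1,2)
proof (induction k arbitrary: L L')
  case 0
  have "atoms W E (L @ M) = atoms W' E' (L' @ M')" using 0(1) by (simp only: tp_0_iff)
  then have "atoms W E (L @ M) \<inter> {(c, i, j). i < length L \<and> j < length L} =
     atoms W' E' (L' @ M') \<inter> {(c, i, j). i < length L' \<and> j < length L'}" using 0(2) by simp
  moreover have "atoms W E (L @ M) \<inter> {(c, i, j). i < length L \<and> j < length L} = atoms W E L"
    by (intro set_eqI) (clarsimp simp: atoms_def nth_append conj_commute cong: conj_cong)
  moreover have "atoms W' E' (L' @ M') \<inter> {(c, i, j). i < length L' \<and> j < length L'} = atoms W' E' L'"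
    by (intro set_eqI) (clarsimp simp: atoms_def nth_append conj_commute cong: conj_cong)
  ultimately have "atoms W E L = atoms W' E' L'" by simp
  then show ?case by simp
next
  case (Suc k)
  show ?case
  proof (rule tp_SucI)
    fix A assume "A \<subseteq> W"
    then obtain A' where A': "A' \<subseteq> W'" "tp k W E (A # (L @ M)) = tp k W' E' (A' # (L' @ M'))"
      using tp_SucD[OF Suc.prems(1) assms(3,4)] by blast
    then show "\<exists>A'\<subseteq>W'. tp k W E (A # L) = tp k W' E' (A' # L')"
      using Suc.IH[of "A # L" "A' # L'"] Suc.prems(2) by auto
  next
    fix A' assume "A' \<subseteq> W'"
    then obtain A where A: "A \<subseteq> W" "tp k W' E' (A' # (L' @ M')) = tp k W E (A # (L @ M))"
      using tp_SucD[OF Suc.prems(1)[symmetric] assms(4,3)] by blast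
    then show "\<exists>A\<subseteq>W. tp k W E (A # L) = tp k W' E' (A' # L')"
      using Suc.IH[of "A # L" "A' # L'"] Suc.prems(2) by auto
  qed
qed

section \<open>Types determine the truth of formulas\<close>

primrec quantifier_rank :: "mso \<Rightarrow> nat" where
  "quantifier_rank (Eq x y) = 0"
| "quantifier_rank (Adj x y) = 0"
| "quantifier_rank (Mem x X) = 0"
| "quantifier_rank (Neg \<phi>) = quantifier_rank \<phi>"
| "quantifier_rank (Conj \<phi> \<psi>) = max (quantifier_rank \<phi>) (quantifier_rank \<psi>)"
| "quantifier_rank (ExVertex x \<phi>) = Suc (quantifier_rank \<phi>)"
| "quantifier_rank (ExSet X \<phi>) = Suc (quantifier_rank \<phi>)"

text \<open>The Ehrenfeucht-Fraisse argument. The functions \<open>e\<close> and \<open>f\<close>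
  locate the values of the variables in the lists, those of vertex variables as singletons.\<close>

lemma sat_tp:
  assumes "finite W" "finite W'" "tp k W E L = tp k W' E' L'" "quantifier_rank \<phi> \<le> k"
    and "\<forall>x\<in>free_vertex_vars \<phi>. e x < length L \<and> v x \<in> W \<and> v' x \<in> W' \<and> L ! e x = {v x} \<and> L' ! e x = {v' x}"
    and "\<forall>X\<in>free_set_vars \<phi>. f X < length L \<and> S X \<subseteq> W \<and> S' X \<subseteq> W' \<and> L ! f X = S X \<and> L' ! f X = S' X"
  shows "sat (W, E) v S \<phi> \<longleftrightarrow> sat (W', E') v' S' \<phi>"
  using assms(3-)
proof (induction \<phi> arbitrary: k L L' v v' S S' e f)
  case (Eq x y)
  note a = tp_atoms[OF Eq.prems(1) assms(1,2)] tp_length[OF Eq.prems(1) assms(1,2)]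
  have "(0, e x, e y) \<in> atoms W E L \<longleftrightarrow> v x = v y" using Eq.prems by (auto simp: atoms_def)
  moreover have "(0, e x, e y) \<in> atoms W' E' L' \<longleftrightarrow> v' x = v' y" using Eq.prems a by (auto simp: atoms_def)
  ultimately show ?case using a by simp
next
  case (Adj x y)
  note a = tp_atoms[OF Adj.prems(1) assms(1,2)] tp_length[OF Adj.prems(1) assms(1,2)]
  have "(1, e x, e y) \<in> atoms W E L \<longleftrightarrow> {v x, v y} \<in> E" using Adj.prems by (auto simp: atoms_def)
  moreover have "(1, e x, e y) \<in> atoms W' E' L' \<longleftrightarrow> {v' x, v' y} \<in> E'" using Adj.prems a by (auto simp: atoms_def)
  ultimately show ?case using a by simp
next
  case (Mem x X)
  note a = tp_atoms[OF Mem.prems(1) assms(1,2)] tp_length[OF Mem.prems(1) assms(1,2)]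
  have "(0, e x, f X) \<in> atoms W E L \<longleftrightarrow> v x \<in> S X" using Mem.prems by (auto simp: atoms_def)
  moreover have "(0, e x, f X) \<in> atoms W' E' L' \<longleftrightarrow> v' x \<in> S' X" using Mem.prems a by (auto simp: atoms_def)
  ultimately show ?case using a by simp
next
  case (Neg \<phi>)
  have "sat (W, E) v S \<phi> \<longleftrightarrow> sat (W', E') v' S' \<phi>"
    using Neg.prems by (intro Neg.IH[of k L L' e v v' f S S']) auto
  then show ?case by simp
next
  case (Conj \<phi> \<psi>)
  have "sat (W, E) v S \<phi> \<longleftrightarrow> sat (W', E') v' S' \<phi>"
    using Conj.prems by (intro Conj.IH(1)[of k L L' e v v' f S S']) auto
  moreover have "sat (W, E) v S \<psi> \<longleftrightarrow> sat (W', E') v' S' \<psi>"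
    using Conj.prems by (intro Conj.IH(2)[of k L L' e v v' f S S']) auto
  ultimately show ?case by simp
next
  case (ExVertex x \<phi>)
  obtain k' where k: "k = Suc k'" using ExVertex.prems by (cases k) auto
  note t = ExVertex.prems(1)[unfolded k]
  have *: "sat (W, E) (v(x := a)) S \<phi> \<longleftrightarrow> sat (W', E') (v'(x := a')) S' \<phi>"
    if "a \<in> W" "a' \<in> W'" "tp k' W E ({a} # L) = tp k' W' E' ({a'} # L')" for a a'
    using ExVertex.prems that k
    by (intro ExVertex.IH[of k' "{a} # L" "{a'} # L'" "\<lambda>y. if y = x then 0 else Suc (e y)" _ _ "\<lambda>X. Suc (f X)"]) auto
  \<comment> \<open>Code 2 forces the answer to a singleton to be a singleton again.\<close>
  have **: "\<exists>a'. A' = {a'} \<and> a' \<in> W'"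
    if "tp k' W E ({a} # L) = tp k' W' E' (A' # L')" "a \<in> W" "A' \<subseteq> W'" for a A'
  proof -
    have "(2, 0, 0) \<in> atoms W E ({a} # L)" using that by (auto simp: atoms_def)
    then have "(2, 0, 0) \<in> atoms W' E' (A' # L')" using tp_atoms[OF that(1) assms(1,2)] by simp
    then have "\<exists>a'. A' \<inter> W' = {a'}" by (simp add: atoms_def)
    then show ?thesis using that(3) by auto
  qed
  have ***: "\<exists>a. A = {a} \<and> a \<in> W"
    if "tp k' W E (A # L) = tp k' W' E' ({a'} # L')" "a' \<in> W'" "A \<subseteq> W" for a' A
  proof -
    have "(2, 0, 0) \<in> atoms W' E' ({a'} # L')" using that by (auto simp: atoms_def)
    then have "(2, 0, 0) \<in> atoms W E (A # L)" using tp_atoms[OF that(1) assms(1,2)] by simp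
    then have "\<exists>a. A \<inter> W = {a}" by (simp add: atoms_def)
    then show ?thesis using that(3) by auto
  qed
  show ?case
  proof
    assume "sat (W, E) v S (ExVertex x \<phi>)"
    then obtain a where a: "a \<in> W" "sat (W, E) (v(x := a)) S \<phi>" by auto
    obtain A' where A': "A' \<subseteq> W'" "tp k' W E ({a} # L) = tp k' W' E' (A' # L')"
      using tp_SucD[OF t assms(1,2), of "{a}"] a(1) by auto
    then obtain a' where "A' = {a'}" "a' \<in> W'" using **[OF A'(2) a(1)] by blast
    then show "sat (W', E') v' S' (ExVertex x \<phi>)" using *[of a a'] a A' by auto
  next
    assume "sat (W', E') v' S' (ExVertex x \<phi>)"
    then obtain a' where a': "a' \<in> W'" "sat (W', E') (v'(x := a')) S' \<phi>" by auto
    obtain A where A: "A \<subseteq> W" "tp k' W' E' ({a'} # L') = tp k' W E (A # L)"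
      using tp_SucD[OF t[symmetric] assms(2,1), of "{a'}"] a'(1) by auto
    then obtain a where "A = {a}" "a \<in> W" using ***[OF A(2)[symmetric] a'(1)] by blast
    then show "sat (W, E) v S (ExVertex x \<phi>)" using *[of a a'] a' A by auto
  qed
next
  case (ExSet X \<phi>)
  obtain k' where k: "k = Suc k'" using ExSet.prems by (cases k) auto
  note t = ExSet.prems(1)[unfolded k]
  have *: "sat (W, E) v (S(X := A)) \<phi> \<longleftrightarrow> sat (W', E') v' (S'(X := A')) \<phi>"
    if "A \<subseteq> W" "A' \<subseteq> W'" "tp k' W E (A # L) = tp k' W' E' (A' # L')" for A A'
    using ExSet.prems that k
    by (intro ExSet.IH[of k' "A # L" "A' # L'" "\<lambda>y. Suc (e y)" _ _ "\<lambda>Y. if Y = X then 0 else Suc (f Y)"]) auto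
  show ?case
  proof
    assume "sat (W, E) v S (ExSet X \<phi>)"
    then obtain A where A: "A \<subseteq> W" "sat (W, E) v (S(X := A)) \<phi>" by auto
    obtain A' where A': "A' \<subseteq> W'" "tp k' W E (A # L) = tp k' W' E' (A' # L')"
      using tp_SucD[OF t assms(1,2) A(1)] by blast
    then show "sat (W', E') v' S' (ExSet X \<phi>)" using *[of A A'] A by auto
  next
    assume "sat (W', E') v' S' (ExSet X \<phi>)"
    then obtain A' where A': "A' \<subseteq> W'" "sat (W', E') v' (S'(X := A')) \<phi>" by auto
    obtain A where A: "A \<subseteq> W" "tp k' W' E' (A' # L') = tp k' W E (A # L)"
      using tp_SucD[OF t[symmetric] assms(2,1) A'(1)] by blast
    then show "sat (W, E) v S (ExSet X \<phi>)" using *[of A A'] A' by auto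
  qed
qed

lemma models_tp:
  assumes "finite W" "finite W'" "tp k W E [] = tp k W' E' []" "quantifier_rank \<phi> \<le> k" "mso_sentence \<phi>"
  shows "(W, E) \<Turnstile> \<phi> \<longleftrightarrow> (W', E') \<Turnstile> \<phi>"
proof -
  have "sat (W, E) undefined undefined \<phi> \<longleftrightarrow> sat (W', E') undefined undefined \<phi>"
    by (rule sat_tp[OF assms(1-4)]) (use assms(5) in \<open>auto simp: mso_sentence_def\<close>)
  then show ?thesis using models_iff_sat[OF assms(5)] by metis
qed

section \<open>Absorption of repeated components\<close>

definition separated :: "'a set set \<Rightarrow> 'a set set \<Rightarrow> bool" where
  "separated E \<V> \<longleftrightarrow> finite \<V> \<and> (\<forall>V\<in>\<V>. finite V) \<and>
     (\<forall>V\<in>\<V>. \<forall>V'\<in>\<V>. V \<noteq> V' \<longrightarrow> V \<inter> V' = {} \<and> (\<forall>a\<in>V. \<forall>b\<in>V'. {a, b} \<notin> E))"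

lemma separated_finite:
  assumes "separated E \<V>"
  shows "finite \<V>" "V \<in> \<V> \<Longrightarrow> finite V" "finite (\<Union>(\<V> - \<W>))"
  using assms by (auto simp: separated_def)

lemma separated_disjoint:
  assumes "separated E \<V>" "V \<in> \<V>"
  shows "V \<inter> \<Union>(\<V> - {V} - \<W>) = {}" "a \<in> V \<Longrightarrow> b \<in> \<Union>(\<V> - {V} - \<W>) \<Longrightarrow> {a, b} \<notin> E"
  using assms unfolding separated_def by blast+

lemma tp_Cons_cong:
  assumes "A \<inter> W = A' \<inter> W"
  shows "tp k W E (A # L) = tp k W E (A' # L)"
  using assms by (intro tp_cong) (auto simp: nth_Cons split: nat.split)

lemma large_fiber:
  assumes "finite S" "finite T" "f ` S \<subseteq> T" "n * card T < card S"
  obtains t where "n < card {x \<in> S. f x = t}"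
proof -
  have "\<exists>t\<in>T. n < card {x \<in> S. f x = t}"
  proof (rule ccontr)
    assume "\<not> (\<exists>t\<in>T. n < card {x \<in> S. f x = t})"
    then have le: "card {x \<in> S. f x = t} \<le> n" if "t \<in> T" for t using that by force
    have "card S = (\<Sum>t\<in>T. card {x \<in> S. f x = t})"
      using sum.group[OF assms(1-3), of "\<lambda>_. 1::nat"] by simp
    also have "\<dots> \<le> (\<Sum>t\<in>T. n)" using le by (intro sum_mono)
    finally show False using assms(4) by (simp add: mult.commute)
  qed
  then show thesis using that by blast
qed

lemma atoms_mono:
  assumes "W \<subseteq> W'"
  shows "(1, i, j) \<in> atoms W E L \<Longrightarrow> (1, i, j) \<in> atoms W' E L"
    "(3, i, j) \<in> atoms W E L \<Longrightarrow> (3, i, j) \<in> atoms W' E L"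
proof -
  assume "(1, i, j) \<in> atoms W E L"
  then have "i < length L" "j < length L" "\<exists>a\<in>L ! i \<inter> W. \<exists>b\<in>L ! j \<inter> W. {a, b} \<in> E"
    by (simp_all add: atoms_def)
  moreover from this have "\<exists>a\<in>L ! i \<inter> W'. \<exists>b\<in>L ! j \<inter> W'. {a, b} \<in> E" using assms by blast
  ultimately show "(1, i, j) \<in> atoms W' E L" by (simp add: atoms_def)
next
  assume "(3, i, j) \<in> atoms W E L"
  then show "(3, i, j) \<in> atoms W' E L" using assms by (auto simp: atoms_def)
qed

text \<open>Rank \<open>k\<close> cannot count beyond some \<open>N\<close>: of more than
  \<open>N\<close> parts of equal type one may be deleted. For the next rank, a chosen set refines
  the types of the parts, but by the pigeonhole principle more than \<open>N\<close> of them keep a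
  common refined type, and the induction hypothesis deletes one of these.\<close>

lemma absorb:
  "\<exists>N. \<forall>\<V> E (L :: 'a set list). length L = m \<longrightarrow> separated E \<V> \<longrightarrow>
     (\<forall>V0\<in>\<V>. N < card {V \<in> \<V>. tp k V E L = tp k V0 E L} \<longrightarrow>
        tp k (\<Union>\<V>) E L = tp k (\<Union>(\<V> - {V0})) E L)"
proof (induction k arbitrary: m)
  case 0
  show ?case
  \<comment> \<open>Two copies of \<open>V0\<close> must remain. With one alone, a set could be a
    singleton after the deletion without being one before; two disjoint copies rule this
    out.\<close>
  proof (intro exI[of _ 2] allI impI ballI)
    fix \<V> V0 and E :: "'a set set" and L :: "'a set list"
    assume sep: "separated E \<V>" and V0: "V0 \<in> \<V>" and
      c: "2 < card {V \<in> \<V>. tp 0 V E L = tp 0 V0 E L}"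
    define S where "S = {V \<in> \<V>. tp 0 V E L = tp 0 V0 E L}"
    have "finite S" using separated_finite(1)[OF sep] by (simp add: S_def)
    moreover have "V0 \<in> S" using V0 by (simp add: S_def)
    moreover have "2 < card S" using c unfolding S_def .
    ultimately have "2 \<le> card (S - {V0})" by simp
    then obtain P where P: "P \<subseteq> S - {V0}" "card P = 2" by (metis obtain_subset_with_card_n)
    then obtain V1 V2 where V12: "P = {V1, V2}" "V1 \<noteq> V2" by (auto simp: card_2_iff)
    define U where "U = \<Union>(\<V> - {V0})"
    have sub: "V1 \<subseteq> U" "V2 \<subseteq> U" using P V12 by (auto simp: U_def S_def)
    have dis: "V1 \<inter> V2 = {}" using sep P V12 unfolding separated_def S_def by blast
    have at: "atoms V1 E L = atoms V0 E L" "atoms V2 E L = atoms V0 E L"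
      using P V12 unfolding S_def tp_0_iff by blast+
    have UV: "\<Union>\<V> = V0 \<union> U" using V0 by (auto simp: U_def)
    have dU: "V0 \<inter> U = {}" and nc: "\<And>a b. a \<in> V0 \<Longrightarrow> b \<in> U \<Longrightarrow> {a, b} \<notin> E"
      using separated_disjoint[OF sep V0, where \<W> = "{}"] by (auto simp: U_def)
    have 0: "(0, i, j) \<in> atoms V0 E L" if "(0, i, j) \<in> atoms U E L" for i j
    proof -
      have "(0, i, j) \<in> atoms V1 E L" using that sub(1) by (auto simp: atoms_def)
      then show ?thesis by (simp only: at)
    qed
    have 13: "(c, i, j) \<in> atoms U E L" if "(c, i, j) \<in> atoms V0 E L" "c = 1 \<or> c = 3" for c i j
    proof -
      have "(c, i, j) \<in> atoms V1 E L" using that(1) by (simp only: at)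
      then show ?thesis using that(2) atoms_mono[OF sub(1)] by blast
    qed
    have 2: "(3, i, i) \<in> atoms V0 E L" if "(2, i, j) \<in> atoms V0 E L" for i j
      using that unfolding atoms_def by auto
    have 3: "(3, i, i) \<notin> atoms V0 E L" if U2: "(2, i, j) \<in> atoms U E L" for i j
    proof
      assume "(3, i, i) \<in> atoms V0 E L"
      then have "(3, i, i) \<in> atoms V1 E L" "(3, i, i) \<in> atoms V2 E L" using at by auto
      then obtain x y where "x \<in> L ! i \<inter> V1" "y \<in> L ! i \<inter> V2" by (auto simp: atoms_def)
      moreover obtain a where "L ! i \<inter> U = {a}" using U2 by (auto simp: atoms_def)
      ultimately have "x = a" "y = a" using sub by auto
      then show False using \<open>x \<in> L ! i \<inter> V1\<close> \<open>y \<in> L ! i \<inter> V2\<close> dis by auto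
    qed
    have "(c, i, j) \<in> atoms (V0 \<union> U) E L \<longleftrightarrow> (c, i, j) \<in> atoms U E L" for c i j
    proof -
      have "c \<in> {0, 1, 2, 3}" if "(c, i, j) \<in> atoms U E L" using that by (auto simp: atoms_def)
      then show ?thesis by (subst atoms_Un[OF dU]) (use nc 0 13 2 3 in blast)+
    qed
    then have "atoms (V0 \<union> U) E L = atoms U E L" by auto
    then show "tp 0 (\<Union>\<V>) E L = tp 0 (\<Union>(\<V> - {V0})) E L" unfolding UV by (simp add: U_def)
  qed
next
  case (Suc k)
  obtain N where N: "\<And>\<V> E (L :: 'a set list) V0. length L = Suc m \<Longrightarrow> separated E \<V> \<Longrightarrow> V0 \<in> \<V> \<Longrightarrow>
     N < card {V \<in> \<V>. tp k V E L = tp k V0 E L} \<Longrightarrow> tp k (\<Union>\<V>) E L = tp k (\<Union>(\<V> - {V0})) E L"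
    using Suc.IH[of "Suc m"] by blast
  define T where "T = {tp k W E L | (W :: 'a set) E L. finite W \<and> length L = Suc m}"
  have finT: "finite T" unfolding T_def by (rule finite_types)
  show ?case
  \<comment> \<open>The successor keeps more than \<open>N * card T\<close> parts available when
    \<open>V0\<close> itself is excluded.\<close>
  proof (intro exI[of _ "Suc (N * card T)"] allI impI ballI)
    fix \<V> V0 and E :: "'a set set" and L :: "'a set list"
    assume len: "length L = m" and sep: "separated E \<V>" and V0: "V0 \<in> \<V>" and
      c: "Suc (N * card T) < card {V \<in> \<V>. tp (Suc k) V E L = tp (Suc k) V0 E L}"
    define S where "S = {V \<in> \<V>. tp (Suc k) V E L = tp (Suc k) V0 E L}"
    have finS: "finite S" using separated_finite(1)[OF sep] by (simp add: S_def)
    note fin = separated_finite[OF sep]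
    have V0S: "V0 \<in> S" using V0 by (simp add: S_def)
    have "Suc (N * card T) < card S" using c unfolding S_def .
    then have cS: "N * card T < card S" and cS': "N * card T < card (S - {V0})"
      using V0S finS by simp_all
    have fT: "tp k V E (A # L) \<in> T" if "V \<in> \<V>" for V A
      unfolding T_def using len fin(2)[OF that] by auto (metis length_Cons)
    show "tp (Suc k) (\<Union>\<V>) E L = tp (Suc k) (\<Union>(\<V> - {V0})) E L"
    proof (rule tp_SucI)
      fix A assume "A \<subseteq> \<Union>\<V>"
      have "(\<lambda>V. tp k V E (A # L)) ` S \<subseteq> T" using fT by (auto simp: S_def)
      then obtain t where t: "N < card {V \<in> S. tp k V E (A # L) = t}"
        using large_fiber[OF finS finT _ cS] by blast
      then have "{V \<in> S. tp k V E (A # L) = t} \<noteq> {}" by (metis card.empty not_less_zero)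
      then obtain V1 where V1: "V1 \<in> S" "tp k V1 E (A # L) = t" by blast
      have V1V: "V1 \<in> \<V>" using V1 by (simp add: S_def)
      have "N < card {V \<in> \<V>. tp k V E (A # L) = tp k V1 E (A # L)}"
        using t V1(2) fin(1)
        by (intro less_le_trans[OF t] card_mono) (auto simp: S_def)
      then have *: "tp k (\<Union>\<V>) E (A # L) = tp k (\<Union>(\<V> - {V1})) E (A # L)"
        using N[of "A # L" E \<V> V1] sep V1V len by simp
      \<comment> \<open>The induction deletes \<open>V1\<close>, but \<open>V0\<close> is to go.
        Both have the same type of rank k+1, so \<open>V1\<close> can answer the trace of
        \<open>A\<close> on \<open>V0\<close> and take over its role.\<close>
      have "\<exists>A'. tp k (\<Union>(\<V> - {V1})) E (A # L) = tp k (\<Union>(\<V> - {V0})) E (A' # L)"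
      proof (cases "V1 = V0")
        case False
        have "tp (Suc k) V0 E L = tp (Suc k) V1 E L" using V1 by (simp add: S_def)
        then obtain B where B: "B \<subseteq> V1" "tp k V0 E ((A \<inter> V0) # L) = tp k V1 E (B # L)"
          using tp_SucD[of k V0 E L V1 E L "A \<inter> V0"] fin(2)[OF V0] fin(2)[OF V1V] by auto
        define W where "W = \<Union>(\<V> - {V0} - {V1})"
        have W': "W = \<Union>(\<V> - {V1} - {V0})" unfolding W_def by (rule arg_cong[where f = Union]) auto
        note d0 = separated_disjoint[OF sep V0, where \<W> = "{V1}", folded W_def]
        note d1 = separated_disjoint[OF sep V1V, where \<W> = "{V0}", folded W']
        have finW: "finite W" unfolding W_def by (rule finite_subset[OF _ fin(3)[of "{}"]]) blast
        define A' where "A' = (A \<inter> W) \<union> B"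
        have e1: "tp k V0 E (A # L) = tp k V1 E (A' # L)"
        proof -
          have "tp k V0 E (A # L) = tp k V0 E ((A \<inter> V0) # L)" by (rule tp_Cons_cong) blast
          also have "\<dots> = tp k V1 E (B # L)" by (rule B(2))
          also have "\<dots> = tp k V1 E (A' # L)" using d1(1) B(1) unfolding A'_def by (intro tp_Cons_cong) blast
          finally show ?thesis .
        qed
        have e2: "tp k W E (A # L) = tp k W E (A' # L)"
          using d1(1) B(1) unfolding A'_def by (intro tp_Cons_cong) blast
        have "tp k (V0 \<union> W) E (A # L) = tp k (V1 \<union> W) E (A' # L)"
          by (rule tp_Un[OF fin(2)[OF V0] finW fin(2)[OF V1V] finW d0(1) _ d1(1) _ e1 e2]; fact d0 d1)
        moreover have "\<Union>(\<V> - {V1}) = V0 \<union> W" "\<Union>(\<V> - {V0}) = V1 \<union> W"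
          using V0 V1V False by (auto simp: W_def)
        ultimately show ?thesis by auto
      qed auto
      then obtain A' where "tp k (\<Union>\<V>) E (A # L) = tp k (\<Union>(\<V> - {V0})) E (A' # L)" using * by auto
      also have "\<dots> = tp k (\<Union>(\<V> - {V0})) E ((A' \<inter> \<Union>(\<V> - {V0})) # L)" by (rule tp_Cons_cong) blast
      finally show "\<exists>A'\<subseteq>\<Union>(\<V> - {V0}). tp k (\<Union>\<V>) E (A # L) = tp k (\<Union>(\<V> - {V0})) E (A' # L)"
        by (meson Int_lower2)
    next
      \<comment> \<open>Conversely \<open>V0\<close> gets a trace \<open>B\<close> imitating that of
        \<open>A\<close> on a part \<open>V1\<close> of frequent refined type; then
        \<open>V0\<close> is itself one of many and can be deleted by induction.\<close>
      fix A assume A: "A \<subseteq> \<Union>(\<V> - {V0})"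
      have "(\<lambda>V. tp k V E (A # L)) ` (S - {V0}) \<subseteq> T" using fT by (auto simp: S_def)
      then obtain t where t: "N < card {V \<in> S - {V0}. tp k V E (A # L) = t}"
        using large_fiber[OF _ finT _ cS'] finS by blast
      then have "{V \<in> S - {V0}. tp k V E (A # L) = t} \<noteq> {}" by (metis card.empty not_less_zero)
      then obtain V1 where V1: "V1 \<in> S" "V1 \<noteq> V0" "tp k V1 E (A # L) = t" by blast
      have V1V: "V1 \<in> \<V>" using V1 by (simp add: S_def)
      have "tp (Suc k) V1 E L = tp (Suc k) V0 E L" using V1 by (simp add: S_def)
      then obtain B where B: "B \<subseteq> V0" "tp k V1 E ((A \<inter> V1) # L) = tp k V0 E (B # L)"
        using tp_SucD[of k V1 E L V0 E L "A \<inter> V1"] fin(2)[OF V0] fin(2)[OF V1V] by auto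
      define A' where "A' = A \<union> B"
      have AV0: "A \<inter> V0 = {}" using A separated_disjoint(1)[OF sep V0, where \<W> = "{}"] by auto
      have e0: "tp k V0 E (A' # L) = t"
      proof -
        have "tp k V0 E (A' # L) = tp k V0 E (B # L)"
          using AV0 unfolding A'_def by (intro tp_Cons_cong) blast
        also have "\<dots> = tp k V1 E ((A \<inter> V1) # L)" using B(2) by simp
        also have "\<dots> = tp k V1 E (A # L)" by (rule tp_Cons_cong) blast
        finally show ?thesis using V1 by simp
      qed
      have e1: "tp k V E (A' # L) = tp k V E (A # L)" if "V \<in> \<V>" "V \<noteq> V0" for V
      proof (rule tp_Cons_cong)
        have "V \<inter> V0 = {}" using sep that V0 unfolding separated_def by blast
        then show "A' \<inter> V = A \<inter> V" using B(1) unfolding A'_def by blast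
      qed
      have "{V \<in> S - {V0}. tp k V E (A # L) = t} \<subseteq> {V \<in> \<V>. tp k V E (A' # L) = tp k V0 E (A' # L)}"
      proof
        fix V assume V: "V \<in> {V \<in> S - {V0}. tp k V E (A # L) = t}"
        then have "V \<in> \<V>" "V \<noteq> V0" by (simp_all add: S_def)
        then show "V \<in> {V \<in> \<V>. tp k V E (A' # L) = tp k V0 E (A' # L)}" using V e0 e1 by simp
      qed
      then have "N < card {V \<in> \<V>. tp k V E (A' # L) = tp k V0 E (A' # L)}"
        using t fin(1) by (intro less_le_trans[OF t] card_mono) auto
      then have "tp k (\<Union>\<V>) E (A' # L) = tp k (\<Union>(\<V> - {V0})) E (A' # L)"
        using N[of "A' # L" E \<V> V0] sep V0 len by simp
      also have "\<dots> = tp k (\<Union>(\<V> - {V0})) E (A # L)"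
        using separated_disjoint(1)[OF sep V0, where \<W> = "{}"] B(1) unfolding A'_def by (intro tp_Cons_cong) auto
      finally have "tp k (\<Union>\<V>) E (A' # L) = tp k (\<Union>(\<V> - {V0})) E (A # L)" .
      moreover have "A' \<subseteq> \<Union>\<V>" using A B(1) V0 unfolding A'_def by blast
      ultimately show "\<exists>A'\<subseteq>\<Union>\<V>. tp k (\<Union>\<V>) E (A' # L) = tp k (\<Union>(\<V> - {V0})) E (A # L)" by blast
    qed
  qed
qed

section \<open>Stars of rooted trees\<close>

lemma star_tree:
  assumes "finite I" "\<And>i. i \<in> I \<Longrightarrow> F i \<in> trees_on (V i)" "\<And>i. i \<in> I \<Longrightarrow> r i \<in> V i"
    and "\<And>i j. i \<in> I \<Longrightarrow> j \<in> I \<Longrightarrow> i \<noteq> j \<Longrightarrow> V i \<inter> V j = {}" "\<And>i. i \<in> I \<Longrightarrow> c \<notin> V i"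
  shows "(\<Union>i\<in>I. insert {c, r i} (F i)) \<in> trees_on (insert c (\<Union>i\<in>I. V i))"
  using assms
proof (induction I rule: finite_induct)
  case (insert i I)
  have IH: "(\<Union>i\<in>I. insert {c, r i} (F i)) \<in> trees_on (insert c (\<Union>i\<in>I. V i))"
    using insert.prems by (intro insert.IH) auto
  have "insert {c, r i} ((\<Union>i\<in>I. insert {c, r i} (F i)) \<union> F i) \<in> trees_on (insert c (\<Union>i\<in>I. V i) \<union> V i)"
  proof (rule glue_trees[OF IH])
    have "V j \<inter> V i = {}" if "j \<in> I" for j using insert.prems(3)[of j i] insert.hyps that by auto
    then show "insert c (\<Union>i\<in>I. V i) \<inter> V i = {}" using insert.prems(4)[of i] by auto
  qed (use insert.prems in auto)
  moreover have "insert {c, r i} ((\<Union>i\<in>I. insert {c, r i} (F i)) \<union> F i) = (\<Union>i\<in>insert i I. insert {c, r i} (F i))"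
    by auto
  moreover have "insert c (\<Union>i\<in>I. V i) \<union> V i = insert c (\<Union>i\<in>insert i I. V i)" by auto
  ultimately show ?case by simp
qed simp

text \<open>Without the edges at the centre the branches are separated, and absorption drops the
  branch \<open>V'\<close>. Then the centre is added as one more part, its edges are restored as a
  join of the set of roots with \<open>{c}\<close>, and these two markers are forgotten.\<close>

lemma star_absorb:
  fixes V :: "'i \<Rightarrow> 'a set"
  assumes N: "\<And>\<V> E (L :: 'a set list) V0. length L = 2 \<Longrightarrow> separated E \<V> \<Longrightarrow> V0 \<in> \<V> \<Longrightarrow>
     N < card {V \<in> \<V>. tp k V E L = tp k V0 E L} \<Longrightarrow> tp k (\<Union>\<V>) E L = tp k (\<Union>(\<V> - {V0})) E L"
    and I: "finite I" "\<And>i. i \<in> I \<Longrightarrow> finite (V i)" "\<And>i. i \<in> I \<Longrightarrow> F i \<subseteq> edges_on (V i)" "\<And>i. i \<in> I \<Longrightarrow> r i \<in> V i"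
    and dis: "\<And>i j. i \<in> I \<Longrightarrow> j \<in> I \<Longrightarrow> i \<noteq> j \<Longrightarrow> V i \<inter> V j = {}" "\<And>i. i \<in> I \<Longrightarrow> c \<notin> V i"
    and V': "finite V'" "E' \<subseteq> edges_on V'" "v \<in> V'" "\<And>i. i \<in> I \<Longrightarrow> V i \<inter> V' = {}" "c \<notin> V'"
    and many: "N < card {i \<in> I. tp k (V i) (F i) [{r i}, {}] = tp k V' E' [{v}, {}]}"
  shows "tp k (insert c (\<Union>i\<in>I. V i) \<union> V') (insert {v, c} (E' \<union> (\<Union>i\<in>I. insert {c, r i} (F i)))) [] =
    tp k (insert c (\<Union>i\<in>I. V i)) (\<Union>i\<in>I. insert {c, r i} (F i)) []"
proof -
  define \<V> where "\<V> = V ` I"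
  define E0 where "E0 = E' \<union> (\<Union>i\<in>I. F i)"
  define R where "R = insert v (r ` I)"
  \<comment> \<open>On a single branch these markers leave the traces \<open>{r i}\<close> and the
    empty set; this explains the lists \<open>[{r i}, {}]\<close> in the hypotheses.\<close>
  let ?L = "[R, {c}]"
  have F: "e \<subseteq> V i" if "e \<in> F i" "i \<in> I" for e i using I(3) that edges_onD by blast
  have E': "e \<subseteq> V'" if "e \<in> E'" for e using V'(2) that edges_onD by blast
  have FV: "{a, b} \<in> E0 \<longleftrightarrow> {a, b} \<in> F i" if "a \<in> V i" "i \<in> I" for a b i
  proof -
    have "\<not> {a, b} \<subseteq> V'" using V'(4) that by blast
    moreover have "\<not> {a, b} \<subseteq> V j" if "j \<in> I" "j \<noteq> i" for j using dis(1)[of i j] that \<open>a \<in> V i\<close> \<open>i \<in> I\<close> by blast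
    ultimately show ?thesis using F E' that unfolding E0_def by blast
  qed
  have EV: "{a, b} \<in> E0 \<longleftrightarrow> {a, b} \<in> E'" if "a \<in> V'" for a b
  proof -
    have "\<not> {a, b} \<subseteq> V i" if "i \<in> I" for i using V'(4) that \<open>a \<in> V'\<close> by blast
    then show ?thesis using F unfolding E0_def by blast
  qed
  have cE: "{a, c} \<notin> E0" for a
    using F E' dis(2) V'(5) unfolding E0_def by blast
  have sep: "separated E0 (insert V' \<V>)"
  proof -
    have nc1: "{a, b} \<notin> E0" if "a \<in> V i" "b \<notin> V i" "i \<in> I" for a b i using FV[of a i b] F that by blast
    have nc2: "{a, b} \<notin> E0" if "a \<in> V'" "b \<notin> V'" for a b using EV[of a b] E' that by blast
    have nc: "{a, b} \<notin> E0" if "W \<in> insert V' \<V>" "a \<in> W" "b \<notin> W" for W a b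
      using that nc1 nc2 by (auto simp: \<V>_def)
    have d: "W \<inter> W' = {}" if W: "W \<in> insert V' \<V>" "W' \<in> insert V' \<V>" "W \<noteq> W'" for W W'
    proof -
      have "V i \<inter> V j = {}" if "i \<in> I" "j \<in> I" "V i \<noteq> V j" for i j using dis(1) that by metis
      moreover have "V' \<inter> V i = {}" if "i \<in> I" for i using V'(4)[OF that] by (simp add: Int_commute)
      ultimately show ?thesis using W V'(4) unfolding \<V>_def by (elim insertE imageE) simp_all
    qed
    have "{a, b} \<notin> E0" if "W \<in> insert V' \<V>" "W' \<in> insert V' \<V>" "W \<noteq> W'" "a \<in> W" "b \<in> W'" for W W' a b
    proof (rule nc[OF that(1,4)])
      show "b \<notin> W" using d[OF that(1-3)] that(5) by blast
    qed
    moreover have "finite (insert V' \<V>)" "finite W" if "W \<in> insert V' \<V>" for W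
      using I(1,2) V'(1) that by (auto simp: \<V>_def)
    ultimately show ?thesis unfolding separated_def
    proof (intro conjI ballI impI)
      show "finite (insert V' \<V>)" using I(1) by (simp add: \<V>_def)
    qed (use d in simp_all)
  qed
  have nV': "V' \<notin> \<V>" using V'(3,4) unfolding \<V>_def by blast
  have tV: "tp k (V i) E0 ?L = tp k (V i) (F i) [{r i}, {}]" if i: "i \<in> I" for i
  proof (rule tp_cong)
    fix l assume "l < length ?L"
    then consider "l = 0" | "l = 1" by (auto simp: less_Suc_eq)
    then show "?L ! l \<inter> V i = [{r i}, {}] ! l \<inter> V i"
    proof cases
      case 1
      have "r j \<notin> V i" if "j \<in> I" "j \<noteq> i" for j using dis(1)[of i j] i that I(4) by blast
      moreover have "v \<notin> V i" using V'(3,4) i by blast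
      ultimately have "R \<inter> V i = {r i}" using I(4) i unfolding R_def by blast
      then show ?thesis using 1 I(4) i by simp
    qed (use dis(2) i in simp)
  qed (use FV i in auto)
  have tV': "tp k V' E0 ?L = tp k V' E' [{v}, {}]"
  proof (rule tp_cong)
    fix l assume "l < length ?L"
    then consider "l = 0" | "l = 1" by (auto simp: less_Suc_eq)
    then show "?L ! l \<inter> V' = [{v}, {}] ! l \<inter> V'"
    proof cases
      case 1
      have "r j \<notin> V'" if "j \<in> I" for j using that I(4) V'(4) by blast
      then have "R \<inter> V' = {v}" using V'(3) unfolding R_def by blast
      then show ?thesis using 1 V'(3) by simp
    qed (use V'(5) in simp)
  qed (use EV in auto)
  have "card {i \<in> I. tp k (V i) (F i) [{r i}, {}] = tp k V' E' [{v}, {}]} \<le> card {W \<in> insert V' \<V>. tp k W E0 ?L = tp k V' E0 ?L}"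
  proof (rule card_inj_on_le[where f = V])
    show "inj_on V {i \<in> I. tp k (V i) (F i) [{r i}, {}] = tp k V' E' [{v}, {}]}"
      using dis(1) I(4) by (intro inj_onI) blast
    show "V ` {i \<in> I. tp k (V i) (F i) [{r i}, {}] = tp k V' E' [{v}, {}]} \<subseteq> {W \<in> insert V' \<V>. tp k W E0 ?L = tp k V' E0 ?L}"
      using tV tV' by (auto simp: \<V>_def)
    show "finite {W \<in> insert V' \<V>. tp k W E0 ?L = tp k V' E0 ?L}" using I(1) by (simp add: \<V>_def)
  qed
  then have "tp k (\<Union>(insert V' \<V>)) E0 ?L = tp k (\<Union>(insert V' \<V> - {V'})) E0 ?L"
    using many by (intro N sep) auto
  also have "insert V' \<V> - {V'} = \<V>" using nV' by blast
  finally have 1: "tp k (\<Union>(insert V' \<V>)) E0 ?L = tp k (\<Union>\<V>) E0 ?L" .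
  have fin: "finite (\<Union>(insert V' \<V>))" "finite (\<Union>\<V>)" using I(1,2) V'(1) by (auto simp: \<V>_def)
  have cV: "c \<notin> \<Union>(insert V' \<V>)" using dis(2) V'(5) by (auto simp: \<V>_def)
  have 2: "tp k (\<Union>(insert V' \<V>) \<union> {c}) E0 ?L = tp k (\<Union>\<V> \<union> {c}) E0 ?L"
    using fin cV cE 1 by (intro tp_Un) auto
  have "tp k (\<Union>(insert V' \<V>) \<union> {c}) (join_edges E0 (?L ! 0) (?L ! 1)) ?L =
     tp k (\<Union>\<V> \<union> {c}) (join_edges E0 (?L ! 0) (?L ! 1)) ?L"
    using fin by (intro tp_join_edges 2) auto
  then have "tp k (\<Union>(insert V' \<V>) \<union> {c}) (join_edges E0 R {c}) ([] @ ?L) =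
     tp k (\<Union>\<V> \<union> {c}) (join_edges E0 R {c}) ([] @ ?L)" by simp
  then have 3: "tp k (\<Union>(insert V' \<V>) \<union> {c}) (join_edges E0 R {c}) [] = tp k (\<Union>\<V> \<union> {c}) (join_edges E0 R {c}) []"
    by (rule tp_append) (use fin in auto)
  have J: "join_edges E0 R {c} = insert {v, c} (E' \<union> (\<Union>i\<in>I. insert {c, r i} (F i)))"
    unfolding join_edges_def E0_def R_def by (auto simp: insert_commute)
  have U1: "\<Union>(insert V' \<V>) \<union> {c} = insert c (\<Union>i\<in>I. V i) \<union> V'" by (auto simp: \<V>_def)
  have U2: "\<Union>\<V> \<union> {c} = insert c (\<Union>i\<in>I. V i)" by (auto simp: \<V>_def)
  have "tp k (\<Union>\<V> \<union> {c}) (join_edges E0 R {c}) [] = tp k (insert c (\<Union>i\<in>I. V i)) (\<Union>i\<in>I. insert {c, r i} (F i)) []"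
    unfolding U2 J
  proof (rule tp_cong)
    fix a b assume ab: "a \<in> insert c (\<Union>i\<in>I. V i)" "b \<in> insert c (\<Union>i\<in>I. V i)"
    have "a \<notin> V'" "b \<notin> V'" using ab V'(4,5) by auto
    then have "{a, b} \<notin> E'" "{a, b} \<noteq> {v, c}" using E' V'(3) by (auto simp: doubleton_eq_iff)
    then show "{a, b} \<in> insert {v, c} (E' \<union> (\<Union>i\<in>I. insert {c, r i} (F i))) \<longleftrightarrow> {a, b} \<in> (\<Union>i\<in>I. insert {c, r i} (F i))"
      by auto
  qed auto
  then show ?thesis using 3 unfolding U1 J by simp
qed

section \<open>A universal tree\<close>

lemma cross_image:
  assumes "inj_on g V" "X \<subseteq> V" "e \<subseteq> V"
  shows "cross (g ` X) (g ` e) \<longleftrightarrow> cross X e"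
proof -
  have "g ` e \<inter> g ` X = g ` (e \<inter> X)" using inj_on_image_Int[OF assms(1,3,2)] by simp
  then show ?thesis unfolding cross_def inj_on_image_subset_iff[OF assms(1,3,2)] by simp
qed

lemma image_edge_iff:
  assumes "inj_on g V" "E \<subseteq> edges_on V" "a \<in> V" "b \<in> V"
  shows "{g a, g b} \<in> (`) g ` E \<longleftrightarrow> {a, b} \<in> E"
proof
  assume "{g a, g b} \<in> (`) g ` E"
  then obtain e where "e \<in> E" "g ` {a, b} = g ` e" by auto
  moreover from this have "e \<subseteq> V" using assms(2) edges_onD by blast
  ultimately show "{a, b} \<in> E" using inj_on_image_eq_iff[OF assms(1), of "{a, b}" e] assms(3,4) by simp
next
  assume "{a, b} \<in> E"
  then show "{g a, g b} \<in> (`) g ` E" by (intro image_eqI[of _ _ "{a, b}"]) auto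
qed

lemma forests_on_image:
  assumes g: "inj_on g V" and E: "E \<in> forests_on V"
  shows "(`) g ` E \<in> forests_on (g ` V)"
proof -
  note EV = forests_on_subset[OF E]
  have "(`) g ` E \<subseteq> edges_on (g ` V)"
  proof
    fix e' assume "e' \<in> (`) g ` E"
    then obtain e where e: "e \<in> E" "e' = g ` e" by blast
    have "card e = 2" using e E by (auto simp: forests_on_def edges_on_def)
    then have "card e' = 2" using e EV[OF e(1)] card_image[OF inj_on_subset[OF g]] by simp
    then show "e' \<in> edges_on (g ` V)" using e EV[OF e(1)] by (auto simp: edges_on_def)
  qed
  moreover have "acyclic_edges ((`) g ` E)"
    unfolding acyclic_edges_def
  proof
    fix e' assume "e' \<in> (`) g ` E"
    then obtain e where e: "e \<in> E" "e' = g ` e" by blast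
    then have "e \<in> edges_on V" using forests_on_edges[OF E] by blast
    then obtain a where "a \<in> V" by (auto elim: edges_onE)
    then obtain X where X: "X \<subseteq> V" "a \<notin> X" "{f \<in> E. cross X f} = {e}" by (rule acyclic_cut[OF E e(1)])
    have "cross (g ` X) (g ` f) \<longleftrightarrow> f = e" if "f \<in> E" for f
    proof -
      have "cross (g ` X) (g ` f) \<longleftrightarrow> f \<in> {f \<in> E. cross X f}" using cross_image[OF g X(1) EV[OF that]] that by simp
      then show ?thesis unfolding X(3) by simp
    qed
    then have "{f' \<in> (`) g ` E. cross (g ` X) f'} = {e'}" using e by auto
    then show "\<exists>X. {f' \<in> (`) g ` E. cross X f'} = {e'}" by blast
  qed
  ultimately show ?thesis by (simp add: forests_on_def)
qed

lemma trees_on_image: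
  assumes g: "inj_on g V" and E: "E \<in> trees_on V"
  shows "(`) g ` E \<in> trees_on (g ` V)"
proof -
  have "connected_on (g ` V) ((`) g ` E)"
    unfolding connected_on_def
  proof (intro conjI allI impI)
    show "g ` V \<noteq> {}" using trees_on_nonempty[OF E] by simp
    fix Y assume Y: "Y \<subseteq> g ` V" "Y \<noteq> {}" "Y \<noteq> g ` V"
    then obtain X where X: "X \<subseteq> V" "Y = g ` X" by (meson subset_imageE)
    then have "X \<noteq> {}" "X \<noteq> V" using Y by auto
    then obtain e where "e \<in> E" "cross X e" using E X(1) by (auto simp: trees_on_def connected_on_def)
    then show "\<exists>e\<in>(`) g ` E. cross Y e"
      using cross_image[OF g X(1) trees_on_subset[OF E]] X(2) by auto
  qed
  then show ?thesis using forests_on_image[OF g trees_on_forests_on[OF E]] by (simp add: trees_on_def)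
qed

lemma image_edges_inv:
  assumes "inj_on g V" "E \<subseteq> Pow V"
  shows "(`) (inv_into V g) ` (`) g ` E = E"
proof -
  have "(`) (inv_into V g) ` (`) g ` E = (\<lambda>e. inv_into V g ` g ` e) ` E" by (simp add: image_image)
  also have "\<dots> = (\<lambda>e. e) ` E"
  proof (rule image_cong[OF refl])
    fix e assume "e \<in> E"
    then have "e \<subseteq> V" using assms(2) by blast
    then show "inv_into V g ` g ` e = e" by (rule inv_into_image_cancel[OF assms(1)])
  qed
  finally show ?thesis by simp
qed

lemma image_edges_inv':
  assumes "E \<subseteq> Pow (g ` V)"
  shows "(`) g ` (`) (inv_into V g) ` E = E"
proof -
  have "(`) g ` (`) (inv_into V g) ` E = (\<lambda>e. g ` inv_into V g ` e) ` E" by (simp add: image_image)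
  also have "\<dots> = (\<lambda>e. e) ` E"
  proof (rule image_cong[OF refl])
    fix e assume "e \<in> E"
    then have "e \<subseteq> g ` V" using assms by blast
    then show "g ` inv_into V g ` e = e" by (rule image_inv_into_cancel[OF refl])
  qed
  finally show ?thesis by simp
qed

lemma card_forests_on_image:
  assumes g: "inj_on g V"
  shows "card {E \<in> forests_on (g ` V). P E} = card {E \<in> forests_on V. P ((`) g ` E)}"
proof (rule bij_betw_same_card[symmetric])
  have i: "inj_on (inv_into V g) (g ` V)" by (rule inj_on_inv_into) simp
  have V: "inv_into V g ` g ` V = V" using inv_into_image_cancel[OF g] by blast
  have p: "E \<subseteq> Pow V" if "E \<in> forests_on V" for E and V :: "'x set" using forests_on_subset[OF that] by blast
  have p': "E \<subseteq> Pow (g ` V)" if "E \<in> forests_on (g ` V)" for E using forests_on_subset[OF that] by blast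
  show "bij_betw ((`) ((`) g)) {E \<in> forests_on V. P ((`) g ` E)} {E \<in> forests_on (g ` V). P E}"
  proof (rule bij_betw_byWitness[where f' = "(`) ((`) (inv_into V g))"])
    show "\<forall>E\<in>{E \<in> forests_on V. P ((`) g ` E)}. (`) (inv_into V g) ` (`) g ` E = E"
      using image_edges_inv[OF g p] by simp
    show "\<forall>E\<in>{E \<in> forests_on (g ` V). P E}. (`) g ` (`) (inv_into V g) ` E = E"
      using image_edges_inv'[OF p'] by simp
    show "(`) ((`) g) ` {E \<in> forests_on V. P ((`) g ` E)} \<subseteq> {E \<in> forests_on (g ` V). P E}"
      using forests_on_image[OF g] by blast
    show "(`) ((`) (inv_into V g)) ` {E \<in> forests_on (g ` V). P E} \<subseteq> {E \<in> forests_on V. P ((`) g ` E)}"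
    proof
      fix F assume "F \<in> (`) ((`) (inv_into V g)) ` {E \<in> forests_on (g ` V). P E}"
      then obtain E where E: "E \<in> forests_on (g ` V)" "P E" "F = (`) (inv_into V g) ` E" by blast
      have "F \<in> forests_on V" using forests_on_image[OF i E(1)] unfolding E(3) V .
      moreover have "(`) g ` F = E" using image_edges_inv'[OF p'[OF E(1)]] E(3) by simp
      ultimately show "F \<in> {E \<in> forests_on V. P ((`) g ` E)}" using E(2) by simp
    qed
  qed
qed

text \<open>\<open>M\<close> is a star with more than \<open>N\<close> branches of every
  rank-\<open>k\<close> type of rooted tree, \<open>N\<close> being the bound of absorption for two
  marker sets. A tree \<open>V'\<close> hung on the centre by \<open>v\<close> is, rooted at
  \<open>v\<close>, of one of these types and is absorbed. The map \<open>g\<close> admits any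
  relabelled copy of \<open>M\<close>.\<close>

lemma universal_tree:
  "\<exists>(M :: nat set) E c. finite M \<and> E \<in> trees_on M \<and> c \<in> M \<and>
     (\<forall>g (V' :: nat set) E' v. inj_on g M \<longrightarrow> finite V' \<longrightarrow> E' \<in> trees_on V' \<longrightarrow> v \<in> V' \<longrightarrow> V' \<inter> g ` M = {} \<longrightarrow>
        tp k (g ` M \<union> V') (insert {v, g c} (E' \<union> (`) g ` E)) [] = tp k M E [])"
proof -
  obtain N where N: "\<And>\<V> E (L :: nat set list) V0. length L = 2 \<Longrightarrow> separated E \<V> \<Longrightarrow> V0 \<in> \<V> \<Longrightarrow>
     N < card {V \<in> \<V>. tp k V E L = tp k V0 E L} \<Longrightarrow> tp k (\<Union>\<V>) E L = tp k (\<Union>(\<V> - {V0})) E L"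
    using absorb[of 2 k] by blast
  define \<Theta> where "\<Theta> = {tp k W E [{v}, {}] | (W :: nat set) E v. finite W \<and> E \<in> trees_on W \<and> v \<in> W}"
  have "finite \<Theta>"
  proof (rule finite_subset)
    show "\<Theta> \<subseteq> {tp k W E L | (W :: nat set) E L. finite W \<and> length L = 2}"
      unfolding \<Theta>_def by (auto; metis One_nat_def Suc_1 length_Cons list.size(3))
  qed (rule finite_types)
  have "\<forall>\<theta>\<in>\<Theta>. \<exists>x. case x of (W :: nat set, E, v) \<Rightarrow> finite W \<and> E \<in> trees_on W \<and> v \<in> W \<and> tp k W E [{v}, {}] = \<theta>"
    unfolding \<Theta>_def by auto
  then obtain x where x: "\<forall>\<theta>\<in>\<Theta>. case x \<theta> of (W :: nat set, E, v) \<Rightarrow> finite W \<and> E \<in> trees_on W \<and> v \<in> W \<and> tp k W E [{v}, {}] = \<theta>"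
    by (rule bchoice[THEN exE])
  define Wf Ef vf where "Wf = (\<lambda>\<theta>. fst (x \<theta>))" and "Ef = (\<lambda>\<theta>. fst (snd (x \<theta>)))" and "vf = (\<lambda>\<theta>. snd (snd (x \<theta>)))"
  have rep: "finite (Wf \<theta>)" "Ef \<theta> \<in> trees_on (Wf \<theta>)" "vf \<theta> \<in> Wf \<theta>" "tp k (Wf \<theta>) (Ef \<theta>) [{vf \<theta>}, {}] = \<theta>"
    if "\<theta> \<in> \<Theta>" for \<theta>
    using bspec[OF x that] by (simp_all add: Wf_def Ef_def vf_def case_prod_beta)
  \<comment> \<open>There are N + 1 indices for each type, one more than the bound that absorption
    requires to be exceeded.\<close>
  define I where "I = \<Theta> \<times> {..N}"
  \<comment> \<open>The pairing function keeps the branches disjoint, and the successor reserves 0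
    for the centre.\<close>
  define h where "h = (\<lambda>i x. Suc (prod_encode (prod_encode i, x)))"
  have hinj: "inj_on (h i) W" for i W by (auto simp: inj_on_def h_def prod_encode_eq)
  define M where "M = insert 0 (\<Union>i\<in>I. h i ` Wf (fst i))"
  define E where "E = (\<Union>i\<in>I. insert {0, h i (vf (fst i))} ((`) (h i) ` Ef (fst i)))"
  have I: "finite I" using \<open>finite \<Theta>\<close> by (simp add: I_def)
  have finM: "finite M" unfolding M_def using I rep(1) by (auto simp: I_def)
  have dis: "h i x = h j y \<Longrightarrow> i = j" "h i x \<noteq> 0" for i j x y by (auto simp: h_def prod_encode_eq)
  have tE: "(`) (h i) ` Ef (fst i) \<in> trees_on (h i ` Wf (fst i))" if "i \<in> I" for i
    using that rep(2) hinj by (intro trees_on_image) (auto simp: I_def)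
  have tree: "E \<in> trees_on M"
    unfolding E_def M_def
  proof (rule star_tree[OF I tE])
    fix i j assume "i \<in> I" "j \<in> I" "i \<noteq> j"
    then show "h i ` Wf (fst i) \<inter> h j ` Wf (fst j) = {}" using dis(1) by blast
  next
    fix i assume "i \<in> I"
    then show "h i (vf (fst i)) \<in> h i ` Wf (fst i)" using rep(3) by (auto simp: I_def)
    show "0 \<notin> h i ` Wf (fst i)" using dis(2) by (metis imageE)
  qed
  have "tp k (g ` M \<union> V') (insert {v, g 0} (E' \<union> (`) g ` E)) [] = tp k M E []"
    if g: "inj_on g M" and V': "finite V'" "E' \<in> trees_on V'" "v \<in> V'" "V' \<inter> g ` M = {}" for g and V' :: "nat set" and E' v
  proof -
    define Vi where "Vi = (\<lambda>i. (g \<circ> h i) ` Wf (fst i))"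
    define F where "F = (\<lambda>i. (`) (g \<circ> h i) ` Ef (fst i))"
    define r where "r = (\<lambda>i. (g \<circ> h i) (vf (fst i)))"
    have hM: "h i ` Wf (fst i) \<subseteq> M" if "i \<in> I" for i using that by (auto simp: M_def)
    have ginj: "inj_on (g \<circ> h i) (Wf (fst i))" if "i \<in> I" for i
      using hinj inj_on_subset[OF g hM[OF that]] by (intro comp_inj_on)
    have gM: "g ` M = insert (g 0) (\<Union>i\<in>I. Vi i)" by (simp add: M_def Vi_def image_Union image_UN image_comp)
    have gE: "(`) g ` E = (\<Union>i\<in>I. insert {g 0, r i} (F i))"
      by (simp add: E_def F_def r_def image_UN image_comp o_def image_image)
    have tF: "F i \<in> trees_on (Vi i)" if "i \<in> I" for i
      unfolding F_def Vi_def using rep(2) ginj[OF that] that by (intro trees_on_image) (auto simp: I_def)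
    have ti: "tp k (Vi i) (F i) [{r i}, {}] = fst i" if i: "i \<in> I" for i
    proof -
      have \<theta>: "fst i \<in> \<Theta>" using i by (auto simp: I_def)
      have "tp k ((g \<circ> h i) ` Wf (fst i)) (F i) (map ((`) (g \<circ> h i)) [{vf (fst i)}, {}]) =
          tp k (Wf (fst i)) (Ef (fst i)) [{vf (fst i)}, {}]"
      proof (rule tp_image[OF ginj[OF i]])
        fix a b assume "a \<in> Wf (fst i)" "b \<in> Wf (fst i)"
        then show "{(g \<circ> h i) a, (g \<circ> h i) b} \<in> F i \<longleftrightarrow> {a, b} \<in> Ef (fst i)"
          unfolding F_def by (intro image_edge_iff[OF ginj[OF i] trees_on_edges[OF rep(2)[OF \<theta>]]])
      qed (use rep(3)[OF \<theta>] in auto)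
      then show ?thesis using rep(4)[OF \<theta>] by (simp add: Vi_def r_def)
    qed
    have \<theta>0: "tp k V' E' [{v}, {}] \<in> \<Theta>" using V' unfolding \<Theta>_def
      by (intro CollectI exI[of _ V'] exI[of _ E'] exI[of _ v]) simp
    have "tp k (insert (g 0) (\<Union>i\<in>I. Vi i) \<union> V') (insert {v, g 0} (E' \<union> (\<Union>i\<in>I. insert {g 0, r i} (F i)))) [] =
      tp k (insert (g 0) (\<Union>i\<in>I. Vi i)) (\<Union>i\<in>I. insert {g 0, r i} (F i)) []"
    proof (rule star_absorb[OF N I])
      fix i assume i: "i \<in> I"
      show "finite (Vi i)" using i rep(1) by (auto simp: I_def Vi_def)
      show "F i \<subseteq> edges_on (Vi i)" by (rule trees_on_edges[OF tF[OF i]])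
      show "r i \<in> Vi i" using i rep(3) by (auto simp: I_def Vi_def r_def)
      show "g 0 \<notin> Vi i"
      proof
        assume "g 0 \<in> Vi i"
        then obtain x where x: "x \<in> h i ` Wf (fst i)" "g 0 = g x" by (auto simp: Vi_def)
        then have "x = 0" using inj_onD[OF g, of 0 x] hM[OF i] by (auto simp: M_def)
        then show False using x(1) dis(2) by (metis imageE)
      qed
      show "Vi i \<inter> V' = {}" using V'(4) i unfolding gM by blast
      fix j assume j: "j \<in> I" "i \<noteq> j"
      show "Vi i \<inter> Vi j = {}"
      proof (rule ccontr)
        assume "Vi i \<inter> Vi j \<noteq> {}"
        then obtain x y where xy: "x \<in> Wf (fst i)" "y \<in> Wf (fst j)" "g (h i x) = g (h j y)" by (auto simp: Vi_def)
        then have "h i x = h j y" using inj_onD[OF g xy(3)] hM[OF i] hM[OF j(1)] by blast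
        then show False using dis(1) j(2) by blast
      qed
    next
      show "E' \<subseteq> edges_on V'" by (rule trees_on_edges[OF V'(2)])
      show "g 0 \<notin> V'" using V'(4) unfolding gM by blast
      have "card ({tp k V' E' [{v}, {}]} \<times> {..N}) \<le> card {i \<in> I. tp k (Vi i) (F i) [{r i}, {}] = tp k V' E' [{v}, {}]}"
        using I \<theta>0 ti by (intro card_mono) (auto simp: I_def)
      then show "N < card {i \<in> I. tp k (Vi i) (F i) [{r i}, {}] = tp k V' E' [{v}, {}]}" by simp
    qed (use V' in auto)
    also have "\<dots> = tp k (g ` M) ((`) g ` E) (map ((`) g) [])" unfolding gM gE by simp
    also have "\<dots> = tp k M E []"
      using image_edge_iff[OF g trees_on_edges[OF tree]] by (intro tp_image[OF g]) auto
    finally show ?thesis unfolding gM gE .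
  qed
  moreover have "0 \<in> M" by (simp add: M_def)
  ultimately show ?thesis using finM tree by blast
qed

section \<open>A zero-one law for random trees\<close>

lemma card_trees_on: "finite V \<Longrightarrow> V \<noteq> {} \<Longrightarrow> real (card (trees_on V)) = real (card V) ^ (card V - 2)"
  by (simp add: cayley)

text \<open>The quotient counts the choices of j vertices and of a tree on the others, relative to
  all trees. Written in tree weights it is a shifted quotient, which tends to 1, times the constant
  e^(-j) / j!.\<close>

lemma choose_trees_tendsto:
  "(\<lambda>n. real (n choose j) * real (n - j) ^ (n - j - 2) / real n ^ (n - 2)) \<longlonglongrightarrow> exp (- real j) / fact j"
proof -
  have "(\<lambda>n. tree_weight (n - j) / tree_weight n * (exp (- real j) / fact j)) \<longlonglongrightarrow> 1 * (exp (- real j) / fact j)"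
    by (intro tendsto_mult tree_weight_shift_tendsto tendsto_const)
  moreover have "eventually (\<lambda>n. tree_weight (n - j) / tree_weight n * (exp (- real j) / fact j) =
     real (n choose j) * real (n - j) ^ (n - j - 2) / real n ^ (n - 2)) sequentially"
    using eventually_ge_at_top[of "Suc j"]
  proof eventually_elim
    case (elim n)
    have e: "exp (- real (n - j)) * exp (- real j) = exp (- real n)"
      using elim by (simp add: exp_add[symmetric] of_nat_diff)
    have b: "real (n choose j) = fact n / (fact j * fact (n - j))"
      using elim by (intro binomial_fact) auto
    have "tree_weight (n - j) / tree_weight n * (exp (- real j) / fact j) =
      real (n - j) ^ (n - j - 2) * (exp (- real (n - j)) * exp (- real j)) / (fact (n - j) * fact j) *
      (fact n / (real n ^ (n - 2) * exp (- real n)))"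
      using elim by (simp add: tree_weight_def mult_ac del: of_nat_diff)
    also have "\<dots> = real (n choose j) * real (n - j) ^ (n - j - 2) / real n ^ (n - 2)"
      unfolding e b by (simp add: mult_ac del: of_nat_diff)
    finally show ?case .
  qed
  ultimately show ?thesis by (auto intro: Lim_transform_eventually)
qed

section \<open>Pendant copies and the second moment method\<close>

text \<open>The size condition leaves vertices outside \<open>W \<union> W'\<close>, so some edge
  leaves the union, and it can only be \<open>f\<close> or \<open>f'\<close>. If the sets met,
  connectivity of one would supply an edge inside it that crosses the other; this would have to be
  the edge that leaves the union. Likewise, if the sets are disjoint, an attaching edge inside the
  union would cross both and would thus be the only edge crossing either.\<close>

lemma pendant_disjoint:
  assumes T: "T \<in> trees_on V" and fin: "finite V" and W: "W \<subseteq> V" "W' \<subseteq> V" "card W = card W'" "W \<noteq> W'" "2 * card W < card V"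
    and f: "{e \<in> T. cross W e} = {f}" "{e \<in> T. cross W' e} = {f'}"
    and con: "connected_on W (T \<inter> Pow W)" "connected_on W' (T \<inter> Pow W')"
  shows "W \<inter> W' = {}" "\<not> f \<subseteq> W \<union> W'" "\<not> f' \<subseteq> W \<union> W'"
proof -
  have finW: "finite W" "finite W'" using W fin finite_subset by auto
  have "card (W \<union> W') \<le> 2 * card W" using card_Un_le[of W W'] W(3) by simp
  then have "W \<union> W' \<noteq> V" using W(5) by auto
  moreover have "W \<noteq> {}" using con(1) by (simp add: connected_on_def)
  moreover have "\<forall>X\<subseteq>V. X \<noteq> {} \<longrightarrow> X \<noteq> V \<longrightarrow> (\<exists>e\<in>T. cross X e)"
    using T by (simp add: trees_on_def connected_on_def)
  ultimately have "\<exists>e\<in>T. cross (W \<union> W') e" using W(1,2) by simp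
  then obtain e where e: "e \<in> T" "cross (W \<union> W') e" by blast
  have f_iff: "cross W e \<longleftrightarrow> e = f" "cross W' e \<longleftrightarrow> e = f'" if "e \<in> T" for e
    using f[THEN eqset_imp_iff, of e] that by simp_all
  have fT: "f \<in> T" "f' \<in> T" "cross W f" "cross W' f'"
    using f(1)[THEN eqset_imp_iff, of f] f(2)[THEN eqset_imp_iff, of f'] by simp_all
  have ne: "\<not> e \<subseteq> W \<union> W'" and or: "e = f \<or> e = f'"
    using e f_iff[OF e(1)] by (auto simp: cross_def)
  have sub: False if s: "W1 \<inter> W2 \<noteq> {}" "W1 \<noteq> W2" "card W1 = card W2" "finite W1" "finite W2"
     "connected_on W2 (T \<inter> Pow W2)" "{e' \<in> T. cross W1 e'} = {e}" "\<not> e \<subseteq> W2" for W1 W2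
  proof -
    have "\<not> W2 \<subseteq> W1" using s(2-5) card_subset_eq by metis
    then have "W2 \<inter> W1 \<noteq> W2" by blast
    then obtain d where d: "d \<in> T \<inter> Pow W2" "cross (W2 \<inter> W1) d"
      using s(1,6) unfolding connected_on_def by (metis Int_commute inf_le1)
    then have "cross W1 d" using cross_Int[of d W2 W1] by (simp add: Int_commute)
    then have "d = e" using d s(7)[THEN eqset_imp_iff, of d] by simp
    then show False using d s(8) by blast
  qed
  show dis: "W \<inter> W' = {}"
  proof (rule ccontr)
    assume nd: "W \<inter> W' \<noteq> {}"
    from or show False
    proof
      assume "e = f"
      then have "{e' \<in> T. cross W e'} = {e}" using f(1) by simp
      then show False using sub[OF nd W(4,3) finW con(2)] ne by blast
    next
      assume "e = f'"
      then have "{e' \<in> T. cross W' e'} = {e}" using f(2) by simp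
      moreover have "W' \<inter> W \<noteq> {}" using nd by blast
      ultimately show False using sub[OF _ W(4)[symmetric] W(3)[symmetric] finW(2,1) con(1)] ne by blast
    qed
  qed
  have *: False if "d \<in> {f, f'}" "d \<subseteq> W \<union> W'" for d
  proof -
    have "cross W d \<and> cross W' d" using that dis fT(3,4) unfolding cross_def by blast
    moreover have "d \<in> T" using that fT by auto
    ultimately have "d = f" "d = f'" using f_iff by auto
    then show False using or ne that(2) by blast
  qed
  show "\<not> f \<subseteq> W \<union> W'" "\<not> f' \<subseteq> W \<union> W'" using * by auto
qed

lemma Collect_cross_Diff:
  assumes "\<And>e. e \<in> E \<Longrightarrow> e \<subseteq> V"
  shows "{e \<in> E. cross (V - W) e} = {e \<in> E. cross W e}"
  by (intro Collect_cong conj_cong refl cross_Diff assms)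

text \<open>For each \<open>W\<close> one labelled tree \<open>F W\<close> and one vertex
  \<open>c W\<close> are prescribed. Hence the tree on the rest and its attachment vertex
  \<open>v\<close> determine the whole tree.\<close>

definition pendant :: "'a set \<Rightarrow> ('a set \<Rightarrow> 'a set set) \<Rightarrow> ('a set \<Rightarrow> 'a) \<Rightarrow> 'a set \<Rightarrow> 'a set set \<Rightarrow> bool" where
  "pendant V F c W T \<longleftrightarrow> T \<inter> Pow W = F W \<and> (\<exists>v\<in>V - W. {e \<in> T. cross W e} = {{v, c W}})"

context
  fixes V :: "'a set" and F :: "'a set \<Rightarrow> 'a set set" and c :: "'a set \<Rightarrow> 'a" and h :: nat
  assumes fin: "finite V"
    and F: "\<And>W. W \<subseteq> V \<Longrightarrow> card W = h \<Longrightarrow> F W \<in> trees_on W \<and> c W \<in> W"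
begin

lemma card_pendant_ge:
  assumes W: "W \<subseteq> V" "card W = h"
  shows "card {T \<in> trees_on V. pendant V F c W T} \<ge> card (V - W) * card (trees_on (V - W))"
proof -
  let ?g = "\<lambda>(E, v). insert {v, c W} (E \<union> F W)"
  note FW = F[OF W]
  have VW: "(V - W) \<inter> W = {}" "(V - W) \<union> W = V" using W(1) by auto
  have parts: "{e \<in> ?g (E, v). cross (V - W) e} = {{v, c W}}" "?g (E, v) \<inter> Pow (V - W) = E" "?g (E, v) \<inter> Pow W = F W"
    if "E \<in> trees_on (V - W)" "v \<in> V - W" for E v
    using glue_parts[OF trees_on_forests_on[OF that(1)] trees_on_forests_on[OF FW[THEN conjunct1]] VW(1) that(2) FW[THEN conjunct2]]
    by simp_all
  have inj: "inj_on ?g (trees_on (V - W) \<times> (V - W))"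
  proof (rule inj_onI, clarify)
    fix E v E' v' assume 1: "E \<in> trees_on (V - W)" "v \<in> V" "v \<notin> W" and 2: "E' \<in> trees_on (V - W)" "v' \<in> V" "v' \<notin> W"
      and eq: "insert {v, c W} (E \<union> F W) = insert {v', c W} (E' \<union> F W)"
    have p: "{e \<in> ?g (E, v). cross (V - W) e} = {{v, c W}}" "?g (E, v) \<inter> Pow (V - W) = E"
      using parts[of E v] 1 by auto
    have p': "{e \<in> ?g (E', v'). cross (V - W) e} = {{v', c W}}" "?g (E', v') \<inter> Pow (V - W) = E'"
      using parts[of E' v'] 2 by auto
    have "?g (E, v) = ?g (E', v')" using eq by simp
    then have "{{v, c W}} = {{v', c W}}" "E = E'" using p p' by metis+
    then show "E = E' \<and> v = v'" by (auto simp: doubleton_eq_iff)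
  qed
  have "?g ` (trees_on (V - W) \<times> (V - W)) \<subseteq> {T \<in> trees_on V. pendant V F c W T}"
  proof clarify
    fix E v assume E: "E \<in> trees_on (V - W)" "v \<in> V" "v \<notin> W"
    have "insert {v, c W} (E \<union> F W) \<in> trees_on (V - W \<union> W)"
      using E FW VW by (intro glue_trees) auto
    then have t: "?g (E, v) \<in> trees_on V" using VW(2) by simp
    have "{e \<in> ?g (E, v). cross W e} = {e \<in> ?g (E, v). cross (V - W) e}"
      by (rule Collect_cross_Diff[OF trees_on_subset[OF t], symmetric])
    then have "{e \<in> ?g (E, v). cross W e} = {{v, c W}}" using parts(1)[of E v] E by simp
    then show "insert {v, c W} (E \<union> F W) \<in> trees_on V \<and> pendant V F c W (insert {v, c W} (E \<union> F W))"
      using t parts(3)[of E v] E unfolding pendant_def by auto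
  qed
  then have "card (trees_on (V - W) \<times> (V - W)) \<le> card {T \<in> trees_on V. pendant V F c W T}"
    using inj finite_trees_on[OF fin] by (intro card_inj_on_le) auto
  then show ?thesis by (simp add: card_cartesian_product mult.commute)
qed

text \<open>Two pendant sets are disjoint by \<open>pendant_disjoint\<close>, and both attachment
  vertices lie outside them. So the tree is determined by the tree on the remaining vertices and two
  vertices of it.\<close>

lemma card_two_pendants_le:
  assumes W: "W \<subseteq> V" "card W = h" "W' \<subseteq> V" "card W' = h" "W \<noteq> W'" "2 * h < card V"
  shows "card {T \<in> trees_on V. pendant V F c W T \<and> pendant V F c W' T} \<le>
    (if W \<inter> W' = {} then card (V - W - W') ^ 2 * card (trees_on (V - W - W')) else 0)"
proof -
  let ?U = "V - W - W'"
  let ?g = "\<lambda>(E, v, v'). insert {v, c W} (insert {v', c W'} (E \<union> F W' \<union> F W))"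
  note FW = F[OF W(1,2)] F[OF W(3,4)]
  have key: "W \<inter> W' = {} \<and> T \<in> ?g ` (trees_on ?U \<times> ?U \<times> ?U)"
    if T: "T \<in> trees_on V" "pendant V F c W T" "pendant V F c W' T" for T
  proof -
    obtain v where v: "v \<in> V - W" "T \<inter> Pow W = F W" "{e \<in> T. cross W e} = {{v, c W}}"
      using T(2) by (auto simp: pendant_def)
    obtain v' where v': "v' \<in> V - W'" "T \<inter> Pow W' = F W'" "{e \<in> T. cross W' e} = {{v', c W'}}"
      using T(3) by (auto simp: pendant_def)
    have con: "connected_on W (T \<inter> Pow W)" "connected_on W' (T \<inter> Pow W')"
      using FW by (simp_all add: v(2) v'(2) trees_on_def)
    note pd = pendant_disjoint[OF T(1) fin W(1,3) _ W(5) _ v(3) v'(3) con]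
    have d: "W \<inter> W' = {}" "\<not> {v, c W} \<subseteq> W \<union> W'" "\<not> {v', c W'} \<subseteq> W \<union> W'"
      using pd W(2,4,6) by simp_all
    have vU: "v \<in> ?U" "v' \<in> ?U" using v v' d FW by auto
    have "{e \<in> T. cross (V - W) e} = {e \<in> T. cross W e}"
      by (rule Collect_cross_Diff[OF trees_on_subset[OF T(1)]])
    then have cr: "{e \<in> T. cross (V - W) e} = {{v, c W}}" using v(3) by simp
    have cW: "c W \<notin> V - W" using FW by simp
    note s1 = split_tree_both[OF T(1) Diff_subset cr v(1) cW]
    have VVW: "V - (V - W) = W" using W(1) by blast
    define T1 where "T1 = T \<inter> Pow (V - W)"
    have T1: "T1 \<in> trees_on (V - W)" using s1(1) by (simp add: T1_def)
    have Teq: "T = insert {v, c W} (T1 \<union> F W)" using s1(3) unfolding VVW v(2) T1_def .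
    have cW': "c W' \<in> W'" "W' \<subseteq> V - W" using FW W(3) d(1) by auto
    have "{e \<in> T1. cross (V - W - W') e} = {e \<in> T1. cross W' e}"
      by (rule Collect_cross_Diff[OF trees_on_subset[OF T1]])
    also have "\<dots> = {e \<in> T. cross W' e} \<inter> Pow (V - W)" unfolding T1_def by blast
    also have "\<dots> = {{v', c W'}}" unfolding v'(3) using vU(2) cW' by auto
    finally have cr': "{e \<in> T1. cross (V - W - W') e} = {{v', c W'}}" .
    have "c W' \<notin> V - W - W'" using cW'(1) by simp
    note s2 = split_tree_both[OF T1 Diff_subset cr' vU(2) this]
    have "V - W - (V - W - W') = W'" using cW'(2) by blast
    moreover have "T1 \<inter> Pow W' = F W'" unfolding T1_def v'(2)[symmetric] using cW'(2) by blast
    ultimately have "T1 = insert {v', c W'} ((T1 \<inter> Pow ?U) \<union> F W')" using s2(3) by metis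
    then have "T = ?g (T1 \<inter> Pow ?U, v, v')" using Teq by auto
    moreover have "(T1 \<inter> Pow ?U, v, v') \<in> trees_on ?U \<times> ?U \<times> ?U" using s2(1) vU by simp
    ultimately show ?thesis using d(1) by blast
  qed
  show ?thesis
  proof (cases "W \<inter> W' = {}")
    case True
    have finU: "finite (trees_on ?U \<times> ?U \<times> ?U)" using fin by (simp add: finite_trees_on)
    have "card {T \<in> trees_on V. pendant V F c W T \<and> pendant V F c W' T} \<le> card (?g ` (trees_on ?U \<times> ?U \<times> ?U))"
      using key finU by (intro card_mono) auto
    also have "\<dots> \<le> card (trees_on ?U \<times> ?U \<times> ?U)" using finU by (rule card_image_le)
    also have "\<dots> = card ?U ^ 2 * card (trees_on ?U)" by (simp add: card_cartesian_product power2_eq_square)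
    finally show ?thesis using True by simp
  next
    case False
    then have "{T \<in> trees_on V. pendant V F c W T \<and> pendant V F c W' T} = {}" using key by blast
    from arg_cong[OF this, of card] show ?thesis using False by simp
  qed
qed

text \<open>Cauchy-Schwarz over the trees with a pendant copy: the square of the first moment is at
  most their number times the second moment. Here \<open>a\<close> is a lower bound for the first
  moment \<open>m\<close>, and \<open>p\<close> bounds the contribution of ordered pairs of distinct
  pendant sets.\<close>

lemma card_exists_pendant_ge:
  assumes h: "h \<ge> 1" "2 * h < card V"
  defines "n \<equiv> card V"
  defines "a \<equiv> real (n choose h) * real (n - h) * real (n - h) ^ (n - h - 2)"
    and "p \<equiv> real (n choose h) * real ((n - h) choose h) * real (n - 2 * h) ^ 2 * real (n - 2 * h) ^ (n - 2 * h - 2)"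
  shows "real (card {T \<in> trees_on V. \<exists>W\<subseteq>V. card W = h \<and> pendant V F c W T}) \<ge> a ^ 2 / (a + p)"
proof -
  define S where "S = {W. W \<subseteq> V \<and> card W = h}"
  have finS: "finite S" using fin by (simp add: S_def)
  have cS: "card S = n choose h" unfolding S_def n_def using n_subsets[OF fin] .
  have finT: "finite (trees_on V)" using finite_trees_on[OF fin] .
  have cW: "card (V - W) = n - h" "V - W \<noteq> {}" if "W \<in> S" for W
  proof -
    have W: "W \<subseteq> V" "card W = h" using that by (auto simp: S_def)
    then have "finite W" using fin finite_subset by blast
    then show c: "card (V - W) = n - h" using W by (simp add: card_Diff_subset n_def)
    have "card (V - W) > 0" unfolding c using h by (simp add: n_def)
    then show "V - W \<noteq> {}" by (metis card_gt_0_iff)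
  qed
  define X where "X = (\<lambda>T. card {W \<in> S. pendant V F c W T})"
  define Pos where "Pos = {T \<in> trees_on V. \<exists>W\<subseteq>V. card W = h \<and> pendant V F c W T}"
  have X0: "X T = 0" if "T \<in> trees_on V - Pos" for T
  proof -
    have "{W \<in> S. pendant V F c W T} = {}" using that by (auto simp: Pos_def S_def)
    from arg_cong[OF this, of card] show ?thesis by (simp add: X_def)
  qed
  have Xsum: "real (X T) = (\<Sum>W\<in>S. if pendant V F c W T then 1 else 0)" for T
    using finS by (simp add: X_def sum.If_cases Int_def)
  define P where "P = (\<lambda>W W'. real (card {T \<in> trees_on V. pendant V F c W T \<and> pendant V F c W' T}))"
  have sumX: "(\<Sum>T\<in>trees_on V. real (X T)) = (\<Sum>W\<in>S. P W W)"
  proof -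
    have "(\<Sum>T\<in>trees_on V. real (X T)) = (\<Sum>W\<in>S. \<Sum>T\<in>trees_on V. if pendant V F c W T then 1 else 0)"
      unfolding Xsum by (rule sum.swap)
    also have "\<dots> = (\<Sum>W\<in>S. P W W)"
      using finT by (intro sum.cong) (simp_all add: P_def sum.If_cases Int_def)
    finally show ?thesis .
  qed
  have sumX2: "(\<Sum>T\<in>trees_on V. real (X T) ^ 2) = (\<Sum>W\<in>S. \<Sum>W'\<in>S. P W W')"
  proof -
    have "real (X T) ^ 2 = (\<Sum>W\<in>S. \<Sum>W'\<in>S. if pendant V F c W T \<and> pendant V F c W' T then 1 else 0)" for T
      unfolding power2_eq_square Xsum sum_product by (intro sum.cong) auto
    then have "(\<Sum>T\<in>trees_on V. real (X T) ^ 2) =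
       (\<Sum>T\<in>trees_on V. \<Sum>W\<in>S. \<Sum>W'\<in>S. if pendant V F c W T \<and> pendant V F c W' T then 1 else 0)" by simp
    also have "\<dots> = (\<Sum>W\<in>S. \<Sum>T\<in>trees_on V. \<Sum>W'\<in>S. if pendant V F c W T \<and> pendant V F c W' T then 1 else 0)"
      by (rule sum.swap)
    also have "\<dots> = (\<Sum>W\<in>S. \<Sum>W'\<in>S. \<Sum>T\<in>trees_on V. if pendant V F c W T \<and> pendant V F c W' T then 1 else 0)"
      by (intro sum.cong refl sum.swap)
    also have "\<dots> = (\<Sum>W\<in>S. \<Sum>W'\<in>S. P W W')"
      using finT by (intro sum.cong) (simp_all add: P_def sum.If_cases Int_def)
    finally show ?thesis .
  qed
  define m where "m = (\<Sum>W\<in>S. P W W)"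
  have am: "a \<le> m"
  proof -
    have "a = (\<Sum>W\<in>S. real (n - h) * real (n - h) ^ (n - h - 2))" by (simp add: a_def cS)
    also have "\<dots> \<le> m" unfolding m_def
    proof (rule sum_mono)
      fix W assume W: "W \<in> S"
      have "card (V - W) * card (trees_on (V - W)) \<le> card {T \<in> trees_on V. pendant V F c W T}"
        using W by (intro card_pendant_ge) (auto simp: S_def)
      then have "real (card (V - W) * card (trees_on (V - W))) \<le> P W W"
        unfolding P_def conj_absorb by (rule of_nat_mono)
      then show "real (n - h) * real (n - h) ^ (n - h - 2) \<le> P W W"
        using cW[OF W] fin by (simp add: card_trees_on)
    qed
    finally show ?thesis .
  qed
  have pm: "(\<Sum>W\<in>S. \<Sum>W'\<in>S. P W W') \<le> m + p"
  proof -
    have "(\<Sum>W'\<in>S. P W W') \<le> P W W + real ((n - h) choose h) * (real (n - 2 * h) ^ 2 * real (n - 2 * h) ^ (n - 2 * h - 2))" if W: "W \<in> S" for W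
    proof -
      have "(\<Sum>W'\<in>S. P W W') = P W W + (\<Sum>W'\<in>S - {W}. P W W')" using finS W by (simp add: sum.remove)
      also have "(\<Sum>W'\<in>S - {W}. P W W') \<le> (\<Sum>W'\<in>S - {W}. if W \<inter> W' = {} then real (n - 2 * h) ^ 2 * real (n - 2 * h) ^ (n - 2 * h - 2) else 0)"
      proof (rule sum_mono)
        fix W' assume W': "W' \<in> S - {W}"
        have le: "card {T \<in> trees_on V. pendant V F c W T \<and> pendant V F c W' T} \<le>
            (if W \<inter> W' = {} then card (V - W - W') ^ 2 * card (trees_on (V - W - W')) else 0)"
          using W W' h by (intro card_two_pendants_le) (auto simp: S_def)
        show "P W W' \<le> (if W \<inter> W' = {} then real (n - 2 * h) ^ 2 * real (n - 2 * h) ^ (n - 2 * h - 2) else 0)"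
        proof (cases "W \<inter> W' = {}")
          case True
          have "card (V - W - W') = card (V - W) - card W'"
            using True W' fin finite_subset by (intro card_Diff_subset) (auto simp: S_def)
          then have c2: "card (V - W - W') = n - 2 * h" using cW[OF W] W' by (simp add: S_def)
          have "card (V - W - W') > 0" unfolding c2 using h(2) by (simp add: n_def)
          then have "V - W - W' \<noteq> {}" by (metis card_gt_0_iff)
          then have "real (card (V - W - W') ^ 2 * card (trees_on (V - W - W'))) = real (n - 2 * h) ^ 2 * real (n - 2 * h) ^ (n - 2 * h - 2)"
            using fin c2 by (simp add: card_trees_on)
          then show ?thesis using le True unfolding P_def by (simp flip: of_nat_power of_nat_mult)
        qed (use le in \<open>simp add: P_def\<close>)
      qed
      also have "\<dots> = real (card {W' \<in> S - {W}. W \<inter> W' = {}}) * (real (n - 2 * h) ^ 2 * real (n - 2 * h) ^ (n - 2 * h - 2))"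
        using finS by (simp add: sum.If_cases Int_def)
      also have "\<dots> \<le> real ((n - h) choose h) * (real (n - 2 * h) ^ 2 * real (n - 2 * h) ^ (n - 2 * h - 2))"
      proof (rule mult_right_mono)
        have "{W' \<in> S - {W}. W \<inter> W' = {}} \<subseteq> {W'. W' \<subseteq> V - W \<and> card W' = h}" by (auto simp: S_def)
        then have "card {W' \<in> S - {W}. W \<inter> W' = {}} \<le> card {W'. W' \<subseteq> V - W \<and> card W' = h}"
          using fin by (intro card_mono) auto
        also have "\<dots> = (n - h) choose h" using n_subsets[of "V - W" h] fin cW[OF W] by simp
        finally show "real (card {W' \<in> S - {W}. W \<inter> W' = {}}) \<le> real ((n - h) choose h)" by simp
      qed simp
      finally show ?thesis by simp
    qed
    then have "(\<Sum>W\<in>S. \<Sum>W'\<in>S. P W W') \<le> (\<Sum>W\<in>S. P W W + real ((n - h) choose h) * (real (n - 2 * h) ^ 2 * real (n - 2 * h) ^ (n - 2 * h - 2)))"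
      by (intro sum_mono)
    also have "\<dots> = m + p" by (simp add: sum.distrib m_def p_def cS)
    finally show ?thesis .
  qed
  have "m = (\<Sum>T\<in>Pos. 1 * real (X T))"
    unfolding m_def sumX[symmetric] using X0 finT by (intro sum.mono_neutral_cong_right) (auto simp: Pos_def)
  then have "m ^ 2 \<le> (\<Sum>T\<in>Pos. 1 ^ 2) * (\<Sum>T\<in>Pos. real (X T) ^ 2)"
    using Cauchy_Schwarz_ineq_sum[of "\<lambda>_. 1" "\<lambda>T. real (X T)" Pos] by simp
  also have "(\<Sum>T\<in>Pos. real (X T) ^ 2) = (\<Sum>T\<in>trees_on V. real (X T) ^ 2)"
    using X0 finT by (intro sum.mono_neutral_cong_left) (auto simp: Pos_def)
  also have "(\<Sum>T\<in>Pos. 1 ^ 2) * \<dots> \<le> real (card Pos) * (m + p)"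
    unfolding sumX2 using pm by (simp add: mult_left_mono)
  finally have CS: "m ^ 2 \<le> real (card Pos) * (m + p)" .
  have a0: "a > 0" using h by (simp add: a_def n_def)
  have p0: "p \<ge> 0" by (simp add: p_def)
  \<comment> \<open>The quotient m^2 / (m + p) increases with m, so m may be replaced by its lower
    bound.\<close>
  have "a ^ 2 * (m + p) \<le> m ^ 2 * (a + p)"
  proof -
    have "a ^ 2 * p \<le> m ^ 2 * p" using am a0 p0 by (intro mult_right_mono power_mono) auto
    moreover have "a * m * a \<le> a * m * m" using am a0 by (intro mult_left_mono) auto
    ultimately show ?thesis by (simp add: algebra_simps power2_eq_square)
  qed
  also have "\<dots> \<le> real (card Pos) * (m + p) * (a + p)" using CS a0 p0 by (intro mult_right_mono) auto
  finally have "(m + p) * a ^ 2 \<le> (m + p) * (real (card Pos) * (a + p))" by (simp add: mult_ac)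
  then have "a ^ 2 \<le> real (card Pos) * (a + p)" using am a0 p0 by (simp add: mult_le_cancel_left)
  then show ?thesis using a0 p0 unfolding Pos_def[symmetric] by (simp add: divide_le_eq)
qed

end

text \<open>Up to the number t of all trees, \<open>a\<close> is of order \<kappa> n and
  \<open>p\<close> of order \<kappa>^2 n^2, with \<kappa> = e^(-h) / h!. So \<open>p\<close>
  dominates and agrees asymptotically with a^2 / t.\<close>

lemma second_moment_ratio_tendsto:
  assumes h: "h \<ge> 1"
  defines "a \<equiv> \<lambda>n. real (n choose h) * real (n - h) * real (n - h) ^ (n - h - 2)"
    and "p \<equiv> \<lambda>n. real (n choose h) * real ((n - h) choose h) * real (n - 2 * h) ^ 2 * real (n - 2 * h) ^ (n - 2 * h - 2)"
  shows "(\<lambda>n. a n ^ 2 / (a n + p n) / real n ^ (n - 2)) \<longlonglongrightarrow> 1"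
proof -
  define t where "t = (\<lambda>n. real n ^ (n - 2))"
  define \<alpha> where "\<alpha> = (\<lambda>n. real (n choose h) * t (n - h) / t n)"
  define \<kappa> :: real where "\<kappa> = exp (- real h) / fact h"
  have \<kappa>: "\<kappa> > 0" by (simp add: \<kappa>_def)
  have l1: "\<alpha> \<longlonglongrightarrow> \<kappa>" using choose_trees_tendsto[of h] by (simp add: \<alpha>_def \<kappa>_def t_def)
  have l2: "(\<lambda>n. \<alpha> (n - h)) \<longlonglongrightarrow> \<kappa>" using l1 by (rule filterlim_compose) (rule filterlim_minus_const_nat_at_top)
  have l3: "(\<lambda>n. 1 / (real n - real h)) \<longlonglongrightarrow> 0" by real_asymp
  have l4: "(\<lambda>n. ((real n - 2 * real h) / (real n - real h)) ^ 2) \<longlonglongrightarrow> 1" by real_asymp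
  have "(\<lambda>n. 1 / (1 / \<alpha> n * (1 / (real n - real h)) + \<alpha> (n - h) / \<alpha> n * ((real n - 2 * real h) / (real n - real h)) ^ 2))
     \<longlonglongrightarrow> 1 / (1 / \<kappa> * 0 + \<kappa> / \<kappa> * 1)"
    using \<kappa> by (intro tendsto_intros l1 l2 l3 l4) auto
  moreover have "eventually (\<lambda>n. 1 / (1 / \<alpha> n * (1 / (real n - real h)) + \<alpha> (n - h) / \<alpha> n * ((real n - 2 * real h) / (real n - real h)) ^ 2)
     = a n ^ 2 / (a n + p n) / real n ^ (n - 2)) sequentially"
    using eventually_gt_at_top[of "2 * h"]
  proof eventually_elim
    case (elim n)
    define x y where "x = real n - real h" and "y = real n - 2 * real h"
    have x: "real (n - h) = x" "x > 0" using elim by (auto simp: x_def of_nat_diff)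
    have y: "real (n - 2 * h) = y" "y > 0" using elim by (auto simp: y_def of_nat_diff)
    have tp: "t n > 0" "t (n - h) > 0" "t (n - 2 * h) > 0" using elim by (auto simp: t_def)
    have tp': "t (n - h - h) > 0" using elim by (auto simp: t_def)
    have "n choose h > 0" "(n - h) choose h > 0" using elim by (simp_all add: zero_less_binomial)
    then have \<alpha>p: "\<alpha> n > 0" "\<alpha> (n - h) > 0" using tp tp' unfolding \<alpha>_def by simp_all
    have a: "a n = \<alpha> n * x * t n" using tp by (simp add: a_def \<alpha>_def x t_def)
    have p: "p n = \<alpha> n * \<alpha> (n - h) * y ^ 2 * t n"
    proof -
      have "n - h - h = n - 2 * h" by simp
      then have eq: "\<alpha> n * \<alpha> (n - h) * t n = real (n choose h) * real ((n - h) choose h) * t (n - 2 * h)"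
        using tp by (simp add: \<alpha>_def)
      have "\<alpha> n * \<alpha> (n - h) * y ^ 2 * t n = (\<alpha> n * \<alpha> (n - h) * t n) * y ^ 2" by (simp only: mult_ac)
      also have "\<dots> = (real (n choose h) * real ((n - h) choose h) * t (n - 2 * h)) * y ^ 2" unfolding eq ..
      also have "\<dots> = p n" unfolding p_def t_def y by (simp only: mult_ac)
      finally show ?thesis by simp
    qed
    have "a n ^ 2 / (a n + p n) / t n = (\<alpha> n * x) ^ 2 / (\<alpha> n * x + \<alpha> n * \<alpha> (n - h) * y ^ 2)"
    proof -
      have "a n + p n = (\<alpha> n * x + \<alpha> n * \<alpha> (n - h) * y ^ 2) * t n" unfolding a p by (simp add: algebra_simps)
      moreover have "a n ^ 2 = (\<alpha> n * x) ^ 2 * (t n * t n)" unfolding a by (simp add: power2_eq_square)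
      ultimately show ?thesis using tp by simp
    qed
    also have "\<dots> = 1 / ((\<alpha> n * x + \<alpha> n * \<alpha> (n - h) * y ^ 2) / (\<alpha> n * x) ^ 2)" by simp
    also have "(\<alpha> n * x + \<alpha> n * \<alpha> (n - h) * y ^ 2) / (\<alpha> n * x) ^ 2 = 1 / \<alpha> n * (1 / x) + \<alpha> (n - h) / \<alpha> n * (y / x) ^ 2"
      using \<alpha>p x(2) by (simp add: field_simps power2_eq_square)
    finally show ?case by (simp add: x_def y_def t_def)
  qed
  ultimately have "(\<lambda>n. a n ^ 2 / (a n + p n) / real n ^ (n - 2)) \<longlonglongrightarrow> 1 / (1 / \<kappa> * 0 + \<kappa> / \<kappa> * 1)"
    by (rule Lim_transform_eventually)
  then show ?thesis using \<kappa> by simp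
qed

text \<open>Almost every tree has a pendant copy of the universal tree and hence its type. The bound
  \<open>\<rho>\<close> depends on the number of vertices only, so that it applies to every vertex
  set that a giant component may have.\<close>

theorem tree_zero_one:
  "\<exists>\<tau> \<rho>. \<rho> \<longlonglongrightarrow> (1 :: real) \<and> (\<forall>V :: nat set. finite V \<longrightarrow>
     real (card {T \<in> trees_on V. tp k V T [] = \<tau>}) \<ge> \<rho> (card V) * real (card (trees_on V)))"
proof -
  obtain M :: "nat set" and E c where M: "finite M" "E \<in> trees_on M" "c \<in> M" and
    univ: "\<And>g (V' :: nat set) E' v. inj_on g M \<Longrightarrow> finite V' \<Longrightarrow> E' \<in> trees_on V' \<Longrightarrow> v \<in> V' \<Longrightarrow> V' \<inter> g ` M = {} \<Longrightarrow>
        tp k (g ` M \<union> V') (insert {v, g c} (E' \<union> (`) g ` E)) [] = tp k M E []"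
    using universal_tree[of k] by blast
  define h where "h = card M"
  have h: "h \<ge> 1" using M by (auto simp: h_def Suc_le_eq card_gt_0_iff)
  define a where "a = (\<lambda>n. real (n choose h) * real (n - h) * real (n - h) ^ (n - h - 2))"
  define p where "p = (\<lambda>n. real (n choose h) * real ((n - h) choose h) * real (n - 2 * h) ^ 2 * real (n - 2 * h) ^ (n - 2 * h - 2))"
  define \<rho> where "\<rho> = (\<lambda>n. if 2 * h < n then a n ^ 2 / (a n + p n) / real n ^ (n - 2) else 0)"
  have lim: "\<rho> \<longlonglongrightarrow> 1"
  proof -
    have "eventually (\<lambda>n. a n ^ 2 / (a n + p n) / real n ^ (n - 2) = \<rho> n) sequentially"
      using eventually_gt_at_top[of "2 * h"] by eventually_elim (simp add: \<rho>_def)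
    then show ?thesis using second_moment_ratio_tendsto[OF h] unfolding a_def p_def
      by (rule Lim_transform_eventually[rotated])
  qed
  \<comment> \<open>Any bijection will do, because \<open>univ\<close> holds for every embedding of
    \<open>M\<close>.\<close>
  define g where "g = (\<lambda>W :: nat set. SOME g. bij_betw g M W)"
  define F where "F = (\<lambda>W. (`) (g W) ` E)"
  define d where "d = (\<lambda>W. g W c)"
  have "real (card {T \<in> trees_on V. tp k V T [] = tp k M E []}) \<ge> \<rho> (card V) * real (card (trees_on V))"
    if fin: "finite V" for V :: "nat set"
  proof (cases "2 * h < card V")
    case True
    have g: "bij_betw (g W) M W" if "W \<subseteq> V" "card W = h" for W
    proof -
      have "finite W" using that fin finite_subset by blast
      then have "\<exists>g. bij_betw g M W" using M(1) that(2) by (intro finite_same_card_bij) (auto simp: h_def)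
      then show ?thesis unfolding g_def by (rule someI_ex)
    qed
    have F: "F W \<in> trees_on W \<and> d W \<in> W" if "W \<subseteq> V" "card W = h" for W
      using trees_on_image[of "g W" M E] g[OF that] M by (auto simp: F_def d_def bij_betw_def)
    have "V \<noteq> {}" using True by auto
    have "{T \<in> trees_on V. \<exists>W\<subseteq>V. card W = h \<and> pendant V F d W T} \<subseteq> {T \<in> trees_on V. tp k V T [] = tp k M E []}"
    proof clarify
      fix T W assume T: "T \<in> trees_on V" and W: "W \<subseteq> V" "h = card W" and pd: "pendant V F d W T"
      obtain v where v: "v \<in> V - W" "T \<inter> Pow W = F W" "{e \<in> T. cross W e} = {{v, d W}}"
        using pd by (auto simp: pendant_def)
      have dW: "d W \<in> W" using F W by auto
      have cr: "{e \<in> T. cross W e} = {{d W, v}}" using v(3) by (simp add: insert_commute)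
      have "v \<notin> W" using v(1) by simp
      note s = split_tree_both[OF T W(1) cr dW this]
      have gW: "inj_on (g W) M" "g W ` M = W" using g[OF W(1)] W(2) by (auto simp: bij_betw_def)
      have "T = insert {d W, v} (F W \<union> (T \<inter> Pow (V - W)))" using s(3) unfolding v(2) .
      then have Teq: "T = insert {v, g W c} ((T \<inter> Pow (V - W)) \<union> (`) (g W) ` E)"
        by (simp add: d_def F_def insert_commute Un_commute)
      have "tp k (g W ` M \<union> (V - W)) (insert {v, g W c} ((T \<inter> Pow (V - W)) \<union> (`) (g W) ` E)) [] = tp k M E []"
        using gW fin s(2) v(1) by (intro univ) auto
      then show "tp k V T [] = tp k M E []" unfolding Teq[symmetric] gW(2) using W(1) by (simp add: Un_absorb1)
    qed
    then have "real (card {T \<in> trees_on V. \<exists>W\<subseteq>V. card W = h \<and> pendant V F d W T}) \<le> real (card {T \<in> trees_on V. tp k V T [] = tp k M E []})"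
      using finite_trees_on[OF fin] by (intro of_nat_mono card_mono) auto
    moreover have "a (card V) ^ 2 / (a (card V) + p (card V)) \<le> real (card {T \<in> trees_on V. \<exists>W\<subseteq>V. card W = h \<and> pendant V F d W T})"
      unfolding a_def p_def by (rule card_exists_pendant_ge[OF fin F h True])
    moreover have "\<rho> (card V) * real (card (trees_on V)) = a (card V) ^ 2 / (a (card V) + p (card V))"
      using True card_trees_on[OF fin \<open>V \<noteq> {}\<close>] by (auto simp: \<rho>_def)
    ultimately show ?thesis by simp
  qed (simp add: \<rho>_def)
  then show ?thesis using lim by blast
qed

section \<open>The limit law for random forests\<close>

definition forest_count :: "nat \<Rightarrow> nat" where
  "forest_count n = card (forests_on {1..n})"

definition iso_invariant :: "('a set \<Rightarrow> 'a set set \<Rightarrow> bool) \<Rightarrow> bool" where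
  "iso_invariant Q \<longleftrightarrow> (\<forall>g V E. finite V \<longrightarrow> inj_on g V \<longrightarrow> E \<in> forests_on V \<longrightarrow> (Q (g ` V) ((`) g ` E) \<longleftrightarrow> Q V E))"

lemma card_forests_on_invariant:
  fixes V :: "nat set"
  assumes "iso_invariant Q" "finite V"
  shows "card {E \<in> forests_on V. Q V E} = card {E \<in> forests_on {1..card V}. Q {1..card V} E}"
proof -
  obtain g where "bij_betw g {1..card V} V"
    using finite_same_card_bij[of "{1..card V}" V] assms(2) by auto
  then have g: "inj_on g {1..card V}" "g ` {1..card V} = V" by (auto simp: bij_betw_def)
  have "card {E \<in> forests_on V. Q V E} = card {E \<in> forests_on {1..card V}. Q (g ` {1..card V}) ((`) g ` E)}"
    using card_forests_on_image[OF g(1), of "Q V"] unfolding g(2) .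
  also have "{E \<in> forests_on {1..card V}. Q (g ` {1..card V}) ((`) g ` E)} = {E \<in> forests_on {1..card V}. Q {1..card V} E}"
    using assms(1) g(1) unfolding iso_invariant_def by (intro Collect_cong conj_cong refl) simp
  finally show ?thesis .
qed

lemma card_forests_on_count: "finite (V :: nat set) \<Longrightarrow> card (forests_on V) = forest_count (card V)"
  using card_forests_on_invariant[of "\<lambda>_ _. True" V] by (simp add: iso_invariant_def forest_count_def)

lemma forest_count_0 [simp]: "forest_count 0 = 1"
  by (simp add: forest_count_def)

lemma forest_count_pos: "forest_count n > 0"
proof -
  have "{} \<in> forests_on {1..n}" by (simp add: forests_on_def acyclic_edges_def)
  then show ?thesis unfolding forest_count_def using finite_forests_on[of "{1..n}"] card_gt_0_iff by blast
qed

text \<open>The index k counts the companions of the vertex n+1 in its component.\<close>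

lemma forest_count_Suc:
  "forest_count (Suc n) = (\<Sum>k\<le>n. (n choose k) * (Suc k ^ (Suc k - 2) * forest_count (n - k)))"
proof -
  let ?V = "{1..Suc n}"
  have "forest_count (Suc n) = (\<Sum>C | Suc n \<in> C \<and> C \<subseteq> ?V. card (trees_on C) * card (forests_on (?V - C)))"
    unfolding forest_count_def by (rule card_forests_on_rec) auto
  also have "\<dots> = (\<Sum>D\<in>Pow {1..n}. card (trees_on (insert (Suc n) D)) * card (forests_on (?V - insert (Suc n) D)))"
  proof (rule sum.reindex_bij_witness[of _ "insert (Suc n)" "\<lambda>C. C - {Suc n}"])
    fix C assume "C \<in> {C. Suc n \<in> C \<and> C \<subseteq> ?V}"
    then have C: "Suc n \<in> C" "C \<subseteq> ?V" by auto
    then show i: "insert (Suc n) (C - {Suc n}) = C" by blast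
    have "x \<in> {1..n}" if "x \<in> C - {Suc n}" for x using that C(2) by (fastforce simp: le_Suc_eq)
    then show "C - {Suc n} \<in> Pow {1..n}" by blast
    show "card (trees_on (insert (Suc n) (C - {Suc n}))) * card (forests_on (?V - insert (Suc n) (C - {Suc n}))) =
        card (trees_on C) * card (forests_on (?V - C))" unfolding i ..
  next
    fix D assume "D \<in> Pow {1..n}"
    then have D: "D \<subseteq> {1..n}" by simp
    then show "insert (Suc n) D - {Suc n} = D" by fastforce
    show "insert (Suc n) D \<in> {C. Suc n \<in> C \<and> C \<subseteq> ?V}" using D by fastforce
  qed
  also have "\<dots> = (\<Sum>D\<in>Pow {1..n}. Suc (card D) ^ (Suc (card D) - 2) * forest_count (n - card D))"
  proof (rule sum.cong[OF refl])
    fix D assume "D \<in> Pow {1..n}"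
    then have D: "D \<subseteq> {1..n}" "finite D" using finite_subset by auto
    then have nD: "Suc n \<notin> D" by fastforce
    have c: "card (insert (Suc n) D) = Suc (card D)" using D nD by simp
    have "card (?V - insert (Suc n) D) = card ?V - card (insert (Suc n) D)"
      using D by (intro card_Diff_subset) auto
    then have "card (?V - insert (Suc n) D) = n - card D" using c by simp
    then show "card (trees_on (insert (Suc n) D)) * card (forests_on (?V - insert (Suc n) D)) =
        Suc (card D) ^ (Suc (card D) - 2) * forest_count (n - card D)"
      using cayley[of "insert (Suc n) D"] c D by (simp add: card_forests_on_count)
  qed
  also have "\<dots> = (\<Sum>k\<le>n. (n choose k) * (Suc k ^ (Suc k - 2) * forest_count (n - k)))"
    using sum_Pow_card[of "{1..n}" "\<lambda>k. Suc k ^ (Suc k - 2) * forest_count (n - k)"] by simp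
  finally show ?thesis .
qed

text \<open>\<open>m\<close> is the number of admissible labelled forests on \<open>{1..j}\<close>.
  Together with e^(-j), the factor 1/j! is the limit in \<open>choose_trees_tendsto\<close>.\<close>

definition fragment_weight :: "nat \<Rightarrow> nat \<Rightarrow> real" where
  "fragment_weight j m = exp (- 1 / 2) * exp (- real j) * real m / fact j"

definition forest_weight :: "nat \<Rightarrow> real" where
  "forest_weight n = real (forest_count n) * exp (- real n) / fact n"

lemma forest_weight_0: "forest_weight 0 = 1"
  by (simp add: forest_weight_def)

text \<open>The factor n turns the binomial sum over the component of one vertex into a convolution
  of weights.\<close>

lemma forest_weight_rec:
  assumes "n \<ge> 1"
  shows "real n * forest_weight n = (\<Sum>k=1..n. rooted_weight k * forest_weight (n - k))"
proof -
  obtain m where n: "n = Suc m" using assms by (cases n) auto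
  have "real n * forest_weight n = real (forest_count (Suc m)) * exp (- real (Suc m)) / fact m"
    unfolding n forest_weight_def by (simp add: field_simps del: of_nat_Suc)
  also have "\<dots> = (\<Sum>k\<le>m. real (m choose k) * (real (Suc k ^ (Suc k - 2)) * real (forest_count (m - k))) * exp (- real (Suc m)) / fact m)"
    unfolding forest_count_Suc of_nat_sum of_nat_mult sum_distrib_right sum_divide_distrib ..
  also have "\<dots> = (\<Sum>k\<le>m. rooted_weight (Suc k) * forest_weight (m - k))"
  proof (rule sum.cong[OF refl])
    fix k assume k: "k \<in> {..m}"
    have e: "exp (- real (Suc m)) = exp (- real (Suc k)) * exp (- real (m - k))"
      using k by (simp add: exp_add[symmetric] of_nat_diff)
    have b: "real (m choose k) = fact m / (fact k * fact (m - k))" using k by (intro binomial_fact) auto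
    have r: "rooted_weight (Suc k) = real (Suc k ^ (Suc k - 2)) * exp (- real (Suc k)) / fact k"
      unfolding rooted_weight_def tree_weight_def by (simp add: field_simps del: of_nat_Suc of_nat_power)
    show "real (m choose k) * (real (Suc k ^ (Suc k - 2)) * real (forest_count (m - k))) * exp (- real (Suc m)) / fact m =
        rooted_weight (Suc k) * forest_weight (m - k)"
      unfolding e b r forest_weight_def by (simp add: field_simps del: of_nat_Suc of_nat_power of_nat_diff)
  qed
  also have "\<dots> = (\<Sum>k=1..n. rooted_weight k * forest_weight (n - k))"
    unfolding n by (rule sum.reindex_bij_witness[of _ "\<lambda>k. k - 1" Suc]) auto
  finally show ?thesis .
qed

text \<open>The forest weights sum to e^(1/2), which cancels the leading factor. So no mass escapes
  to unbounded fragments.\<close>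

lemma fragment_weight_total: "(\<lambda>j. fragment_weight j (forest_count j)) sums 1"
proof -
  have "forest_weight sums exp (1 / 2)"
    by (rule forest_weight_sums[OF forest_weight_0 forest_weight_rec])
  then have "(\<lambda>j. exp (- 1 / 2) * forest_weight j) sums (exp (- 1 / 2) * exp (1 / 2))" by (rule sums_mult)
  moreover have "exp (- 1 / 2) * exp (1 / 2) = (1 :: real)" by (simp add: exp_minus)
  moreover have "(\<lambda>j. exp (- 1 / 2) * forest_weight j) = (\<lambda>j. fragment_weight j (forest_count j))"
    by (simp add: fun_eq_iff fragment_weight_def forest_weight_def)
  ultimately show ?thesis by simp
qed

lemma choose_trees_forests_tendsto:
  "(\<lambda>n. real (n choose j) * real (n - j) ^ (n - j - 2) / real (forest_count n)) \<longlonglongrightarrow> exp (- 1 / 2) * exp (- real j) / fact j"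
proof -
  have "(\<lambda>n. forest_weight n / tree_weight n) \<longlonglongrightarrow> exp (1 / 2)"
    by (rule forest_tree_ratio[OF forest_weight_0 forest_weight_rec])
  then have "(\<lambda>n. real (n choose j) * real (n - j) ^ (n - j - 2) / real n ^ (n - 2) / (forest_weight n / tree_weight n))
     \<longlonglongrightarrow> exp (- real j) / fact j / exp (1 / 2)"
    by (intro tendsto_divide choose_trees_tendsto) auto
  moreover have "eventually (\<lambda>n. real (n choose j) * real (n - j) ^ (n - j - 2) / real n ^ (n - 2) / (forest_weight n / tree_weight n) =
     real (n choose j) * real (n - j) ^ (n - j - 2) / real (forest_count n)) sequentially"
    using eventually_ge_at_top[of 1]
  proof eventually_elim
    case (elim n)
    have "forest_weight n / tree_weight n = real (forest_count n) / real n ^ (n - 2)"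
      using elim by (simp add: forest_weight_def tree_weight_def)
    then show ?case using elim by simp
  qed
  ultimately have "(\<lambda>n. real (n choose j) * real (n - j) ^ (n - j - 2) / real (forest_count n)) \<longlonglongrightarrow> exp (- real j) / fact j / exp (1 / 2)"
    by (rule Lim_transform_eventually)
  moreover have "exp (- real j) / fact j / exp (1 / 2) = exp (- 1 / 2) * exp (- real j) / fact j"
    by (simp add: exp_minus field_simps)
  ultimately show ?thesis by simp
qed

definition forest_property_prob :: "(nat graph \<Rightarrow> bool) \<Rightarrow> nat \<Rightarrow> real" where
  "forest_property_prob \<Phi> n = card {G \<in> forests n. \<Phi> G} / card (forests n)"

lemma card_forests_property: "card {G \<in> forests n. \<Phi> G} = card {E \<in> forests_on {1..n}. \<Phi> ({1..n}, E)}"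
proof -
  have "{G \<in> forests n. \<Phi> G} = Pair {1..n} ` {E \<in> forests_on {1..n}. \<Phi> ({1..n}, E)}"
    unfolding forests_eq by auto
  then show ?thesis by (simp add: card_image inj_on_def)
qed

lemma card_forests: "card (forests n) = forest_count n"
  unfolding forests_eq forest_count_def by (simp add: card_image inj_on_def)

text \<open>For each set \<open>W\<close> of fewer than \<open>J\<close> vertices,
  \<open>B W\<close> collects the forests in which the complement of \<open>W\<close> carries a good
  tree component and \<open>W\<close> a forest with property \<open>Q\<close>. These events are
  disjoint and imply \<Phi>, so their sizes add up.\<close>

lemma forest_property_prob_ge:
  assumes good: "\<And>U :: nat set. finite U \<Longrightarrow> real (card {T \<in> trees_on U. good U T}) \<ge> \<rho> (card U) * real (card (trees_on U))"
    and A: "\<And>W :: nat set. finite W \<Longrightarrow> card {H \<in> forests_on W. Q W H} = A (card W)"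
    and imp: "\<And>U W T H. card W < J \<Longrightarrow> n - J < card U \<Longrightarrow> finite U \<Longrightarrow> finite W \<Longrightarrow> U \<inter> W = {} \<Longrightarrow> T \<in> trees_on U \<Longrightarrow> good U T \<Longrightarrow>
      H \<in> forests_on W \<Longrightarrow> Q W H \<Longrightarrow> \<Phi> (U \<union> W, T \<union> H)"
    and n: "2 * J < n"
  shows "forest_property_prob \<Phi> n \<ge> (\<Sum>j<J. real (n choose j) * real (n - j) ^ (n - j - 2) / real (forest_count n) * (\<rho> (n - j) * real (A j)))"
proof -
  let ?V = "{1..n}"
  define S where "S = {W. W \<subseteq> ?V \<and> card W < J}"
  have finS: "finite S" by (simp add: S_def)
  have finW: "finite W" if "W \<in> S" for W using that finite_subset by (auto simp: S_def)
  define B where "B = (\<lambda>W. {E \<in> forests_on ?V. (\<forall>e\<in>E. \<not> cross (?V - W) e) \<and> connected_on (?V - W) (E \<inter> Pow (?V - W)) \<and>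
       good (?V - W) (E \<inter> Pow (?V - W)) \<and> Q W (E \<inter> Pow (?V - (?V - W)))})"
  have VW: "?V - (?V - W) = W" "card (?V - W) = n - card W" "?V - W \<noteq> {}" "?V - W \<union> W = ?V" if W: "W \<in> S" for W
  proof -
    have w: "W \<subseteq> ?V" "card W < J" using W by (auto simp: S_def)
    then show "?V - (?V - W) = W" "?V - W \<union> W = ?V" by auto
    show c: "card (?V - W) = n - card W" using w finW[OF W] by (simp add: card_Diff_subset)
    have "card (?V - W) > 0" unfolding c using w(2) n by simp
    then show "?V - W \<noteq> {}" by (metis card_gt_0_iff)
  qed
  have cB: "real (card (B W)) \<ge> real (n - card W) ^ (n - card W - 2) * (\<rho> (n - card W) * real (A (card W)))" if W: "W \<in> S" for W
  proof -
    have "card (B W) = card {E1 \<in> trees_on (?V - W). good (?V - W) E1} * card {E2 \<in> forests_on (?V - (?V - W)). Q W E2}"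
      unfolding B_def by (rule card_forests_on_component) auto
    also have "\<dots> = card {E1 \<in> trees_on (?V - W). good (?V - W) E1} * A (card W)"
      using A[OF finW[OF W]] by (simp only: VW(1)[OF W])
    finally have cBW: "real (card (B W)) = real (card {E1 \<in> trees_on (?V - W). good (?V - W) E1}) * real (A (card W))" by simp
    have "\<rho> (n - card W) * real (n - card W) ^ (n - card W - 2) \<le> real (card {E1 \<in> trees_on (?V - W). good (?V - W) E1})"
      using good[of "?V - W"] card_trees_on[of "?V - W"] VW[OF W] by simp
    from mult_right_mono[OF this, of "real (A (card W))"] cBW show ?thesis by (simp add: mult_ac)
  qed
  \<comment> \<open>Because n > 2J, two sets \<open>W\<close> and \<open>W'\<close> do not exhaust
    the vertices. A vertex outside both would have both complements as its component.\<close>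
  have disj: "B W \<inter> B W' = {}" if W: "W \<in> S" "W' \<in> S" "W \<noteq> W'" for W W'
  proof (rule ccontr)
    assume "B W \<inter> B W' \<noteq> {}"
    then obtain E where E: "E \<in> B W" "E \<in> B W'" by blast
    have "card (W \<union> W') \<le> card W + card W'" by (rule card_Un_le)
    also have "\<dots> < card ?V" using W n by (simp add: S_def)
    finally have "\<not> ?V \<subseteq> W \<union> W'" using finW W card_mono[of "W \<union> W'" ?V] by auto
    then obtain x where x: "x \<in> ?V - W" "x \<in> ?V - W'" by blast
    have "?V - W \<subseteq> ?V - W'" using E x by (intro component_subset[of "?V - W" E "?V - W'" x]) (auto simp: B_def)
    moreover have "?V - W' \<subseteq> ?V - W" using E x by (intro component_subset[of "?V - W'" E "?V - W" x]) (auto simp: B_def)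
    ultimately have "?V - W = ?V - W'" by blast
    then show False using VW(1)[OF W(1)] VW(1)[OF W(2)] W(3) by metis
  qed
  have sub: "(\<Union>W\<in>S. B W) \<subseteq> {E \<in> forests_on ?V. \<Phi> (?V, E)}"
  proof
    fix E assume "E \<in> (\<Union>W\<in>S. B W)"
    then obtain W where W: "W \<in> S" "E \<in> B W" by blast
    define T H where "T = E \<inter> Pow (?V - W)" and "H = E \<inter> Pow W"
    have Ef: "E \<in> forests_on ?V" using W(2) by (simp add: B_def)
    have sf: "E \<inter> Pow X \<in> forests_on X" for X
      using Ef edges_on_Int_Pow[OF forests_on_edges[OF Ef]] by (auto simp: forests_on_def intro: acyclic_edges_mono)
    have T: "T \<in> trees_on (?V - W)" "good (?V - W) T" using W(2) sf[of "?V - W"] by (simp_all add: B_def T_def trees_on_def)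
    have H: "H \<in> forests_on W" "Q W H" using W(2) sf[of W] unfolding H_def B_def VW(1)[OF W(1)] by simp_all
    have "{e \<in> E. cross (?V - W) e} = {}" using W(2) by (auto simp: B_def)
    from split_edges[OF forests_on_edges[OF Ef] this] have EU: "E = T \<union> H"
      unfolding T_def H_def VW(1)[OF W(1)] by simp
    have "\<Phi> (?V - W \<union> W, T \<union> H)"
      using VW(2)[OF W(1)] W(1) n finW[OF W(1)] T H by (intro imp) (auto simp: S_def)
    then show "E \<in> {E \<in> forests_on ?V. \<Phi> (?V, E)}" using Ef EU VW(4)[OF W(1)] by simp
  qed
  have "(\<Sum>j<J. real (n choose j) * real (n - j) ^ (n - j - 2) * (\<rho> (n - j) * real (A j))) =
     (\<Sum>j<J. \<Sum>W\<in>{W \<in> S. card W = j}. real (n - card W) ^ (n - card W - 2) * (\<rho> (n - card W) * real (A (card W))))"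
  proof (rule sum.cong[OF refl])
    fix j assume j: "j \<in> {..<J}"
    have "{W \<in> S. card W = j} = {W. W \<subseteq> ?V \<and> card W = j}" using j by (auto simp: S_def)
    then have "card {W \<in> S. card W = j} = n choose j" using n_subsets[of ?V j] by simp
    then show "real (n choose j) * real (n - j) ^ (n - j - 2) * (\<rho> (n - j) * real (A j)) =
       (\<Sum>W\<in>{W \<in> S. card W = j}. real (n - card W) ^ (n - card W - 2) * (\<rho> (n - card W) * real (A (card W))))"
      by simp
  qed
  also have "\<dots> = (\<Sum>W\<in>S. real (n - card W) ^ (n - card W - 2) * (\<rho> (n - card W) * real (A (card W))))"
    by (rule sum.group[OF finS]) (auto simp: S_def)
  also have "\<dots> \<le> (\<Sum>W\<in>S. real (card (B W)))" by (intro sum_mono cB)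
  also have "\<dots> = real (card (\<Union>W\<in>S. B W))"
    using finS disj finite_forests_on[of ?V] by (subst card_UN_disjoint) (auto simp: B_def)
  also have "\<dots> \<le> real (card {E \<in> forests_on ?V. \<Phi> (?V, E)})"
    using sub finite_forests_on[of ?V] by (intro of_nat_mono card_mono) auto
  finally have "(\<Sum>j<J. real (n choose j) * real (n - j) ^ (n - j - 2) * (\<rho> (n - j) * real (A j))) / real (forest_count n) \<le> forest_property_prob \<Phi> n"
    unfolding forest_property_prob_def card_forests_property card_forests by (intro divide_right_mono) auto
  then show ?thesis by (simp add: sum_divide_distrib)
qed

text \<open>Finitely many fragment sizes already bring the sum above \<open>a\<close>, and in a
  finite sum the limit can be taken termwise.\<close>

lemma forest_property_prob_liminf:
  assumes \<rho>: "\<rho> \<longlonglongrightarrow> 1"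
    and good: "\<And>U :: nat set. finite U \<Longrightarrow> real (card {T \<in> trees_on U. good U T}) \<ge> \<rho> (card U) * real (card (trees_on U))"
    and A: "\<And>W :: nat set. finite W \<Longrightarrow> card {H \<in> forests_on W. Q W H} = A (card W)"
    and imp: "\<And>U W T H. N < card U \<Longrightarrow> finite U \<Longrightarrow> finite W \<Longrightarrow> U \<inter> W = {} \<Longrightarrow> T \<in> trees_on U \<Longrightarrow> good U T \<Longrightarrow>
      H \<in> forests_on W \<Longrightarrow> Q W H \<Longrightarrow> \<Phi> (U \<union> W, T \<union> H)"
    and \<alpha>: "(\<lambda>j. fragment_weight j (A j)) sums \<alpha>" "a < \<alpha>"
  shows "eventually (\<lambda>n. a < forest_property_prob \<Phi> n) sequentially"
proof -
  have "eventually (\<lambda>J. a < (\<Sum>j<J. fragment_weight j (A j))) sequentially"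
    using \<alpha> unfolding sums_def by (rule order_tendstoD(1))
  then obtain J where J: "a < (\<Sum>j<J. fragment_weight j (A j))"
    by (auto simp: eventually_sequentially)
  have "(\<lambda>n. \<Sum>j<J. real (n choose j) * real (n - j) ^ (n - j - 2) / real (forest_count n) * (\<rho> (n - j) * real (A j)))
    \<longlonglongrightarrow> (\<Sum>j<J. exp (- 1 / 2) * exp (- real j) / fact j * (1 * real (A j)))"
  proof (intro tendsto_sum tendsto_mult choose_trees_forests_tendsto tendsto_const)
    show "(\<lambda>n. \<rho> (n - j)) \<longlonglongrightarrow> 1" for j
      using \<rho> by (rule filterlim_compose) (rule filterlim_minus_const_nat_at_top)
  qed
  moreover have "(\<Sum>j<J. exp (- 1 / 2) * exp (- real j) / fact j * (1 * real (A j))) = (\<Sum>j<J. fragment_weight j (A j))"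
    by (simp add: fragment_weight_def)
  ultimately have "eventually (\<lambda>n. a < (\<Sum>j<J. real (n choose j) * real (n - j) ^ (n - j - 2) / real (forest_count n) * (\<rho> (n - j) * real (A j)))) sequentially"
    using J by (intro order_tendstoD(1)) auto
  then show ?thesis using eventually_gt_at_top[of "2 * J + N"]
  proof eventually_elim
    case (elim n)
    have "(\<Sum>j<J. real (n choose j) * real (n - j) ^ (n - j - 2) / real (forest_count n) * (\<rho> (n - j) * real (A j))) \<le> forest_property_prob \<Phi> n"
    proof (rule forest_property_prob_ge[where Q = Q and good = good and A = A and \<rho> = \<rho>])
      fix U W :: "nat set" and T H
      assume "card W < J" "n - J < card U" "finite U" "finite W" "U \<inter> W = {}" "T \<in> trees_on U" "good U T"
        "H \<in> forests_on W" "Q W H"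
      then show "\<Phi> (U \<union> W, T \<union> H)" using elim by (intro imp) auto
    qed (use good A elim in auto)
    then show ?case using elim by simp
  qed
qed

text \<open>The lower bound is applied to \<Phi> and to its negation. As the two limiting sums add
  up to 1, both bounds are sharp.\<close>

theorem forest_limit_law:
  assumes \<rho>: "\<rho> \<longlonglongrightarrow> 1"
    and good: "\<And>U :: nat set. finite U \<Longrightarrow> real (card {T \<in> trees_on U. good U T}) \<ge> \<rho> (card U) * real (card (trees_on U))"
    and Q: "iso_invariant Q"
    and iff: "\<And>U W T H. N < card U \<Longrightarrow> finite U \<Longrightarrow> finite W \<Longrightarrow> U \<inter> W = {} \<Longrightarrow> T \<in> trees_on U \<Longrightarrow> good U T \<Longrightarrow>
      H \<in> forests_on W \<Longrightarrow> \<Phi> (U \<union> W, T \<union> H) \<longleftrightarrow> Q W H"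
  shows "forest_property_prob \<Phi> \<longlonglongrightarrow> (\<Sum>j. fragment_weight j (card {H \<in> forests_on {1..j}. Q {1..j} H}))"
proof -
  define A where "A = (\<lambda>j. card {H \<in> forests_on {1..j}. Q {1..j} H})"
  define A' where "A' = (\<lambda>j. card {H \<in> forests_on {1..j}. \<not> Q {1..j} H})"
  have Q': "iso_invariant (\<lambda>W H. \<not> Q W H)" using Q by (simp add: iso_invariant_def)
  have add: "fragment_weight j (A j) + fragment_weight j (A' j) = fragment_weight j (forest_count j)" for j
  proof -
    have "forests_on {1..j} = {H \<in> forests_on {1..j}. Q {1..j} H} \<union> {H \<in> forests_on {1..j}. \<not> Q {1..j} H}" by auto
    then have "forest_count j = card ({H \<in> forests_on {1..j}. Q {1..j} H} \<union> {H \<in> forests_on {1..j}. \<not> Q {1..j} H})"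
      unfolding forest_count_def by (rule arg_cong)
    also have "\<dots> = A j + A' j"
      unfolding A_def A'_def using finite_forests_on[of "{1..j}"] by (intro card_Un_disjoint) auto
    finally show ?thesis by (simp add: fragment_weight_def field_simps)
  qed
  have nn: "fragment_weight j m \<ge> 0" for j m by (simp add: fragment_weight_def)
  have tot: "summable (\<lambda>j. fragment_weight j (forest_count j))" using fragment_weight_total by (simp add: sums_iff)
  have s: "summable (\<lambda>j. fragment_weight j (A j))" "summable (\<lambda>j. fragment_weight j (A' j))"
    using nn add by (auto intro!: summable_comparison_test'[OF tot, of 0] simp flip: add)
  define \<alpha> \<alpha>' where "\<alpha> = (\<Sum>j. fragment_weight j (A j))" and "\<alpha>' = (\<Sum>j. fragment_weight j (A' j))"
  have \<alpha>: "(\<lambda>j. fragment_weight j (A j)) sums \<alpha>" "(\<lambda>j. fragment_weight j (A' j)) sums \<alpha>'"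
    using s by (simp_all add: \<alpha>_def \<alpha>'_def summable_sums)
  have "\<alpha> + \<alpha>' = 1"
    using sums_add[OF \<alpha>] fragment_weight_total unfolding add by (rule sums_unique2)
  have compl: "forest_property_prob (\<lambda>G. \<not> \<Phi> G) n = 1 - forest_property_prob \<Phi> n" for n
  proof -
    have "forests n = {G \<in> forests n. \<Phi> G} \<union> {G \<in> forests n. \<not> \<Phi> G}" by auto
    then have "card (forests n) = card ({G \<in> forests n. \<Phi> G} \<union> {G \<in> forests n. \<not> \<Phi> G})" by (rule arg_cong)
    also have "\<dots> = card {G \<in> forests n. \<Phi> G} + card {G \<in> forests n. \<not> \<Phi> G}"
      using finite_forests[of n] by (intro card_Un_disjoint) auto
    finally have "real (card {G \<in> forests n. \<not> \<Phi> G}) + real (card {G \<in> forests n. \<Phi> G}) = real (forest_count n)"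
      unfolding card_forests by simp
    then show ?thesis using forest_count_pos[of n] unfolding forest_property_prob_def card_forests
      by (simp only: eq_diff_eq add_divide_distrib[symmetric]) simp
  qed
  have "forest_property_prob \<Phi> \<longlonglongrightarrow> \<alpha>"
  proof (rule order_tendstoI)
    fix a assume "a < \<alpha>"
    show "eventually (\<lambda>n. a < forest_property_prob \<Phi> n) sequentially"
    proof (rule forest_property_prob_liminf[OF \<rho> good _ _ \<alpha>(1) \<open>a < \<alpha>\<close>])
      show "card {H \<in> forests_on W. Q W H} = A (card W)" if "finite W" for W
        using card_forests_on_invariant[OF Q that] by (simp add: A_def)
      fix U W :: "nat set" and T H
      assume "N < card U" "finite U" "finite W" "U \<inter> W = {}" "T \<in> trees_on U" "good U T" "H \<in> forests_on W" "Q W H"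
      then show "\<Phi> (U \<union> W, T \<union> H)" using iff[of U W T H] by simp
    qed
  next
    fix a assume "\<alpha> < a"
    then have a: "1 - a < \<alpha>'" using \<open>\<alpha> + \<alpha>' = 1\<close> by simp
    have "eventually (\<lambda>n. 1 - a < forest_property_prob (\<lambda>G. \<not> \<Phi> G) n) sequentially"
    proof (rule forest_property_prob_liminf[OF \<rho> good _ _ \<alpha>(2) a])
      show "card {H \<in> forests_on W. \<not> Q W H} = A' (card W)" if "finite W" for W
        using card_forests_on_invariant[OF Q' that] by (simp add: A'_def)
      fix U W :: "nat set" and T H
      assume "N < card U" "finite U" "finite W" "U \<inter> W = {}" "T \<in> trees_on U" "good U T" "H \<in> forests_on W" "\<not> Q W H"
      then show "\<not> \<Phi> (U \<union> W, T \<union> H)" using iff[of U W T H] by simp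
    qed
    then show "eventually (\<lambda>n. forest_property_prob \<Phi> n < a) sequentially"
      by eventually_elim (simp add: compl)
  qed
  then show ?thesis by (simp add: \<alpha>_def A_def)
qed

lemma forest_prob_property: "forest_prob \<phi> = forest_property_prob (\<lambda>G. G \<Turnstile> \<phi>)"
  by (simp add: fun_eq_iff forest_prob_eq forest_property_prob_def)

text \<open>The giant tree almost surely has the type \<open>\<tau>\<close>, and by composition the
  type of the whole forest then depends only on the type of the fragment.\<close>

theorem mso_limit:
  assumes "mso_sentence \<phi>"
  shows "\<exists>Q. iso_invariant Q \<and>
    forest_prob \<phi> \<longlonglongrightarrow> (\<Sum>j. fragment_weight j (card {H \<in> forests_on {1..j}. Q {1..j} H}))"
proof -
  define k where "k = quantifier_rank \<phi>"
  obtain \<tau> \<rho> where \<rho>: "\<rho> \<longlonglongrightarrow> (1 :: real)" and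
    good: "\<And>V :: nat set. finite V \<Longrightarrow> real (card {T \<in> trees_on V. tp k V T [] = \<tau>}) \<ge> \<rho> (card V) * real (card (trees_on V))"
    using tree_zero_one[of k] by blast
  \<comment> \<open>The rank-\<open>k\<close> types of fragments that satisfy \<phi> together with
    some tree of type \<open>\<tau>\<close>; by composition they do so with every such tree.\<close>
  define D where "D = {tp k W H [] | (U :: nat set) (W :: nat set) T H. finite U \<and> finite W \<and> U \<inter> W = {} \<and> T \<in> trees_on U \<and>
     H \<in> forests_on W \<and> tp k U T [] = \<tau> \<and> (U \<union> W, T \<union> H) \<Turnstile> \<phi>}"
  define Q where "Q = (\<lambda>(W :: nat set) H. tp k W H [] \<in> D)"
  have "iso_invariant Q"
    unfolding iso_invariant_def
  proof (intro allI impI)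
    fix g :: "nat \<Rightarrow> nat" and V E assume V: "finite V" "inj_on g V" "E \<in> forests_on V"
    have "tp k (g ` V) ((`) g ` E) (map ((`) g) []) = tp k V E []"
      using image_edge_iff[OF V(2) forests_on_edges[OF V(3)]] by (intro tp_image[OF V(2)]) auto
    then show "Q (g ` V) ((`) g ` E) \<longleftrightarrow> Q V E" by (simp add: Q_def)
  qed
  moreover have "forest_property_prob (\<lambda>G. G \<Turnstile> \<phi>) \<longlonglongrightarrow> (\<Sum>j. fragment_weight j (card {H \<in> forests_on {1..j}. Q {1..j} H}))"
  proof (rule forest_limit_law[OF \<rho> good \<open>iso_invariant Q\<close>, where N = 0])
    have eq: "tp k (U \<union> W) (T \<union> H) [] = tp k (U' \<union> W') (T' \<union> H') []"
      if a: "finite U" "finite W" "U \<inter> W = {}" "T \<in> trees_on U" "H \<in> forests_on W"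
        and a': "finite U'" "finite W'" "U' \<inter> W' = {}" "T' \<in> trees_on U'" "H' \<in> forests_on W'"
        and t: "tp k U T [] = tp k U' T' []" "tp k W H [] = tp k W' H' []"
      for U W U' W' :: "nat set" and T H T' H'
    proof -
      have r: "tp k U (T \<union> H) [] = tp k U T []" "tp k W (T \<union> H) [] = tp k W H []"
        "\<And>a b. a \<in> U \<Longrightarrow> b \<in> W \<Longrightarrow> {a, b} \<notin> T \<union> H"
        if a: "U \<inter> W = {}" "T \<in> trees_on U" "H \<in> forests_on W" for U W :: "nat set" and T H
      proof -
        note s = trees_on_subset[OF a(2)] forests_on_subset[OF a(3)]
        show "tp k U (T \<union> H) [] = tp k U T []"
        proof (rule tp_cong)
          fix x y assume "x \<in> U" "y \<in> U"
          then have "{x, y} \<notin> H" using s(2)[of "{x, y}"] a(1) by auto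
          then show "{x, y} \<in> T \<union> H \<longleftrightarrow> {x, y} \<in> T" by simp
        qed auto
        show "tp k W (T \<union> H) [] = tp k W H []"
        proof (rule tp_cong)
          fix x y assume "x \<in> W" "y \<in> W"
          then have "{x, y} \<notin> T" using s(1)[of "{x, y}"] a(1) by auto
          then show "{x, y} \<in> T \<union> H \<longleftrightarrow> {x, y} \<in> H" by simp
        qed auto
        fix x y assume "x \<in> U" "y \<in> W"
        then show "{x, y} \<notin> T \<union> H" using s(1)[of "{x, y}"] s(2)[of "{x, y}"] a(1) by auto
      qed
      note r1 = r[OF a(3-5)] and r2 = r[OF a'(3-5)]
      show ?thesis
        by (rule tp_Un[OF a(1,2) a'(1,2) a(3) _ a'(3)]) (use r1 r2 t in auto)
    qed
    fix U W :: "nat set" and T H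
    assume a: "finite U" "finite W" "U \<inter> W = {}" "T \<in> trees_on U" "tp k U T [] = \<tau>" "H \<in> forests_on W"
    show "(U \<union> W, T \<union> H) \<Turnstile> \<phi> \<longleftrightarrow> Q W H"
    proof
      assume "(U \<union> W, T \<union> H) \<Turnstile> \<phi>"
      then show "Q W H" unfolding Q_def D_def using a by blast
    next
      assume "Q W H"
      then obtain U' W' :: "nat set" and T' H' where b: "tp k W H [] = tp k W' H' []" "finite U'" "finite W'" "U' \<inter> W' = {}" "T' \<in> trees_on U'"
        "H' \<in> forests_on W'" "tp k U' T' [] = \<tau>" "(U' \<union> W', T' \<union> H') \<Turnstile> \<phi>"
        unfolding Q_def D_def by blast
      have "tp k (U \<union> W) (T \<union> H) [] = tp k (U' \<union> W') (T' \<union> H') []"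
        using a b by (intro eq) auto
      then show "(U \<union> W, T \<union> H) \<Turnstile> \<phi>"
        using models_tp[of "U \<union> W" "U' \<union> W'" k "T \<union> H" "T' \<union> H'" \<phi>] assms a b by (simp add: k_def)
    qed
  qed
  ultimately show ?thesis unfolding forest_prob_property by blast
qed

section \<open>Defining the small components\<close>

definition mso_true :: mso where "mso_true = Neg (ExVertex 0 (Neg (Eq 0 0)))"
definition mso_imp :: "mso \<Rightarrow> mso \<Rightarrow> mso" where "mso_imp \<phi> \<psi> = Neg (Conj \<phi> (Neg \<psi>))"
definition all_vertex :: "nat \<Rightarrow> mso \<Rightarrow> mso" where "all_vertex x \<phi> = Neg (ExVertex x (Neg \<phi>))"
definition all_set :: "nat \<Rightarrow> mso \<Rightarrow> mso" where "all_set X \<phi> = Neg (ExSet X (Neg \<phi>))"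
definition mso_conjs :: "mso list \<Rightarrow> mso" where "mso_conjs \<phi>s = foldr Conj \<phi>s mso_true"
definition mso_disjs :: "mso list \<Rightarrow> mso" where "mso_disjs \<phi>s = Neg (mso_conjs (map Neg \<phi>s))"
definition ex_vertices :: "nat list \<Rightarrow> mso \<Rightarrow> mso" where "ex_vertices xs \<phi> = foldr ExVertex xs \<phi>"

lemma sat_mso_true [simp]: "sat G v S mso_true"
  by (simp add: mso_true_def)

lemma sat_mso_imp [simp]: "sat G v S (mso_imp \<phi> \<psi>) \<longleftrightarrow> (sat G v S \<phi> \<longrightarrow> sat G v S \<psi>)"
  by (simp add: mso_imp_def)

lemma sat_all_vertex [simp]: "sat G v S (all_vertex x \<phi>) \<longleftrightarrow> (\<forall>a\<in>vertices G. sat G (v(x := a)) S \<phi>)"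
  by (simp add: all_vertex_def)

lemma sat_all_set [simp]: "sat G v S (all_set X \<phi>) \<longleftrightarrow> (\<forall>A\<subseteq>vertices G. sat G v (S(X := A)) \<phi>)"
  by (simp add: all_set_def)

lemma sat_mso_conjs [simp]: "sat G v S (mso_conjs \<phi>s) \<longleftrightarrow> (\<forall>\<phi>\<in>set \<phi>s. sat G v S \<phi>)"
  by (induction \<phi>s) (simp_all add: mso_conjs_def)

lemma sat_mso_disjs [simp]: "sat G v S (mso_disjs \<phi>s) \<longleftrightarrow> (\<exists>\<phi>\<in>set \<phi>s. sat G v S \<phi>)"
  by (simp add: mso_disjs_def)

lemma sat_ex_vertices:
  "sat G v S (ex_vertices xs \<phi>) \<longleftrightarrow>
    (\<exists>u. (\<forall>x\<in>set xs. u x \<in> vertices G) \<and> (\<forall>x. x \<notin> set xs \<longrightarrow> u x = v x) \<and> sat G u S \<phi>)"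
proof (induction xs arbitrary: v)
  case Nil
  have "(\<forall>x. u x = v x) \<longleftrightarrow> u = v" for u by auto
  then show ?case by (simp add: ex_vertices_def)
next
  case (Cons x xs)
  have "sat G v S (ex_vertices (x # xs) \<phi>) \<longleftrightarrow> (\<exists>a\<in>vertices G. \<exists>u. (\<forall>y\<in>set xs. u y \<in> vertices G) \<and>
      (\<forall>y. y \<notin> set xs \<longrightarrow> u y = (v(x := a)) y) \<and> sat G u S \<phi>)"
    using Cons.IH by (simp add: ex_vertices_def)
  also have "\<dots> \<longleftrightarrow> (\<exists>u. (\<forall>y\<in>set (x # xs). u y \<in> vertices G) \<and> (\<forall>y. y \<notin> set (x # xs) \<longrightarrow> u y = v y) \<and> sat G u S \<phi>)"
  proof
    assume "\<exists>a\<in>vertices G. \<exists>u. (\<forall>y\<in>set xs. u y \<in> vertices G) \<and> (\<forall>y. y \<notin> set xs \<longrightarrow> u y = (v(x := a)) y) \<and> sat G u S \<phi>"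
    then obtain a u where u: "a \<in> vertices G" "\<forall>y\<in>set xs. u y \<in> vertices G"
      "\<forall>y. y \<notin> set xs \<longrightarrow> u y = (v(x := a)) y" "sat G u S \<phi>" by blast
    have "u x \<in> vertices G" using u(1-3) by (cases "x \<in> set xs") auto
    moreover have "u y = v y" if "y \<notin> set (x # xs)" for y using that u(3) by auto
    ultimately show "\<exists>u. (\<forall>y\<in>set (x # xs). u y \<in> vertices G) \<and> (\<forall>y. y \<notin> set (x # xs) \<longrightarrow> u y = v y) \<and> sat G u S \<phi>"
      using u by (intro exI[of _ u]) simp
  next
    assume "\<exists>u. (\<forall>y\<in>set (x # xs). u y \<in> vertices G) \<and> (\<forall>y. y \<notin> set (x # xs) \<longrightarrow> u y = v y) \<and> sat G u S \<phi>"
    then obtain u where "\<forall>y\<in>set (x # xs). u y \<in> vertices G" "\<forall>y. y \<notin> set (x # xs) \<longrightarrow> u y = v y" "sat G u S \<phi>" by blast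
    then show "\<exists>a\<in>vertices G. \<exists>u. (\<forall>y\<in>set xs. u y \<in> vertices G) \<and> (\<forall>y. y \<notin> set xs \<longrightarrow> u y = (v(x := a)) y) \<and> sat G u S \<phi>"
      by (intro bexI[of _ "u x"] exI[of _ u]) auto
  qed
  finally show ?case .
qed

lemma free_vars_simps [simp]:
  "free_vertex_vars mso_true = {}" "free_set_vars mso_true = {}"
  "free_vertex_vars (mso_imp \<phi> \<psi>) = free_vertex_vars \<phi> \<union> free_vertex_vars \<psi>"
  "free_set_vars (mso_imp \<phi> \<psi>) = free_set_vars \<phi> \<union> free_set_vars \<psi>"
  "free_vertex_vars (all_vertex x \<phi>) = free_vertex_vars \<phi> - {x}"
  "free_set_vars (all_vertex x \<phi>) = free_set_vars \<phi>"
  "free_vertex_vars (all_set X \<phi>) = free_vertex_vars \<phi>"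
  "free_set_vars (all_set X \<phi>) = free_set_vars \<phi> - {X}"
  by (simp_all add: mso_true_def mso_imp_def all_vertex_def all_set_def)

lemma free_vars_conjs [simp]:
  "free_vertex_vars (mso_conjs \<phi>s) = (\<Union>\<phi>\<in>set \<phi>s. free_vertex_vars \<phi>)"
  "free_set_vars (mso_conjs \<phi>s) = (\<Union>\<phi>\<in>set \<phi>s. free_set_vars \<phi>)"
  by (induction \<phi>s) (simp_all add: mso_conjs_def)

lemma free_vars_disjs [simp]:
  "free_vertex_vars (mso_disjs \<phi>s) = (\<Union>\<phi>\<in>set \<phi>s. free_vertex_vars \<phi>)"
  "free_set_vars (mso_disjs \<phi>s) = (\<Union>\<phi>\<in>set \<phi>s. free_set_vars \<phi>)"
  by (simp_all add: mso_disjs_def)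

lemma free_vars_ex_vertices [simp]:
  "free_vertex_vars (ex_vertices xs \<phi>) = free_vertex_vars \<phi> - set xs"
  "free_set_vars (ex_vertices xs \<phi>) = free_set_vars \<phi>"
  by (induction xs) (auto simp: ex_vertices_def)

section \<open>A sentence for a given fragment\<close>

text \<open>The variables 1 to j name the vertices of the fragment; 0 and \<open>Suc j\<close>
  remain for auxiliary quantifiers.\<close>

definition tuple_vars :: "nat \<Rightarrow> nat list" where "tuple_vars j = [1..<Suc j]"

lemma set_tuple_vars [simp]: "set (tuple_vars j) = {1..j}"
  by (auto simp: tuple_vars_def)

definition avoids :: "nat \<Rightarrow> nat \<Rightarrow> mso" where
  "avoids j y = mso_conjs (map (\<lambda>i. Neg (Eq y i)) (tuple_vars j))"

definition induces :: "nat \<Rightarrow> nat set set \<Rightarrow> mso" where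
  "induces j H = mso_conjs (map (\<lambda>(a, b). Conj (if {a, b} \<in> H then Adj a b else Neg (Adj a b))
     (if a = b then mso_true else Neg (Eq a b))) (List.product (tuple_vars j) (tuple_vars j)))"

definition closed_tuple :: "nat \<Rightarrow> mso" where
  "closed_tuple j = mso_conjs (map (\<lambda>i. all_vertex 0 (mso_imp (Adj i 0) (Neg (avoids j 0)))) (tuple_vars j))"

text \<open>Connectivity of the vertices outside the tuple, stated by cuts. This is where the
  fragment formula quantifies over sets.\<close>

definition connected_rest :: "nat \<Rightarrow> mso" where
  "connected_rest j = all_set 0 (mso_imp
     (Conj (ExVertex 0 (Conj (avoids j 0) (Mem 0 0))) (ExVertex 0 (Conj (avoids j 0) (Neg (Mem 0 0)))))
     (ExVertex 0 (ExVertex (Suc j) (mso_conjs [avoids j 0, avoids j (Suc j), Mem 0 0, Neg (Mem (Suc j) 0), Adj 0 (Suc j)]))))"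

text \<open>On a graph with a large tree component, the formula says that the remaining components form a copy of \<open>H\<close>.\<close>

definition fragment_formula :: "nat \<Rightarrow> nat set set \<Rightarrow> mso" where
  "fragment_formula j H = ex_vertices (tuple_vars j) (mso_conjs [induces j H, closed_tuple j, connected_rest j])"

lemma sat_avoids: "sat G v S (avoids j y) \<longleftrightarrow> v y \<notin> v ` {1..j}"
  by (auto simp: avoids_def)

lemma sat_induces:
  "sat (V, E) v S (induces j H) \<longleftrightarrow>
    (\<forall>a\<in>{1..j}. \<forall>b\<in>{1..j}. ({v a, v b} \<in> E \<longleftrightarrow> {a, b} \<in> H) \<and> (a \<noteq> b \<longrightarrow> v a \<noteq> v b))"
proof -
  have "sat (V, E) v S (induces j H) \<longleftrightarrow> (\<forall>p\<in>{1..j} \<times> {1..j}. sat (V, E) v S (case p of (a, b) \<Rightarrow>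
      Conj (if {a, b} \<in> H then Adj a b else Neg (Adj a b)) (if a = b then mso_true else Neg (Eq a b))))"
    by (simp add: induces_def)
  also have "\<dots> \<longleftrightarrow> (\<forall>a\<in>{1..j}. \<forall>b\<in>{1..j}. ({v a, v b} \<in> E \<longleftrightarrow> {a, b} \<in> H) \<and> (a \<noteq> b \<longrightarrow> v a \<noteq> v b))"
    unfolding split_paired_Ball_Sigma by (intro ball_cong refl) simp
  finally show ?thesis .
qed

lemma sat_closed_tuple:
  "sat (V, E) v S (closed_tuple j) \<longleftrightarrow> (\<forall>i\<in>{1..j}. \<forall>y\<in>V. {v i, y} \<in> E \<longrightarrow> y \<in> v ` {1..j})"
proof -
  have "(v(0 := y)) ` {1..j} = v ` {1..j}" for y by (intro image_cong) auto
  then show ?thesis by (simp add: closed_tuple_def sat_avoids)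
qed

lemma sat_connected_rest:
  "sat (V, E) v S (connected_rest j) \<longleftrightarrow>
    (\<forall>Z\<subseteq>V. (\<exists>y\<in>V - v ` {1..j}. y \<in> Z) \<and> (\<exists>y\<in>V - v ` {1..j}. y \<notin> Z) \<longrightarrow>
       (\<exists>y\<in>V - v ` {1..j}. \<exists>z\<in>V - v ` {1..j}. y \<in> Z \<and> z \<notin> Z \<and> {y, z} \<in> E))"
proof -
  have 1: "(v(0 := y)) ` {1..j} = v ` {1..j}" for y by (intro image_cong) auto
  have 2: "(v(0 := y, Suc j := z)) ` {1..j} = v ` {1..j}" for y z by (intro image_cong) auto
  have "sat (V, E) v (S(0 := Z)) (ExVertex 0 (Conj (avoids j 0) (Mem 0 0))) \<longleftrightarrow> (\<exists>y\<in>V - v ` {1..j}. y \<in> Z)" for Z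
    by (auto simp: sat_avoids 1)
  moreover have "sat (V, E) v (S(0 := Z)) (ExVertex 0 (Conj (avoids j 0) (Neg (Mem 0 0)))) \<longleftrightarrow> (\<exists>y\<in>V - v ` {1..j}. y \<notin> Z)" for Z
    by (auto simp: sat_avoids 1)
  moreover have "sat (V, E) v (S(0 := Z)) (ExVertex 0 (ExVertex (Suc j)
      (mso_conjs [avoids j 0, avoids j (Suc j), Mem 0 0, Neg (Mem (Suc j) 0), Adj 0 (Suc j)]))) \<longleftrightarrow>
     (\<exists>y\<in>V - v ` {1..j}. \<exists>z\<in>V - v ` {1..j}. y \<in> Z \<and> z \<notin> Z \<and> {y, z} \<in> E)" for Z
    by (auto simp: sat_avoids 2)
  ultimately show ?thesis
    unfolding connected_rest_def sat_all_set sat_mso_imp sat.simps(5) by (simp only: fst_conv)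
qed

lemma mso_sentence_fragment_formula: "mso_sentence (fragment_formula j H)"
proof -
  have a: "free_vertex_vars (avoids j y) \<subseteq> insert y {1..j}" "free_set_vars (avoids j y) = {}" for y
    by (auto simp: avoids_def)
  have "free_vertex_vars (induces j H) \<subseteq> {1..j}" "free_set_vars (induces j H) = {}"
    by (auto simp: induces_def split: if_splits)
  moreover have "free_vertex_vars (closed_tuple j) \<subseteq> {1..j}" "free_set_vars (closed_tuple j) = {}"
    using a by (auto simp: closed_tuple_def)
  moreover have "free_vertex_vars (connected_rest j) \<subseteq> {1..j}" "free_set_vars (connected_rest j) = {}"
    using a[of 0] a[of "Suc j"] by (auto simp: connected_rest_def)
  ultimately show ?thesis by (auto simp: mso_sentence_def fragment_formula_def)
qed

text \<open>The tuple is closed under adjacency, so it contains all or nothing of the tree on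
  \<open>U\<close>, and \<open>j < card U\<close> excludes the former. Testing the connectivity of
  the rest with the cut \<open>U\<close> shows that no vertex of \<open>W\<close> is left outside
  the tuple.\<close>

lemma sat_fragment_formula:
  fixes U W :: "'a set"
  assumes UW: "finite U" "finite W" "U \<inter> W = {}" and T: "T \<in> trees_on U" and H: "H \<in> forests_on W"
    and H0: "H0 \<in> forests_on {1..j}" and j: "j < card U"
  shows "sat (U \<union> W, T \<union> H) v S (fragment_formula j H0) \<longleftrightarrow> (\<exists>g. bij_betw g {1..j} W \<and> H = (`) g ` H0)"
proof -
  note TU = trees_on_subset[OF T] and HW = forests_on_subset[OF H]
  have E: "T \<union> H \<subseteq> edges_on (U \<union> W)"
    using trees_on_edges[OF T] forests_on_edges[OF H] edges_on_mono[of U "U \<union> W"] edges_on_mono[of W "U \<union> W"] by blast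
  have nUW: "{a, b} \<notin> T \<union> H" if "a \<in> U" "b \<in> W" for a b
    using TU[of "{a, b}"] HW[of "{a, b}"] that UW(3) by auto
  have THW: "{a, b} \<in> T \<union> H \<longleftrightarrow> {a, b} \<in> H" if "a \<in> W" for a b
    using TU[of "{a, b}"] that UW(3) by auto
  have sat_iff: "sat (U \<union> W, T \<union> H) v S (fragment_formula j H0) \<longleftrightarrow>
    (\<exists>u. (\<forall>x\<in>{1..j}. u x \<in> U \<union> W) \<and> (\<forall>x. x \<notin> {1..j} \<longrightarrow> u x = v x) \<and>
      sat (U \<union> W, T \<union> H) u S (induces j H0) \<and> sat (U \<union> W, T \<union> H) u S (closed_tuple j) \<and>
      sat (U \<union> W, T \<union> H) u S (connected_rest j))"
    unfolding fragment_formula_def sat_ex_vertices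
    by simp
  show ?thesis unfolding sat_iff sat_induces sat_closed_tuple sat_connected_rest
  proof
    assume "\<exists>u. (\<forall>x\<in>{1..j}. u x \<in> U \<union> W) \<and> (\<forall>x. x \<notin> {1..j} \<longrightarrow> u x = v x) \<and>
      (\<forall>a\<in>{1..j}. \<forall>b\<in>{1..j}. ({u a, u b} \<in> T \<union> H \<longleftrightarrow> {a, b} \<in> H0) \<and> (a \<noteq> b \<longrightarrow> u a \<noteq> u b)) \<and>
      (\<forall>i\<in>{1..j}. \<forall>y\<in>U \<union> W. {u i, y} \<in> T \<union> H \<longrightarrow> y \<in> u ` {1..j}) \<and>
      (\<forall>Z\<subseteq>U \<union> W. (\<exists>y\<in>U \<union> W - u ` {1..j}. y \<in> Z) \<and> (\<exists>y\<in>U \<union> W - u ` {1..j}. y \<notin> Z) \<longrightarrow>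
        (\<exists>y\<in>U \<union> W - u ` {1..j}. \<exists>z\<in>U \<union> W - u ` {1..j}. y \<in> Z \<and> z \<notin> Z \<and> {y, z} \<in> T \<union> H))"
      (is "\<exists>u. ?P u")
    then obtain u where u0: "?P u" ..
    note u1 = u0[THEN conjunct1] and u234 = u0[THEN conjunct2, THEN conjunct2]
    note u23 = u234[THEN conjunct1] and u4 = u234[THEN conjunct2, THEN conjunct1]
      and u5 = u234[THEN conjunct2, THEN conjunct2, rule_format, OF _ conjI]
    have u2: "{u a, u b} \<in> T \<union> H \<longleftrightarrow> {a, b} \<in> H0" and u3: "a \<noteq> b \<Longrightarrow> u a \<noteq> u b" if "a \<in> {1..j}" "b \<in> {1..j}" for a b
      using bspec[OF bspec[OF u23 that(1)] that(2)] by simp_all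
    define X where "X = u ` {1..j}"
    have inj: "inj_on u {1..j}" using u3 by (meson inj_onI)
    have cX: "card X = j" "finite X" using card_image[OF inj] by (simp_all add: X_def)
    have closed: "\<not> cross X e" if "e \<in> T \<union> H" for e
    proof
      assume c: "cross X e"
      have "e \<in> edges_on (U \<union> W)" using E that by blast
      then obtain a b where e: "e = {a, b}" "a \<in> U \<union> W" "b \<in> U \<union> W" by (rule edges_onE)
      have c': "(a \<in> X) \<noteq> (b \<in> X)" using c unfolding e(1) cross_pair .
      have *: "q \<in> X" if "p \<in> X" "q \<in> U \<union> W" "{p, q} \<in> T \<union> H" for p q
      proof -
        obtain i where "i \<in> {1..j}" "p = u i" using \<open>p \<in> X\<close> by (auto simp: X_def)
        then show ?thesis using bspec[OF bspec[OF u4, of i], of q] that by (auto simp: X_def)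
      qed
      have "{b, a} \<in> T \<union> H" using that e(1) by (simp add: insert_commute)
      then show False using *[of a b] *[of b a] c' e that by blast
    qed
    have "X \<inter> U = {} \<or> X \<inter> U = U"
    proof (rule ccontr)
      assume n: "\<not> (X \<inter> U = {} \<or> X \<inter> U = U)"
      have con: "\<forall>Y\<subseteq>U. Y \<noteq> {} \<longrightarrow> Y \<noteq> U \<longrightarrow> (\<exists>e\<in>T. cross Y e)"
        using T by (simp add: trees_on_def connected_on_def)
      have "\<exists>e\<in>T. cross (X \<inter> U) e" using n by (intro con[rule_format]) simp_all
      then obtain e where "e \<in> T" "cross (X \<inter> U) e" by blast
      then show False using closed[of e] cross_Int[OF TU, of e X] by simp
    qed
    moreover have "\<not> U \<subseteq> X" using card_mono[OF cX(2), of U] cX(1) j by auto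
    ultimately have XU: "X \<inter> U = {}" by blast
    then have XW: "X \<subseteq> W" using u1 by (auto simp: X_def)
    obtain y0 where y0: "y0 \<in> U" using trees_on_nonempty[OF T] by blast
    have "W \<subseteq> X"
    proof (rule ccontr)
      assume "\<not> W \<subseteq> X"
      then obtain w where "w \<in> W" "w \<notin> X" by blast
      then have "\<exists>y\<in>U \<union> W - u ` {1..j}. y \<notin> U" using UW(3) unfolding X_def by blast
      moreover have "\<exists>y\<in>U \<union> W - u ` {1..j}. y \<in> U" using y0 XU unfolding X_def by blast
      ultimately obtain y z where "y \<in> U" "z \<in> U \<union> W" "z \<notin> U" "{y, z} \<in> T \<union> H" using u5[of U] by auto
      then show False using nUW[of y z] by blast
    qed
    with XW have XeqW: "u ` {1..j} = W" by (simp add: X_def)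
    have uW: "u a \<in> W" if "a \<in> {1..j}" for a using that XeqW by blast
    have "H = (`) u ` H0"
    proof
      show "H \<subseteq> (`) u ` H0"
      proof
        fix e assume e: "e \<in> H"
        then have "e \<in> edges_on W" using forests_on_edges[OF H] by blast
        then obtain p q where pq: "e = {p, q}" "p \<in> W" "q \<in> W" by (rule edges_onE)
        then obtain a b where ab: "a \<in> {1..j}" "b \<in> {1..j}" "p = u a" "q = u b" unfolding XeqW[symmetric] by blast
        then have "{a, b} \<in> H0" using u2[OF ab(1,2)] e pq by simp
        then show "e \<in> (`) u ` H0" using pq ab by (intro image_eqI[of _ _ "{a, b}"]) auto
      qed
      show "(`) u ` H0 \<subseteq> H"
      proof clarify
        fix e assume "e \<in> H0"
        moreover from this have "e \<in> edges_on {1..j}" using forests_on_edges[OF H0] by blast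
        then obtain a b where "e = {a, b}" "a \<in> {1..j}" "b \<in> {1..j}" by (rule edges_onE)
        ultimately have "{u a, u b} \<in> T \<union> H" "u ` e = {u a, u b}" "u a \<in> W" using u2 uW by auto
        then show "u ` e \<in> H" using THW by simp
      qed
    qed
    moreover have "bij_betw u {1..j} W" using inj XeqW by (simp add: bij_betw_def)
    ultimately show "\<exists>g. bij_betw g {1..j} W \<and> H = (`) g ` H0" by blast
  next
    assume "\<exists>g. bij_betw g {1..j} W \<and> H = (`) g ` H0"
    then obtain g where g: "inj_on g {1..j}" "g ` {1..j} = W" "H = (`) g ` H0" by (auto simp: bij_betw_def)
    define u where "u = (\<lambda>x. if x \<in> {1..j} then g x else v x)"
    have ug: "u x = g x" if "x \<in> {1..j}" for x using that by (simp add: u_def)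
    have uW: "u ` {1..j} = W" using g(2) ug by (metis image_cong)
    have gW: "g x \<in> W" if "x \<in> {1..j}" for x using that g(2) by blast
    have rest: "U \<union> W - u ` {1..j} = U" unfolding uW using UW(3) by blast
    have c1: "\<forall>x\<in>{1..j}. u x \<in> U \<union> W" using ug gW by simp
    have c2: "\<forall>x. x \<notin> {1..j} \<longrightarrow> u x = v x" by (simp add: u_def)
    have c3: "({u a, u b} \<in> T \<union> H \<longleftrightarrow> {a, b} \<in> H0) \<and> (a \<noteq> b \<longrightarrow> u a \<noteq> u b)" if ab: "a \<in> {1..j}" "b \<in> {1..j}" for a b
    proof -
      have "{g a, g b} \<in> H \<longleftrightarrow> {a, b} \<in> H0" unfolding g(3)
        by (rule image_edge_iff[OF g(1) forests_on_edges[OF H0] ab])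
      then show ?thesis using THW[OF gW[OF ab(1)], of "g b"] ug ab inj_onD[OF g(1) _ ab] by auto
    qed
    have c4: "y \<in> u ` {1..j}" if "i \<in> {1..j}" "y \<in> U \<union> W" "{u i, y} \<in> T \<union> H" for i y
      using that nUW[of y "u i"] ug gW unfolding uW by (auto simp: insert_commute)
    have c5: "\<exists>y\<in>U. \<exists>z\<in>U. y \<in> Z \<and> z \<notin> Z \<and> {y, z} \<in> T \<union> H" if "\<exists>y\<in>U. y \<in> Z" "\<exists>y\<in>U. y \<notin> Z" for Z
    proof -
      have con: "\<forall>Y\<subseteq>U. Y \<noteq> {} \<longrightarrow> Y \<noteq> U \<longrightarrow> (\<exists>e\<in>T. cross Y e)"
        using T by (simp add: trees_on_def connected_on_def)
      have "\<exists>e\<in>T. cross (Z \<inter> U) e" by (rule con[rule_format]) (use that in blast)+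
      then obtain e where e: "e \<in> T" "cross (Z \<inter> U) e" by blast
      then have "e \<in> edges_on U" using trees_on_edges[OF T] by blast
      then obtain a b where ab: "e = {a, b}" "a \<in> U" "b \<in> U" by (rule edges_onE)
      have "(a \<in> Z) \<noteq> (b \<in> Z)" using e(2) ab by (simp add: cross_pair)
      moreover have "{a, b} \<in> T \<union> H" "{b, a} \<in> T \<union> H" using e(1) ab(1) by (auto simp: insert_commute)
      ultimately show ?thesis using ab(2,3) by blast
    qed
    show "\<exists>u. (\<forall>x\<in>{1..j}. u x \<in> U \<union> W) \<and> (\<forall>x. x \<notin> {1..j} \<longrightarrow> u x = v x) \<and>
      (\<forall>a\<in>{1..j}. \<forall>b\<in>{1..j}. ({u a, u b} \<in> T \<union> H \<longleftrightarrow> {a, b} \<in> H0) \<and> (a \<noteq> b \<longrightarrow> u a \<noteq> u b)) \<and>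
      (\<forall>i\<in>{1..j}. \<forall>y\<in>U \<union> W. {u i, y} \<in> T \<union> H \<longrightarrow> y \<in> u ` {1..j}) \<and>
      (\<forall>Z\<subseteq>U \<union> W. (\<exists>y\<in>U \<union> W - u ` {1..j}. y \<in> Z) \<and> (\<exists>y\<in>U \<union> W - u ` {1..j}. y \<notin> Z) \<longrightarrow>
        (\<exists>y\<in>U \<union> W - u ` {1..j}. \<exists>z\<in>U \<union> W - u ` {1..j}. y \<in> Z \<and> z \<notin> Z \<and> {y, z} \<in> T \<union> H))"
      by (intro exI[of _ u] conjI c1 c2 ballI allI impI c3[THEN conjunct1] c3[THEN conjunct2, rule_format] c4)
        (use c5 rest in auto)
  qed
qed

text \<open>The sentence is the disjunction of the fragment formulas of all selected forests. It is
  correct for every tree component with more than \<open>J\<close> vertices, so each tree counts as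
  good and \<open>\<rho>\<close> is constantly 1.\<close>

lemma definable_limit:
  fixes \<A> :: "nat \<Rightarrow> nat set set set"
  assumes A: "\<And>j. \<A> j \<subseteq> forests_on {1..j}" "\<And>j. J < j \<Longrightarrow> \<A> j = {}"
    and iso: "\<And>j g H. bij_betw g {1..j} {1..j} \<Longrightarrow> H \<in> \<A> j \<Longrightarrow> (`) g ` H \<in> \<A> j"
  shows "\<exists>\<phi>. mso_sentence \<phi> \<and> forest_prob \<phi> \<longlonglongrightarrow> (\<Sum>j. fragment_weight j (card (\<A> j)))"
proof -
  define Q where "Q = (\<lambda>(W :: nat set) H. \<exists>g. bij_betw g {1..card W} W \<and> H \<in> (`) ((`) g) ` \<A> (card W))"
  have Q_image: "Q (g ` V) ((`) g ` E)" if q: "inj_on g V" "finite V" "Q V E" for g V E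
  proof -
    obtain f H where f: "bij_betw f {1..card V} V" "H \<in> \<A> (card V)" "E = (`) f ` H" using q(3) by (auto simp: Q_def)
    have c: "card (g ` V) = card V" using q(1) by (rule card_image)
    have "bij_betw (g \<circ> f) {1..card V} (g ` V)"
      using f(1) q(1) by (intro bij_betw_trans[of f _ V g]) (auto simp: bij_betw_def)
    moreover have "(`) g ` E = (`) (g \<circ> f) ` H" unfolding f(3) by (simp add: image_image image_comp)
    ultimately show ?thesis unfolding Q_def c using f(2) by blast
  qed
  have "iso_invariant Q"
    unfolding iso_invariant_def
  proof (intro allI impI)
    fix g :: "nat \<Rightarrow> nat" and V E assume V: "finite V" "inj_on g V" "E \<in> forests_on V"
    have "Q (inv_into V g ` g ` V) ((`) (inv_into V g) ` (`) g ` E)" if "Q (g ` V) ((`) g ` E)"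
      by (rule Q_image[OF inj_on_inv_into[OF subset_refl] _ that]) (use V in simp)
    moreover have "E \<subseteq> Pow V" using forests_on_subset[OF V(3)] by blast
    ultimately have "Q V E" if "Q (g ` V) ((`) g ` E)"
      using that unfolding image_edges_inv[OF V(2) \<open>E \<subseteq> Pow V\<close>] inv_into_image_cancel[OF V(2) subset_refl] by blast
    then show "Q (g ` V) ((`) g ` E) \<longleftrightarrow> Q V E" using Q_image[OF V(2,1)] by blast
  qed
  have Q_std: "{H \<in> forests_on {1..j}. Q {1..j} H} = \<A> j" for j
  proof (intro equalityI subsetI)
    fix H assume "H \<in> {H \<in> forests_on {1..j}. Q {1..j} H}"
    then show "H \<in> \<A> j" using iso by (auto simp: Q_def)
  next
    fix H assume H: "H \<in> \<A> j"
    have "Q {1..j} H" unfolding Q_def using H by (intro exI[of _ id]) (auto simp: image_id)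
    then show "H \<in> {H \<in> forests_on {1..j}. Q {1..j} H}" using H A(1) by blast
  qed
  have "finite (SIGMA j:{..J}. \<A> j)"
    using A(1) finite_subset[OF _ finite_forests_on] by (intro finite_SigmaI) (auto intro: finite_subset[OF _ finite_forests_on])
  then obtain xs where xs: "set xs = (SIGMA j:{..J}. \<A> j)" using finite_list by blast
  define \<phi> where "\<phi> = mso_disjs (map (\<lambda>(j, H). fragment_formula j H) xs)"
  have sent: "mso_sentence \<phi>"
    using mso_sentence_fragment_formula by (auto simp: mso_sentence_def \<phi>_def)
  have "forest_property_prob (\<lambda>G. G \<Turnstile> \<phi>) \<longlonglongrightarrow> (\<Sum>j. fragment_weight j (card {H \<in> forests_on {1..j}. Q {1..j} H}))"
  proof (rule forest_limit_law[where \<rho> = "\<lambda>_. 1" and good = "\<lambda>_ _. True" and N = J])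
    fix U W :: "nat set" and T H
    assume a: "J < card U" "finite U" "finite W" "U \<inter> W = {}" "T \<in> trees_on U" "H \<in> forests_on W"
    have "(U \<union> W, T \<union> H) \<Turnstile> \<phi> \<longleftrightarrow> (\<exists>(j, H0)\<in>set xs. sat (U \<union> W, T \<union> H) undefined undefined (fragment_formula j H0))"
      unfolding models_iff_sat[OF sent, where v = undefined and S = undefined]
      by (simp add: \<phi>_def case_prod_unfold)
    also have "\<dots> \<longleftrightarrow> (\<exists>(j, H0)\<in>set xs. \<exists>g. bij_betw g {1..j} W \<and> H = (`) g ` H0)"
    proof (intro bex_cong refl, clarify)
      fix j H0 assume "(j, H0) \<in> set xs"
      then have "j \<le> J" "H0 \<in> forests_on {1..j}" using xs A(1) by auto
      then show "sat (U \<union> W, T \<union> H) undefined undefined (fragment_formula j H0) = (\<exists>g. bij_betw g {1..j} W \<and> H = (`) g ` H0)"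
        using a by (intro sat_fragment_formula) auto
    qed
    also have "\<dots> \<longleftrightarrow> Q W H"
    proof
      assume "\<exists>(j, H0)\<in>set xs. \<exists>g. bij_betw g {1..j} W \<and> H = (`) g ` H0"
      then obtain j H0 g where g: "H0 \<in> \<A> j" "bij_betw g {1..j} W" "H = (`) g ` H0" using xs by auto
      have "card W = j" using bij_betw_same_card[OF g(2)] by simp
      then show "Q W H" using g by (auto simp: Q_def)
    next
      assume "Q W H"
      then obtain g H0 where g: "bij_betw g {1..card W} W" "H0 \<in> \<A> (card W)" "H = (`) g ` H0" by (auto simp: Q_def)
      moreover have "card W \<le> J" using g(2) A(2)[of "card W"] by (cases "J < card W") auto
      ultimately have "(card W, H0) \<in> set xs" using xs by simp
      then show "\<exists>(j, H0)\<in>set xs. \<exists>g. bij_betw g {1..j} W \<and> H = (`) g ` H0" using g by blast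
    qed
    finally show "(U \<union> W, T \<union> H) \<Turnstile> \<phi> \<longleftrightarrow> Q W H" .
  qed (use \<open>iso_invariant Q\<close> in auto)
  then show ?thesis using sent unfolding Q_std forest_prob_property by blast
qed

section \<open>The set of limits\<close>

lemma fragment_weight_nonneg: "fragment_weight j m \<ge> 0"
  by (simp add: fragment_weight_def)

lemma fragment_weight_mono: "m \<le> m' \<Longrightarrow> fragment_weight j m \<le> fragment_weight j m'"
  by (simp add: fragment_weight_def divide_right_mono mult_left_mono)

section \<open>Weights of isomorphism classes compared with tails\<close>

text \<open>The limiting probability that the fragment has at least j vertices.\<close>

definition tail_weight :: "nat \<Rightarrow> real" where
  "tail_weight j = 1 - (\<Sum>i<j. fragment_weight i (forest_count i))"

lemma tail_weight_nonneg: "tail_weight j \<ge> 0"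
  using fragment_weight_total sum_le_suminf[of "\<lambda>j. fragment_weight j (forest_count j)" "{..<j}"]
  by (simp add: tail_weight_def sums_iff fragment_weight_nonneg)

lemma tail_weight_tendsto: "tail_weight \<longlonglongrightarrow> 0"
proof -
  have "(\<lambda>j. 1 - (\<Sum>i<j. fragment_weight i (forest_count i))) \<longlonglongrightarrow> 1 - 1"
    using fragment_weight_total unfolding sums_def by (intro tendsto_diff tendsto_const)
  then show ?thesis by (simp add: tail_weight_def[abs_def])
qed

lemma forest_count_1: "forest_count (Suc 0) = 1"
  by (subst forest_count_Suc) simp

lemma forest_count_2: "forest_count 2 = 2"
  using forest_count_Suc[of 1] by (simp add: forest_count_1 numeral_2_eq_2)

lemma forest_count_3: "forest_count 3 = 7"
  using forest_count_Suc[of 2]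
  by (simp add: forest_count_1 forest_count_2[unfolded numeral_2_eq_2] numeral_2_eq_2 numeral_3_eq_3)

lemma forest_count_4: "forest_count 4 = 38"
proof -
  have c: "(3 :: nat) choose 2 = 3" by (simp add: eval_nat_numeral)
  have "forest_count 4 = (\<Sum>k\<in>{0, 1, 2, 3}. (3 choose k) * (Suc k ^ (Suc k - 2) * forest_count (3 - k)))"
    using forest_count_Suc[of 3] by (simp add: atMost_nat_numeral insert_commute)
  then show ?thesis by (simp add: c forest_count_1 forest_count_2 forest_count_3)
qed

lemma forest_count_5: "forest_count 5 = 291"
proof -
  have c: "(4 :: nat) choose 2 = 6" "(4 :: nat) choose 3 = 4" by (simp_all add: eval_nat_numeral)
  have "forest_count 5 = (\<Sum>k\<in>{0, 1, 2, 3, 4}. (4 choose k) * (Suc k ^ (Suc k - 2) * forest_count (4 - k)))"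
    using forest_count_Suc[of 4] by (simp add: atMost_nat_numeral insert_commute)
  then show ?thesis by (simp add: c forest_count_1 forest_count_2 forest_count_3 forest_count_4)
qed

lemma forest_count_6: "forest_count 6 = 2932"
proof -
  have c: "(5 :: nat) choose 2 = 10" "(5 :: nat) choose 3 = 10" "(5 :: nat) choose 4 = 5"
    by (simp_all add: eval_nat_numeral)
  have "forest_count 6 = (\<Sum>k\<in>{0, 1, 2, 3, 4, 5}. (5 choose k) * (Suc k ^ (Suc k - 2) * forest_count (5 - k)))"
    using forest_count_Suc[of 5] by (simp add: atMost_nat_numeral insert_commute)
  then show ?thesis by (simp add: c forest_count_1 forest_count_2 forest_count_3 forest_count_4 forest_count_5)
qed

text \<open>The 3 stands for a bound on e. From n = 7 on the trees alone suffice, as 7^5 = 16807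
  exceeds 3 * 7! = 15120. For n = 6 the 1296 trees are fewer than 3 * 6! = 2160, and all 2932
  forests are counted.\<close>

lemma forest_count_ge:
  assumes "n \<ge> 6"
  shows "3 * fact n \<le> forest_count n"
proof (cases "n = 6")
  case True
  then show ?thesis by (simp add: forest_count_6 fact_numeral)
next
  case False
  then have "n \<ge> 7" using assms by simp
  then have "3 * fact n \<le> n ^ (n - 2)"
  proof (induction n rule: dec_induct)
    case base
    then show ?case by (simp add: fact_numeral)
  next
    case (step n)
    have "3 * fact (Suc n) = Suc n * (3 * fact n)" by simp
    also have "\<dots> \<le> Suc n * n ^ (n - 2)" using step.IH by (rule mult_le_mono2)
    also have "\<dots> \<le> Suc n * Suc n ^ (n - 2)" by (intro mult_le_mono2 power_mono) auto
    also have "\<dots> = Suc n ^ (Suc n - 2)"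
      using step.hyps by (simp flip: power_Suc add: Suc_diff_le[symmetric] numeral_2_eq_2 Suc_diff_Suc)
    finally show ?case .
  qed
  also have "n ^ (n - 2) = card (trees_on {1..n})" using \<open>n \<ge> 7\<close> by (subst cayley) auto
  also have "\<dots> \<le> forest_count n"
    unfolding forest_count_def using finite_forests_on[of "{1..n}"] by (intro card_mono) (auto simp: trees_on_def)
  finally show ?thesis .
qed

text \<open>The first five terms of the exponential series already give about 1.6484.\<close>

lemma exp_half_ge: "1.648 \<le> exp (1 / 2 :: real)"
proof -
  have "(\<Sum>k<5. (1 / 2 :: real) ^ k /\<^sub>R fact k) \<le> (\<Sum>k. (1 / 2 :: real) ^ k /\<^sub>R fact k)"
    using exp_converges[of "1 / 2 :: real"] by (intro sum_le_suminf) (auto simp: sums_iff)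
  also have "\<dots> = exp (1 / 2)" using exp_converges[of "1 / 2 :: real"] by (simp add: sums_iff)
  finally show ?thesis by (simp add: eval_nat_numeral)
qed

text \<open>The weight of an isomorphism class with \<open>j\<close> vertices is at most the left-hand side.\<close>

lemma class_weight_le_tail:
  assumes "j \<ge> 2"
  shows "exp (- 1 / 2) * exp (- real j) \<le> tail_weight (Suc j)"
proof (cases "j \<ge> 5")
  case True
  \<comment> \<open>From j = 5 on the fragments with exactly j+1 vertices outweigh a class on j
    vertices: e (j+1)! labelled forests would balance j! of them on one vertex less.\<close>
  have "exp 1 * fact (Suc j) \<le> real (forest_count (Suc j))"
  proof -
    have "exp 1 * fact (Suc j) \<le> 3 * (fact (Suc j) :: real)" using exp_le by (intro mult_right_mono) auto
    also have "\<dots> = real (3 * fact (Suc j))" by (simp only: of_nat_mult of_nat_numeral of_nat_fact)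
    also have "\<dots> \<le> real (forest_count (Suc j))" using forest_count_ge[of "Suc j"] True by (intro of_nat_mono) simp
    finally show ?thesis .
  qed
  then have "exp (- 1 / 2) * exp (- real (Suc j)) * (exp 1 * fact (Suc j)) / fact (Suc j) \<le> fragment_weight (Suc j) (forest_count (Suc j))"
    unfolding fragment_weight_def by (intro divide_right_mono mult_left_mono) auto
  moreover have "exp (- real (Suc j)) * exp 1 = exp (- real j)" by (simp add: exp_add[symmetric])
  ultimately have "exp (- 1 / 2) * exp (- real j) \<le> fragment_weight (Suc j) (forest_count (Suc j))"
    by (simp add: mult.assoc del: of_nat_Suc fact_Suc)
  also have "\<dots> \<le> tail_weight (Suc j)"
    using tail_weight_nonneg[of "Suc (Suc j)"] by (simp add: tail_weight_def)
  finally show ?thesis .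
next
  case False
  \<comment> \<open>The cases j = 2, 3, 4 are numerical, with s = e^(1/2) and x = e^(-1) = s^(-2),
    so that one lower bound on s also bounds x from above. Multiplied by s, the claim compares x^j
    plus the first j+1 terms of the forest series with s. The case j = 2 has the least room, about
    1.640 against 1.648.\<close>
  define s where "s = exp (1 / 2 :: real)"
  define x where "x = exp (- 1 :: real)"
  have s: "s \<ge> 1.648" unfolding s_def by (rule exp_half_ge)
  have sx: "s * s * x = 1" unfolding s_def x_def by (simp add: exp_add[symmetric])
  have x0: "x \<ge> 0" by (simp add: x_def)
  then have "1.648 * 1.648 * x \<le> s * s * x" using s by (intro mult_right_mono mult_mono) auto
  then have "x \<le> 0.3683" unfolding sx by simp
  note x = this x0
  have e: "exp (- real i) = x ^ i" for i by (simp add: x_def exp_of_nat_mult[symmetric])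
  have si: "exp (- 1 / 2) = 1 / s" by (simp add: s_def exp_minus inverse_eq_divide)
  have s0: "s > 0" by (simp add: s_def)
  have key: "exp (- 1 / 2) * exp (- real j) \<le> tail_weight (Suc j)"
    if "x ^ j + (\<Sum>i<Suc j. x ^ i * real (forest_count i) / fact i) \<le> s"
  proof -
    have "(x ^ j + (\<Sum>i<Suc j. x ^ i * real (forest_count i) / fact i)) / s \<le> 1" using that s0 by simp
    then show ?thesis unfolding tail_weight_def fragment_weight_def e si
      by (simp add: add_divide_distrib sum_divide_distrib divide_divide_eq_left mult.commute algebra_simps)
  qed
  have p: "x ^ 2 \<le> 0.1357" "x ^ 3 \<le> 0.05" "x ^ 4 \<le> 0.0185"
  proof -
    have "x ^ 2 \<le> 0.3683 ^ 2" "x ^ 3 \<le> 0.3683 ^ 3" "x ^ 4 \<le> 0.3683 ^ 4" using x by (intro power_mono; simp)+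
    then show "x ^ 2 \<le> 0.1357" "x ^ 3 \<le> 0.05" "x ^ 4 \<le> 0.0185" by (simp_all add: power_divide eval_nat_numeral)
  qed
  have S3: "(\<Sum>i<3. x ^ i * real (forest_count i) / fact i) = 1 + x + x ^ 2"
  proof -
    have "(\<Sum>i<2. x ^ i * real (forest_count i) / fact i) = 1 + x"
      by (simp add: numeral_2_eq_2 forest_count_1)
    then show ?thesis
      using sum.lessThan_Suc[of "\<lambda>i. x ^ i * real (forest_count i) / fact i" 2] by (simp add: forest_count_2)
  qed
  have S4: "(\<Sum>i<4. x ^ i * real (forest_count i) / fact i) = 1 + x + x ^ 2 + 7 / 6 * x ^ 3"
    using S3 sum.lessThan_Suc[of "\<lambda>i. x ^ i * real (forest_count i) / fact i" 3] by (simp add: forest_count_3 fact_numeral)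
  have S5: "(\<Sum>i<5. x ^ i * real (forest_count i) / fact i) = 1 + x + x ^ 2 + 7 / 6 * x ^ 3 + 38 / 24 * x ^ 4"
    using S4 sum.lessThan_Suc[of "\<lambda>i. x ^ i * real (forest_count i) / fact i" 4] by (simp add: forest_count_4 fact_numeral)
  consider "j = 2" | "j = 3" | "j = 4" using False assms by linarith
  then show ?thesis
  proof cases
    case 1
    then show ?thesis using S3 x p s by (intro key) simp
  next
    case 2
    then show ?thesis using S4 x p s by (intro key) simp
  next
    case 3
    then show ?thesis using S5 x p s by (intro key) simp
  qed
qed

text \<open>Kakeya's greedy argument: no weight exceeds the sum \<open>r\<close> of all later weights.\<close>

lemma kakeya_step:
  fixes w :: "'a \<Rightarrow> real"
  assumes "finite C" "\<And>c. c \<in> C \<Longrightarrow> 0 \<le> w c \<and> w c \<le> r" "0 \<le> r" "0 \<le> y" "y \<le> sum w C + r"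
  shows "\<exists>D\<subseteq>C. sum w D \<le> y \<and> y \<le> sum w D + r"
  using assms
proof (induction C arbitrary: y rule: finite_induct)
  case empty
  then show ?case by auto
next
  case (insert c C)
  show ?case
  proof (cases "y \<le> sum w C + r")
    case True
    then obtain D where "D \<subseteq> C" "sum w D \<le> y" "y \<le> sum w D + r"
      using insert.IH[of y] insert.prems by auto
    then show ?thesis by blast
  next
    case False
    have "0 \<le> sum w C" using insert.prems by (intro sum_nonneg) auto
    \<comment> \<open>The greedy choice: \<open>y\<close> is out of reach of \<open>C\<close> and
      \<open>r\<close>, so \<open>c\<close> is taken. This does not overshoot because
      \<open>w c \<le> r < y\<close>.\<close>
    then have "0 \<le> y - w c" using False insert.prems(1)[of c] by simp
    moreover have "y - w c \<le> sum w C + r" using insert.prems(4) insert.hyps by simp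
    ultimately obtain D where D: "D \<subseteq> C" "sum w D \<le> y - w c" "y - w c \<le> sum w D + r"
      using insert.IH[of "y - w c"] insert.prems by auto
    have "sum w (insert c D) = w c + sum w D"
      using D(1) insert.hyps finite_subset by (subst sum.insert) auto
    then show ?thesis using D by (intro exI[of _ "insert c D"]) auto
  qed
qed

section \<open>Isomorphism classes as summands\<close>

definition iso_closed :: "nat \<Rightarrow> nat set set set \<Rightarrow> bool" where
  "iso_closed j B \<longleftrightarrow> (\<forall>g. bij_betw g {1..j} {1..j} \<longrightarrow> (\<forall>H\<in>B. (`) g ` H \<in> B))"

text \<open>The orbit of \<open>H\<close> under the symmetric group of \<open>{1..j}\<close>, whose
  order j! bounds its size. Closure under arbitrary bijections of \<open>{1..j}\<close> is reduced
  to this in \<open>iso_closed_Union\<close>.\<close>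

definition iso_class :: "nat \<Rightarrow> nat set set \<Rightarrow> nat set set set" where
  "iso_class j H = {(`) p ` H | p. p permutes {1..j}}"

lemma iso_class_refl: "H \<in> iso_class j H"
  unfolding iso_class_def by (intro CollectI exI[of _ id]) (auto simp: permutes_id)

lemma iso_class_trans:
  assumes "H \<in> iso_class j H'" "H' \<in> iso_class j H''"
  shows "H \<in> iso_class j H''"
proof -
  obtain p p' where p: "p permutes {1..j}" "H = (`) p ` H'" "p' permutes {1..j}" "H' = (`) p' ` H''"
    using assms by (auto simp: iso_class_def)
  then have "H = (`) (p \<circ> p') ` H''" by (simp add: image_image image_comp)
  moreover have "p \<circ> p' permutes {1..j}" using p by (intro permutes_compose)
  ultimately show ?thesis unfolding iso_class_def by blast
qed

lemma iso_class_sym: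
  assumes "H \<in> iso_class j H'"
  shows "H' \<in> iso_class j H"
proof -
  obtain p where p: "p permutes {1..j}" "H = (`) p ` H'" using assms by (auto simp: iso_class_def)
  have "(`) (inv p) ` H = (\<lambda>e. (inv p \<circ> p) ` e) ` H'" unfolding p(2) by (simp add: image_image image_comp)
  also have "inv p \<circ> p = id" using p(1) by (rule permutes_inv_o(2))
  finally have "H' = (`) (inv p) ` H" by simp
  then show ?thesis unfolding iso_class_def using permutes_inv[OF p(1)] by blast
qed

lemma iso_class_forests:
  assumes "H \<in> forests_on {1..j}"
  shows "iso_class j H \<subseteq> forests_on {1..j}"
proof
  fix H' assume "H' \<in> iso_class j H"
  then obtain p where p: "p permutes {1..j}" "H' = (`) p ` H" by (auto simp: iso_class_def)
  show "H' \<in> forests_on {1..j}"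
    using forests_on_image[OF permutes_inj_on[OF p(1)] assms] unfolding p(2) permutes_image[OF p(1)] .
qed

lemma card_iso_class_le: "card (iso_class j H) \<le> fact j"
proof -
  have "iso_class j H = (\<lambda>p. (`) p ` H) ` {p. p permutes {1..j}}" by (auto simp: iso_class_def)
  also have "card \<dots> \<le> card {p. p permutes {1..j}}" using finite_permutations[of "{1..j}"] by (intro card_image_le) simp
  also have "\<dots> = fact j" by (rule card_permutations) auto
  finally show ?thesis .
qed

lemma iso_closed_Union:
  assumes "D \<subseteq> iso_class j ` forests_on {1..j}"
  shows "iso_closed j (\<Union>D)"
  unfolding iso_closed_def
proof (intro allI impI ballI)
  fix g H assume g: "bij_betw g {1..j} {1..j}" and "H \<in> \<Union>D"
  then obtain H0 where H0: "H0 \<in> forests_on {1..j}" "iso_class j H0 \<in> D" "H \<in> iso_class j H0" using assms by blast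
  \<comment> \<open>The map \<open>g\<close> may do anything outside \<open>{1..j}\<close>.
    Redefined as the identity there, it becomes a permutation with the same effect on
    \<open>H\<close>.\<close>
  define p where "p = (\<lambda>x. if x \<in> {1..j} then g x else x)"
  have "bij_betw p {1..j} {1..j}" using g by (rule bij_betw_cong[THEN iffD1, rotated]) (simp add: p_def)
  then have p: "p permutes {1..j}" by (rule bij_imp_permutes) (auto simp: p_def)
  have "H \<in> forests_on {1..j}" using iso_class_forests H0 by blast
  have "g ` e = p ` e" if "e \<in> H" for e
    using forests_on_subset[OF \<open>H \<in> forests_on {1..j}\<close> that] by (intro image_cong refl) (auto simp: p_def)
  then have "(`) g ` H = (`) p ` H" by (rule image_cong[OF refl])
  then have "(`) g ` H \<in> iso_class j H" using p unfolding iso_class_def by blast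
  then have "(`) g ` H \<in> iso_class j H0" using H0(3) by (rule iso_class_trans)
  then show "(`) g ` H \<in> \<Union>D" using H0(2) by blast
qed

text \<open>Kakeya's step with the isomorphism classes on j vertices as summands. Each has at most
  j! members, so its weight is at most the left-hand side of the assumption on
  \<open>r\<close>.\<close>

lemma fragment_level:
  assumes y: "0 \<le> y" "y \<le> fragment_weight j (forest_count j) + r" and r: "exp (- 1 / 2) * exp (- real j) \<le> r"
  shows "\<exists>B\<subseteq>forests_on {1..j}. iso_closed j B \<and> fragment_weight j (card B) \<le> y \<and> y \<le> fragment_weight j (card B) + r"
proof -
  define C where "C = iso_class j ` forests_on {1..j}"
  have finF: "finite (forests_on {1..j})" by (simp add: finite_forests_on)
  have finC: "finite C" using finF by (simp add: C_def)
  have CF: "c \<subseteq> forests_on {1..j}" if "c \<in> C" for c using that iso_class_forests by (auto simp: C_def)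
  have disj: "c \<inter> c' = {}" if "c \<in> C" "c' \<in> C" "c \<noteq> c'" for c c'
  proof (rule ccontr)
    assume "c \<inter> c' \<noteq> {}"
    then obtain H where H: "H \<in> c" "H \<in> c'" by blast
    obtain H1 H2 where H12: "c = iso_class j H1" "c' = iso_class j H2" using \<open>c \<in> C\<close> \<open>c' \<in> C\<close> by (auto simp: C_def)
    have "c = c'" using H unfolding H12 using iso_class_trans iso_class_sym by blast
    with \<open>c \<noteq> c'\<close> show False by blast
  qed
  have cU: "real (card (\<Union>D)) = (\<Sum>c\<in>D. real (card c))" if "D \<subseteq> C" for D
  proof -
    have "card (\<Union>D) = (\<Sum>c\<in>D. card c)"
    proof (rule card_Union_disjoint)
      show "pairwise disjnt D" unfolding pairwise_def disjnt_def using that disj by blast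
      show "finite c" if "c \<in> D" for c using CF finF \<open>D \<subseteq> C\<close> that finite_subset by blast
    qed
    then show ?thesis by simp
  qed
  define w where "w = (\<lambda>c :: nat set set set. fragment_weight j (card c))"
  have wU: "fragment_weight j (card (\<Union>D)) = sum w D" if "D \<subseteq> C" for D
    unfolding fragment_weight_def w_def cU[OF that] by (simp add: sum_distrib_left sum_divide_distrib)
  have "\<Union>C = forests_on {1..j}" using CF iso_class_refl unfolding C_def by blast
  then have tot: "sum w C = fragment_weight j (forest_count j)" using wU[of C] by (simp add: forest_count_def)
  have "\<exists>D\<subseteq>C. sum w D \<le> y \<and> y \<le> sum w D + r"
  proof (rule kakeya_step[OF finC])
    fix c assume "c \<in> C"
    then have "card c \<le> fact j" using card_iso_class_le by (auto simp: C_def)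
    then have "w c \<le> fragment_weight j (fact j)" unfolding w_def by (rule fragment_weight_mono)
    also have "\<dots> = exp (- 1 / 2) * exp (- real j)" by (simp add: fragment_weight_def)
    finally show "0 \<le> w c \<and> w c \<le> r" using r by (simp add: w_def fragment_weight_nonneg)
  next
    have "0 \<le> exp (- 1 / 2) * exp (- real j)" by simp
    then show "0 \<le> r" using r by linarith
  qed (use y tot in auto)
  then obtain D where D: "D \<subseteq> C" "sum w D \<le> y" "y \<le> sum w D + r" by blast
  have "\<Union>D \<subseteq> forests_on {1..j}" using D(1) CF by blast
  then show ?thesis using D wU[OF D(1)] iso_closed_Union[of D j] unfolding C_def by (intro exI[of _ "\<Union>D"]) simp
qed

text \<open>The greedy choice proceeds level by level, keeping the part of x not yet covered between
  0 and the weight of the levels to come. It starts at two vertices because the classes with none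
  and with one vertex outweigh all that follow them.\<close>

lemma fragment_approximation:
  assumes x: "0 \<le> x" "x \<le> tail_weight 2" and "J \<ge> 2"
  shows "\<exists>\<A>. (\<forall>j. \<A> j \<subseteq> forests_on {1..j} \<and> iso_closed j (\<A> j)) \<and> (\<forall>j. j < 2 \<or> J \<le> j \<longrightarrow> \<A> j = {}) \<and>
    (\<Sum>j<J. fragment_weight j (card (\<A> j))) \<le> x \<and> x \<le> (\<Sum>j<J. fragment_weight j (card (\<A> j))) + tail_weight J"
  using assms(3)
proof (induction J rule: dec_induct)
  case base
  show ?case using x
    by (intro exI[of _ "\<lambda>_. {}"]) (simp add: iso_closed_def fragment_weight_def)
next
  case (step J)
  then obtain \<A> where A: "\<And>j. \<A> j \<subseteq> forests_on {1..j} \<and> iso_closed j (\<A> j)" "\<And>j. j < 2 \<or> J \<le> j \<Longrightarrow> \<A> j = {}"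
    "(\<Sum>j<J. fragment_weight j (card (\<A> j))) \<le> x" "x \<le> (\<Sum>j<J. fragment_weight j (card (\<A> j))) + tail_weight J"
    by blast
  define S where "S = (\<Sum>j<J. fragment_weight j (card (\<A> j)))"
  have "x - S \<le> fragment_weight J (forest_count J) + tail_weight (Suc J)"
    using A(4) by (simp add: S_def tail_weight_def)
  then obtain B where B: "B \<subseteq> forests_on {1..J}" "iso_closed J B" "fragment_weight J (card B) \<le> x - S"
    "x - S \<le> fragment_weight J (card B) + tail_weight (Suc J)"
    using fragment_level[of "x - S" J "tail_weight (Suc J)"] A(3) class_weight_le_tail[OF step.hyps(1)] by (auto simp: S_def)
  have s: "(\<Sum>j<Suc J. fragment_weight j (card ((\<A>(J := B)) j))) = S + fragment_weight J (card B)"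
  proof -
    have "(\<Sum>j<J. fragment_weight j (card ((\<A>(J := B)) j))) = S" unfolding S_def by (intro sum.cong) auto
    then show ?thesis by simp
  qed
  show ?case
    using A(1,2) B s step.hyps(1) by (intro exI[of _ "\<A>(J := B)"]) (simp only: s, auto)
qed

text \<open>There is one forest on no vertices and one on a single vertex, so e^(-1/2) and e^(-3/2)
  enter a limit wholly or not at all. The other levels contribute a number in
  \<open>{0..tail_weight 2}\<close>, and sums of finitely many classes are dense there.\<close>

theorem theorem1p7:
  shows "(\<forall>\<phi>. mso_sentence \<phi> \<longrightarrow> convergent (forest_prob \<phi>)) \<and>
    closure {lim (forest_prob \<phi>) | \<phi>. mso_sentence \<phi>} =
      {0 .. 1 - (1 + exp (- 1)) * exp (- 1 / 2)} \<union>
      {exp (- 3 / 2) .. 1 - exp (- 1 / 2)} \<union>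
      {exp (- 1 / 2) .. 1 - exp (- 3 / 2)} \<union>
      {(1 + exp (- 1)) * exp (- 1 / 2) .. 1}"
    (is "_ \<and> closure ?L = ?R")
proof
  show "\<forall>\<phi>. mso_sentence \<phi> \<longrightarrow> convergent (forest_prob \<phi>)"
    using mso_limit convergentI by blast
  have e: "exp (- 1 / 2) * exp (- 1) = (exp (- 3 / 2) :: real)"
  proof -
    have "- 3 / 2 = - 1 / 2 + (- 1 :: real)" by simp
    then show ?thesis by (simp only: exp_add)
  qed
  have f0: "fragment_weight 0 1 = exp (- 1 / 2)" and f1: "fragment_weight 1 1 = exp (- 3 / 2)"
    using e by (simp_all add: fragment_weight_def)
  have z: "fragment_weight j 0 = 0" for j by (simp add: fragment_weight_def)
  have t2: "tail_weight 2 = 1 - exp (- 1 / 2) - exp (- 3 / 2)"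
    using f0 f1 by (simp add: tail_weight_def numeral_2_eq_2 forest_count_1)
  \<comment> \<open>The four intervals as translates of \<open>{0..tail_weight 2}\<close>:
    \<open>a0\<close> and \<open>a1\<close> are 0 or 1 and record whether the two exceptional
    classes are included.\<close>
  have R: "t \<in> ?R \<longleftrightarrow> (\<exists>a0 a1 x. a0 \<le> 1 \<and> a1 \<le> 1 \<and> 0 \<le> x \<and> x \<le> tail_weight 2 \<and>
      t = fragment_weight 0 a0 + fragment_weight 1 a1 + x)" (is "_ \<longleftrightarrow> ?P") for t
  proof
    show ?P if tR: "t \<in> ?R"
    proof -
      have d: "(1 + exp (- 1)) * exp (- 1 / 2) = exp (- 1 / 2) + (exp (- 3 / 2) :: real)" using e by (simp add: algebra_simps)
      have "t \<in> {0..tail_weight 2} \<or> t - exp (- 3 / 2) \<in> {0..tail_weight 2} \<or>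
        t - exp (- 1 / 2) \<in> {0..tail_weight 2} \<or> t - exp (- 1 / 2) - exp (- 3 / 2) \<in> {0..tail_weight 2}"
        using tR unfolding d t2 Un_iff atLeastAtMost_iff by linarith
      then consider "t \<in> {0..tail_weight 2}" | "t - exp (- 3 / 2) \<in> {0..tail_weight 2}" |
        "t - exp (- 1 / 2) \<in> {0..tail_weight 2}" | "t - exp (- 1 / 2) - exp (- 3 / 2) \<in> {0..tail_weight 2}"
        by blast
      then show ?thesis
      proof cases
        case 1
        then show ?thesis by (intro exI[of _ 0] exI[of _ 0] exI[of _ t]) (simp add: z)
      next
        case 2
        then show ?thesis by (intro exI[of _ 0] exI[of _ 1] exI[of _ "t - exp (- 3 / 2)"]) (use z f1 in simp)
      next
        case 3
        then show ?thesis by (intro exI[of _ 1] exI[of _ 0] exI[of _ "t - exp (- 1 / 2)"]) (use z f0 in simp)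
      next
        case 4
        then show ?thesis by (intro exI[of _ 1] exI[of _ 1] exI[of _ "t - exp (- 1 / 2) - exp (- 3 / 2)"]) (use f0 f1 in simp)
      qed
    qed
    show "t \<in> ?R" if P: ?P
    proof -
      have d: "(1 + exp (- 1)) * exp (- 1 / 2) = exp (- 1 / 2) + (exp (- 3 / 2) :: real)" using e by (simp add: algebra_simps)
      obtain a0 a1 x where a: "a0 \<le> 1" "a1 \<le> 1" "0 \<le> x" "x \<le> tail_weight 2" "t = fragment_weight 0 a0 + fragment_weight 1 a1 + x"
        using P by (elim exE conjE)
      have "a0 = 0 \<or> a0 = 1" "a1 = 0 \<or> a1 = 1" using a(1,2) by auto
      then have "fragment_weight 0 a0 = 0 \<or> fragment_weight 0 a0 = exp (- 1 / 2)"
        "fragment_weight 1 a1 = 0 \<or> fragment_weight 1 a1 = exp (- 3 / 2)"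
        using f0 f1 z[of 0] z[of 1] by (elim disjE; simp)+
      then show ?thesis using a(3-5) unfolding d t2 Un_iff atLeastAtMost_iff by (elim disjE) linarith+
    qed
  qed
  show "closure ?L = ?R"
  proof
    have "lim (forest_prob \<phi>) \<in> ?R" if sent: "mso_sentence \<phi>" for \<phi>
    proof -
      obtain Q where Q: "forest_prob \<phi> \<longlonglongrightarrow> (\<Sum>j. fragment_weight j (card {H \<in> forests_on {1..j}. Q {1..j} H}))"
        using mso_limit[OF sent] by blast
      define a where "a = (\<lambda>j. card {H \<in> forests_on {1..j}. Q {1..j} H})"
      have a_le: "a j \<le> forest_count j" for j
        unfolding a_def forest_count_def by (intro card_mono finite_forests_on) auto
      have le: "fragment_weight j (a j) \<le> fragment_weight j (forest_count j)" for j by (intro fragment_weight_mono a_le)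
      have tot: "summable (\<lambda>j. fragment_weight j (forest_count j))" using fragment_weight_total by (simp add: sums_iff)
      then have sa: "summable (\<lambda>j. fragment_weight j (a j))"
        by (rule summable_comparison_test'[of _ 0]) (use le fragment_weight_nonneg in auto)
      define x where "x = (\<Sum>j. fragment_weight (j + 2) (a (j + 2)))"
      have "lim (forest_prob \<phi>) = (\<Sum>j. fragment_weight j (a j))" using Q unfolding a_def by (rule limI)
      also have "\<dots> = x + (\<Sum>j<2. fragment_weight j (a j))"
        unfolding x_def by (rule suminf_split_initial_segment[OF sa])
      also have "(\<Sum>j<2. fragment_weight j (a j)) = fragment_weight 0 (a 0) + fragment_weight 1 (a 1)"
        by (simp add: numeral_2_eq_2)
      finally have l: "lim (forest_prob \<phi>) = fragment_weight 0 (a 0) + fragment_weight 1 (a 1) + x" by simp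
      have sa2: "summable (\<lambda>j. fragment_weight (j + 2) (a (j + 2)))" using sa by (rule summable_ignore_initial_segment)
      have tot2: "summable (\<lambda>j. fragment_weight (j + 2) (forest_count (j + 2)))" using tot by (rule summable_ignore_initial_segment)
      have "0 \<le> x" unfolding x_def by (intro suminf_nonneg sa2 fragment_weight_nonneg)
      moreover have "x \<le> (\<Sum>j. fragment_weight (j + 2) (forest_count (j + 2)))"
        unfolding x_def by (intro suminf_le le sa2 tot2)
      moreover have "(\<Sum>j. fragment_weight (j + 2) (forest_count (j + 2))) = tail_weight 2"
        using suminf_split_initial_segment[OF tot, of 2] fragment_weight_total by (simp add: tail_weight_def sums_iff)
      moreover have "a 0 \<le> 1" "a 1 \<le> 1" using a_le[of 0] a_le[of 1] by (simp_all add: forest_count_1)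
      ultimately show "lim (forest_prob \<phi>) \<in> ?R" unfolding R using l by auto
    qed
    then have "?L \<subseteq> ?R" by blast
    moreover have "closed ?R" by (intro closed_Un closed_atLeastAtMost)
    ultimately show "closure ?L \<subseteq> ?R" by (rule closure_minimal)
    show "?R \<subseteq> closure ?L"
    proof
      fix t assume "t \<in> ?R"
      then obtain a0 a1 x where a: "a0 \<le> 1" "a1 \<le> 1" and x: "0 \<le> x" "x \<le> tail_weight 2"
        and t: "t = fragment_weight 0 a0 + fragment_weight 1 a1 + x" unfolding R by blast
      show "t \<in> closure ?L"
        unfolding closure_approachable
      proof (intro allI impI)
        fix \<epsilon> :: real assume "\<epsilon> > 0"
        then have "eventually (\<lambda>J. tail_weight J < \<epsilon>) sequentially" using tail_weight_tendsto by (intro order_tendstoD(2))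
        then have "eventually (\<lambda>J. tail_weight J < \<epsilon> \<and> 2 \<le> J) sequentially"
          by (intro eventually_conj eventually_ge_at_top)
        then obtain J where J: "tail_weight J < \<epsilon>" "2 \<le> J" by (auto simp: eventually_sequentially)
        obtain \<A> where A: "\<And>j. \<A> j \<subseteq> forests_on {1..j} \<and> iso_closed j (\<A> j)" "\<And>j. j < 2 \<or> J \<le> j \<Longrightarrow> \<A> j = {}"
          "(\<Sum>j<J. fragment_weight j (card (\<A> j))) \<le> x" "x \<le> (\<Sum>j<J. fragment_weight j (card (\<A> j))) + tail_weight J"
          using fragment_approximation[OF x J(2)] by blast
        \<comment> \<open>The approximating classes leave the levels 0 and 1 empty; there the single
          forest is put in as \<open>a0\<close> and \<open>a1\<close> prescribe.\<close>
        define \<B> where "\<B> = (\<lambda>j. if j = 0 \<and> a0 = 1 \<or> j = 1 \<and> a1 = 1 then forests_on {1..j} else \<A> j)"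
        have c: "iso_closed j (forests_on {1..j})" for j
          using forests_on_image[of _ "{1..j}"] unfolding iso_closed_def bij_betw_def by metis
        have B: "\<B> j \<subseteq> forests_on {1..j}" "iso_closed j (\<B> j)" for j using A(1) c by (auto simp: \<B>_def)
        have B0: "\<B> j = {}" if "J < j" for j using that A(2)[of j] J(2) by (auto simp: \<B>_def)
        obtain \<phi> where \<phi>: "mso_sentence \<phi>" "forest_prob \<phi> \<longlonglongrightarrow> (\<Sum>j. fragment_weight j (card (\<B> j)))"
          using definable_limit[OF B(1) B0] B(2) unfolding iso_closed_def by blast
        have "(\<Sum>j. fragment_weight j (card (\<B> j))) = (\<Sum>j<J. fragment_weight j (card (\<B> j)))"
        proof (rule suminf_finite)
          fix j assume "j \<notin> {..<J}"
          then have "\<B> j = {}" using A(2)[of j] J(2) by (auto simp: \<B>_def)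
          then show "fragment_weight j (card (\<B> j)) = 0" by (simp add: z)
        qed simp
        also have "\<dots> = (\<Sum>j<J. fragment_weight j (card (\<A> j)) + (if j = 0 then fragment_weight 0 a0 else 0) + (if j = 1 then fragment_weight 1 a1 else 0))"
        proof (rule sum.cong[OF refl])
          fix j
          have "card (forests_on {1..0::nat}) = 1" "card (forests_on {1..1::nat}) = 1"
            using forest_count_0 forest_count_1 unfolding forest_count_def by simp_all
          moreover have "a0 = 0 \<or> a0 = 1" "a1 = 0 \<or> a1 = 1" using a by auto
          ultimately show "fragment_weight j (card (\<B> j)) = fragment_weight j (card (\<A> j)) + (if j = 0 then fragment_weight 0 a0 else 0) + (if j = 1 then fragment_weight 1 a1 else 0)"
            using A(2)[of 0] A(2)[of 1] z by (auto simp: \<B>_def)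
        qed
        also have "\<dots> = (\<Sum>j<J. fragment_weight j (card (\<A> j))) + fragment_weight 0 a0 + fragment_weight 1 a1"
          using J(2) by (simp add: sum.distrib sum.delta)
        finally have "dist (\<Sum>j. fragment_weight j (card (\<B> j))) t \<le> tail_weight J"
          using A(3,4) t by (simp add: dist_real_def)
        moreover have "lim (forest_prob \<phi>) = (\<Sum>j. fragment_weight j (card (\<B> j)))" using \<phi>(2) by (rule limI)
        ultimately have "dist (lim (forest_prob \<phi>)) t < \<epsilon>" using J(1) by simp
        then show "\<exists>y\<in>?L. dist y t < \<epsilon>" using \<phi>(1) by blast
      qed
    qed
  qed
qed

end
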